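(* Let $X:[0,1]\to\mathbb{R}^d$ be a continuous $d$-dimensional centered Gaussian process whose components are i.i.d. copies of a scalar process $X_0$ whose canonical metric $\delta$ satisfies Condition $(\Gamma)$ for a function $\gamma$. Then: (i) For every Borel set $E\subset[0,1]$, almost surely $\dim_{\mathrm{euc}}(X(E))\ge d\wedge\dim_\delta(E)$, and almost surely $\dim_{\rho_\delta}(Gr_E(X))\ge\dim_\delta(E)$. (ii) If in addition $\gamma$ satisfies Condition $(\mathbf{C_\varepsilon})$ for some $\varepsilon\in(0,1)$, then for every Borel set $E\subset[0,1]$, almost surely $$\dim_\delta(E)\wedge d\le\dim_{\mathrm{euc}}(X(E))\le d\wedge(\dim_\delta(E)+\varepsilon d)$$ and almost surely $$\dim_\delta(E)\le\dim_{\rho_\delta}(Gr_E(X))\le\dim_\delta(E)+\varepsilon d .$$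
   Context: $\delta(s,t):=(\mathbb{E}(X_0(s)-X_0(t))^2)^{1/2}$. $\gamma$ is continuous increasing (near $0$) with $\lim_{r\downarrow0}\gamma(r)=0$. Condition $(\Gamma)$: for some $l\ge1$ and all $s,t$: $\mathbb{E}(X_0(t)^2)=\gamma^2(t)$ and $l^{-1/2}\gamma(|t-s|)\le\delta(s,t)\le l^{1/2}\gamma(|t-s|)$. Condition $(\mathbf{C_\varepsilon})$: there exist $\mathsf{c}_\varepsilon>0$, $x_\varepsilon>0$ with $\int_0^{1/2}\gamma(xy)\frac{dy}{y\sqrt{\log(1/y)}}\le\mathsf{c}_\varepsilon(\gamma(x))^{1-\varepsilon}$ for all $0<x<x_\varepsilon$. For a metric $\rho$ on a space, $\mathcal{H}^\beta_\rho(G):=\lim_{\eta\to0}\inf\{\sum_n(2r_n)^\beta: G\subseteq\bigcup_n B_\rho(x_n,r_n),\ r_n\le\eta\}$ (balls in $\rho$) and $\dim_\rho(G):=\sup\{\beta>0:\mathcal{H}^\beta_\rho(G)>0\}$. $\dim_\delta$ is this with $\rho=\delta$ on $[0,1]$; $\dim_{\mathrm{euc}}$ is the usual Euclidean Hausdorff dimension; $\rho_\delta((s,x),(t,y)):=\max\{\delta(s,t),\|x-y\|\}$ on $\mathbb{R}_+\times\mathbb{R}^d$. $Gr_E(X):=\{(t,X(t)):t\in E\}$. *)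

theory Defs
  imports "HOL-Probability.Probability"
begin

definition hcontent :: "'a set \<Rightarrow> ('a \<Rightarrow> 'a \<Rightarrow> real) \<Rightarrow> real \<Rightarrow> real \<Rightarrow> 'a set \<Rightarrow> ennreal" where
  "hcontent S \<rho> \<beta> \<eta> G =
     (INF p \<in> {(c, r). (\<forall>n::nat. c n \<in> S \<and> 0 \<le> r n \<and> r n \<le> \<eta>) \<and>
                       G \<subseteq> (\<Union>n. {y \<in> S. \<rho> (c n) y < r n})}.
        (\<Sum>n. ennreal ((2 * snd p n) powr \<beta>)))"

(* the limit as eta -> 0 of a monotone (nonincreasing in eta) quantity = its supremum *)
definition hmeasure :: "'a set \<Rightarrow> ('a \<Rightarrow> 'a \<Rightarrow> real) \<Rightarrow> real \<Rightarrow> 'a set \<Rightarrow> ennreal" where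
  "hmeasure S \<rho> \<beta> G = (SUP \<eta> \<in> {0<..}. hcontent S \<rho> \<beta> \<eta> G)"

definition hdim :: "'a set \<Rightarrow> ('a \<Rightarrow> 'a \<Rightarrow> real) \<Rightarrow> 'a set \<Rightarrow> ereal" where
  "hdim S \<rho> G = Sup (insert 0 (ereal ` {\<beta>. 0 < \<beta> \<and> 0 < hmeasure S \<rho> \<beta> G}))"

definition can_metric :: "'a measure \<Rightarrow> ('a \<Rightarrow> real \<Rightarrow> real) \<Rightarrow> real \<Rightarrow> real \<Rightarrow> real" where
  "can_metric M X0 s t = sqrt (\<integral>\<omega>. (X0 \<omega> s - X0 \<omega> t)\<^sup>2 \<partial>M)"

definition graph_metric :: "(real \<Rightarrow> real \<Rightarrow> real) \<Rightarrow> real \<times> 'v::real_normed_vector \<Rightarrow> real \<times> 'v \<Rightarrow> real" where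
  "graph_metric \<delta> p q = max (\<delta> (fst p) (fst q)) (norm (snd p - snd q))"

definition centered_gaussian_rv :: "'a measure \<Rightarrow> ('a \<Rightarrow> real) \<Rightarrow> bool" where
  "centered_gaussian_rv M Y \<longleftrightarrow> Y \<in> borel_measurable M \<and>
     ((AE \<omega> in M. Y \<omega> = 0) \<or> (\<exists>\<sigma>>0. distributed M lborel Y (normal_density 0 \<sigma>)))"

definition centered_gaussian_process :: "'a measure \<Rightarrow> ('a \<Rightarrow> real \<Rightarrow> real) \<Rightarrow> bool" where
  "centered_gaussian_process M X0 \<longleftrightarrow>
     (\<forall>(n::nat) (t::nat \<Rightarrow> real) (c::nat \<Rightarrow> real). (\<forall>i<n. t i \<in> {0..1}) \<longrightarrow>
        centered_gaussian_rv M (\<lambda>\<omega>. \<Sum>i<n. c i * X0 \<omega> (t i)))"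

definition admissible_gamma :: "(real \<Rightarrow> real) \<Rightarrow> bool" where
  "admissible_gamma \<gamma> \<longleftrightarrow> (\<exists>r>0. continuous_on {0..r} \<gamma> \<and> strict_mono_on {0..r} \<gamma>) \<and>
     (\<gamma> \<longlongrightarrow> 0) (at_right 0)"

definition condition_Gamma :: "'a measure \<Rightarrow> ('a \<Rightarrow> real \<Rightarrow> real) \<Rightarrow> (real \<Rightarrow> real) \<Rightarrow> bool" where
  "condition_Gamma M X0 \<gamma> \<longleftrightarrow> (\<exists>l::real. l \<ge> 1 \<and>
     (\<forall>t\<in>{0..1}. (\<integral>\<omega>. (X0 \<omega> t)\<^sup>2 \<partial>M) = (\<gamma> t)\<^sup>2) \<and>
     (\<forall>s\<in>{0..1}. \<forall>t\<in>{0..1}.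
        \<gamma> \<bar>t - s\<bar> / sqrt l \<le> can_metric M X0 s t \<and> can_metric M X0 s t \<le> sqrt l * \<gamma> \<bar>t - s\<bar>))"

definition condition_C :: "(real \<Rightarrow> real) \<Rightarrow> real \<Rightarrow> bool" where
  "condition_C \<gamma> \<epsilon> \<longleftrightarrow> (\<exists>c>0. \<exists>x0>0. \<forall>x. 0 < x \<and> x < x0 \<longrightarrow>
     (\<integral>\<^sup>+ y \<in> {0<..1/2}. ennreal (\<gamma> (x * y) / (y * sqrt (ln (1 / y)))) \<partial>lborel)
       \<le> ennreal (c * (\<gamma> x) powr (1 - \<epsilon>)))"

end

theory Submission
  imports Defs
begin

text \<open>
  The metric \<open>\<delta>\<close> is comparable to \<open>\<gamma>\<close> of the Euclidean distance, and \<open>\<gamma>\<close> is doubling, so \<open>\<delta>\<close>-Hausdorff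
  null sets are exactly the null sets of a content defined with dyadic cells of weight \<open>\<gamma>(2\<^bsup>-n\<^esup>)\<^bsup>\<beta>\<^esup>\<close>.

  Lower bound. Cells form a net, so the content is continuous along increasing sequences of arbitrary
  sets; hence Borel sets are capacitable and carry Frostman measures. As \<open>d\<close> independent
  components give \<open>P(|X(s) - X(t)| < r) \<le> (r / \<delta>(s,t))\<^bsup>d\<^esup>\<close>, the image of such a measure has almost surely
  finite \<open>\<alpha>\<close>-energy for \<open>\<alpha>\<close> below \<open>d\<close> and below the growth exponent. For the graph, the projection to
  the time axis does not increase distances.

  Upper bound. By the entropy condition, the \<open>d\<close>-th moment of the oscillation of \<open>X\<close> over an interval of
  \<open>\<delta>\<close>-diameter \<open>r\<close> is of order \<open>r\<^bsup>(1-\<epsilon>)d\<^esup>\<close>, so the graph over it is covered by about \<open>r\<^bsup>-\<epsilon>d\<^esup>\<close> balls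
  of radius \<open>r\<close>; the image is a projection of the graph.
\<close>

subsection \<open>Dyadic net contents\<close>

text \<open>Two restrictions shape the argument. The set \<open>E\<close> is only Borel, so positive
  mass has to be kept while its Souslin representation is cut down to a compact one; the increasing
  sets property that this consumes rests on strong subadditivity, obtained by keeping only the
  maximal cells of a union. And \<gamma> is controlled only near 0, so times are compared through it
  only inside one cell of a fixed level \<open>n0\<close>; larger scales cost a constant. Doubling
  comes from the triangle inequality for \<delta>. In the upper bound the supremum of the path over
  a cell is never integrated. It is dominated pathwise by a countable sum of exponentials of squared
  increments, the energy of the cell, which is measurable and has a mean bounded uniformly in the
  cell. The energy q enters the covering count linearly because (1 + sqrt (ln q))^d is at most a
  constant times q. Covers of \<open>E\<close> of weight 2^-N thus yield graph covers whose expected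
  weights are summable. Almost sure statements are proved for rational exponents and then
  extended.\<close>

definition cell :: "nat \<Rightarrow> real \<Rightarrow> nat \<times> int" where
  "cell n x = (n, \<lfloor>2 ^ n * x\<rfloor>)"

definition net_cover :: "(nat \<times> int) set \<Rightarrow> real set" where
  "net_cover W = {x. \<exists>n. cell n x \<in> W}"

text \<open>Encoding the weight of a family of cells as a measure turns inclusion-exclusion and
  increasing unions of families into facts about \<open>emeasure\<close>.\<close>

definition net_weight :: "(nat \<Rightarrow> ennreal) \<Rightarrow> (nat \<times> int) measure" where
  "net_weight \<phi> = density (count_space UNIV) (\<phi> \<circ> fst)"

definition net_content :: "(nat \<Rightarrow> ennreal) \<Rightarrow> real set \<Rightarrow> ennreal" where
  "net_content \<phi> A = (INF W \<in> {W. A \<subseteq> net_cover W}. emeasure (net_weight \<phi>) W)"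

text \<open>The level-\<open>m\<close> index is the level-\<open>n\<close> index divided by
  \<open>2 ^ (n - m)\<close>, so the finer cell determines the coarser one. This nesting is the net
  property.\<close>

lemma floor_power2_mult_mono:
  fixes x y :: real
  assumes "m \<le> n" "\<lfloor>2 ^ n * x\<rfloor> = \<lfloor>2 ^ n * y\<rfloor>"
  shows "\<lfloor>2 ^ m * x\<rfloor> = \<lfloor>2 ^ m * y\<rfloor>"
proof -
  have *: "\<lfloor>2 ^ m * z\<rfloor> = \<lfloor>2 ^ n * z\<rfloor> div 2 ^ (n - m)" for z :: real
  proof -
    have "2 ^ m * z = 2 ^ n * z / real (2 ^ (n - m))"
      using assms(1) power_add[of "2::real" m "n - m"] by (simp add: field_simps)
    then show ?thesis
      using floor_divide_real_eq_div[of "2 ^ (n - m)" "2 ^ n * z"] by simp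
  qed
  show ?thesis unfolding *[of x] *[of y] assms(2) ..
qed

lemma cell_eq_mono: "cell n x = cell n y \<Longrightarrow> m \<le> n \<Longrightarrow> cell m x = cell m y"
  using floor_power2_mult_mono[of m n x y] by (simp add: cell_def)

lemma sets_net_weight [simp, measurable_cong]: "sets (net_weight \<phi>) = UNIV"
  by (simp add: net_weight_def)

lemma space_net_weight [simp]: "space (net_weight \<phi>) = UNIV"
  by (simp add: net_weight_def)

abbreviation "weight \<phi> \<equiv> emeasure (net_weight \<phi>)"

lemma emeasure_net_weight:
  "weight \<phi> W = (\<integral>\<^sup>+ w. \<phi> (fst w) \<partial>count_space W)"
  by (simp add: net_weight_def emeasure_density nn_integral_count_space_indicator)

lemma emeasure_net_weight_le_card:
  "finite K \<Longrightarrow> weight \<phi> (Pair n ` K) \<le> of_nat (card K) * \<phi> n"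
  by (simp add: emeasure_net_weight nn_integral_count_space_finite sum.reindex inj_on_def)

lemma net_content_le: "A \<subseteq> net_cover W \<Longrightarrow> net_content \<phi> A \<le> weight \<phi> W"
  unfolding net_content_def by (rule INF_lower) auto

lemma net_content_mono: "A \<subseteq> B \<Longrightarrow> net_content \<phi> A \<le> net_content \<phi> B"
  unfolding net_content_def by (rule INF_superset_mono) auto

lemma net_content_empty [simp]: "net_content \<phi> {} = 0"
  using net_content_le[of "{}" "{}" \<phi>] by simp

lemma net_content_coverE:
  assumes "net_content \<phi> A < top" "0 < e"
  obtains W where "A \<subseteq> net_cover W" "weight \<phi> W \<le> net_content \<phi> A + e"
proof -
  have "net_content \<phi> A < net_content \<phi> A + e"
    using assms by (cases "net_content \<phi> A"; cases e) (auto simp: ennreal_less_iff simp flip: ennreal_plus)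
  then obtain W where "A \<subseteq> net_cover W" "weight \<phi> W < net_content \<phi> A + e"
    unfolding net_content_def INF_less_iff by auto
  then show ?thesis using that by (auto intro: less_imp_le)
qed

lemma net_cover_Union: "net_cover (\<Union>i\<in>I. W i) = (\<Union>i\<in>I. net_cover (W i))"
  by (auto simp: net_cover_def)

lemma suminf_ennreal_half_powers: "0 \<le> e \<Longrightarrow> (\<Sum>i. ennreal (e * (1/2) ^ Suc i)) = ennreal e"
  using sums_mult[OF power_half_series, of e] by (intro suminf_ennreal_eq) auto

lemma net_content_UN_le:
  "net_content \<phi> (\<Union>i. A i) \<le> (\<Sum>i::nat. net_content \<phi> (A i))"
proof (cases "\<exists>i. net_content \<phi> (A i) = top")
  case True
  then obtain i where "net_content \<phi> (A i) = top" by auto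
  then have "(\<Sum>i. net_content \<phi> (A i)) = top"
    using sum_le_suminf[of "\<lambda>i. net_content \<phi> (A i)" "{i}"] by (simp add: top_unique)
  then show ?thesis by simp
next
  case False
  show ?thesis
  proof (rule ennreal_le_epsilon)
    fix e :: real assume "0 < e"
    have "\<exists>W. A i \<subseteq> net_cover W \<and>
        weight \<phi> W \<le> net_content \<phi> (A i) + ennreal (e * (1/2) ^ Suc i)" for i
      using False \<open>0 < e\<close>
      by (metis (no_types, lifting) net_content_coverE ennreal_less_zero_iff less_top mult_pos_pos
          zero_less_power half_gt_zero_iff zero_less_one)
    then obtain W where W: "\<And>i. A i \<subseteq> net_cover (W i)"
      "\<And>i. weight \<phi> (W i) \<le> net_content \<phi> (A i) + ennreal (e * (1/2) ^ Suc i)"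
      by metis
    have "net_content \<phi> (\<Union>i. A i) \<le> weight \<phi> (\<Union>i. W i)"
      using W(1) by (intro net_content_le) (fastforce simp: net_cover_Union)
    also have "... \<le> (\<Sum>i. weight \<phi> (W i))"
      by (intro emeasure_subadditive_countably) auto
    also have "... \<le> (\<Sum>i. net_content \<phi> (A i) + ennreal (e * (1/2) ^ Suc i))"
      using W(2) by (intro suminf_le) auto
    also have "... = (\<Sum>i. net_content \<phi> (A i)) + (\<Sum>i. ennreal (e * (1/2) ^ Suc i))"
      by (rule suminf_add[symmetric]) auto
    finally show "net_content \<phi> (\<Union>i. A i) \<le> (\<Sum>i. net_content \<phi> (A i)) + ennreal e"
      unfolding suminf_ennreal_half_powers[OF less_imp_le[OF \<open>0 < e\<close>]] .
  qed
qed

lemma net_content_Un_le: "net_content \<phi> (A \<union> B) \<le> net_content \<phi> A + net_content \<phi> B"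
proof -
  let ?A = "\<lambda>i::nat. if i = 0 then A else if i = 1 then B else {}"
  have "net_content \<phi> (\<Union>i. ?A i) \<le> (\<Sum>i. net_content \<phi> (?A i))"
    by (rule net_content_UN_le)
  also have "... = (\<Sum>i\<in>{0,1}. net_content \<phi> (?A i))"
    by (rule suminf_finite) auto
  also have "... = net_content \<phi> A + net_content \<phi> B" by simp
  also have "(\<Union>i. ?A i) = A \<union> B"
    by (auto split: if_splits)
  finally show ?thesis .
qed

lemma net_content_UN_finite_le:
  "finite I \<Longrightarrow> net_content \<phi> (\<Union>i\<in>I. A i) \<le> (\<Sum>i\<in>I. net_content \<phi> (A i))"
proof (induction rule: finite_induct)
  case (insert i I)
  then show ?case
    using net_content_Un_le[of \<phi> "A i" "\<Union>i\<in>I. A i"] add_left_mono[OF insert.IH, of "net_content \<phi> (A i)"]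
    by (auto intro: order_trans)
qed simp

text \<open>Such a set meets only the level-\<open>n\<close> cell of \<open>s\<close> and its two
  neighbours, whence the 3 that recurs in the growth bounds.\<close>

lemma net_content_short:
  assumes "\<And>x. x \<in> A \<Longrightarrow> \<bar>x - s\<bar> \<le> 1 / 2 ^ n"
  shows "net_content \<phi> A \<le> 3 * \<phi> n"
proof -
  let ?k = "\<lfloor>2 ^ n * s\<rfloor>"
  have "A \<subseteq> net_cover (Pair n ` {?k - 1, ?k, ?k + 1})"
  proof
    fix x assume "x \<in> A"
    then have "\<bar>2 ^ n * x - 2 ^ n * s\<bar> \<le> 1"
      using assms[of x] by (simp add: field_simps abs_if split: if_splits)
    then have "\<lfloor>2 ^ n * x\<rfloor> \<in> {?k - 1, ?k, ?k + 1}"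
      by simp linarith
    then show "x \<in> net_cover (Pair n ` {?k - 1, ?k, ?k + 1})"
      by (auto simp: net_cover_def cell_def)
  qed
  then have "net_content \<phi> A \<le> weight \<phi> (Pair n ` {?k - 1, ?k, ?k + 1})"
    by (rule net_content_le)
  also have "... \<le> of_nat (card {?k - 1, ?k, ?k + 1}) * \<phi> n"
    by (rule emeasure_net_weight_le_card) simp
  also have "card {?k - 1, ?k, ?k + 1} = 3" by simp
  finally show ?thesis by simp
qed

text \<open>Any two cells are nested or disjoint, so these form a disjoint subfamily with the same union.\<close>

definition maximal_cells :: "(nat \<times> int) set \<Rightarrow> (nat \<times> int) set" where
  "maximal_cells W = {p \<in> W. \<not> (\<exists>x m n. m < n \<and> cell m x \<in> W \<and> cell n x = p)}"

text \<open>The coarsest cell of \<open>W\<close> around \<open>x\<close> is maximal, so discarding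
  all other cells leaves the covered set unchanged.\<close>

lemma least_cell_maximal:
  assumes "x \<in> net_cover W"
  obtains n where "cell n x \<in> maximal_cells W" "\<And>m. m < n \<Longrightarrow> cell m x \<notin> W"
proof -
  define n where "n = (LEAST n. cell n x \<in> W)"
  have n: "cell n x \<in> W"
    using assms unfolding n_def net_cover_def by (auto intro: LeastI)
  have least: "cell m x \<notin> W" if "m < n" for m
    using not_less_Least that unfolding n_def by blast
  have "False" if "m < n'" "cell m y \<in> W" "cell n' y = cell n x" for y m n'
  proof -
    have [simp]: "n' = n" using that by (simp add: cell_def)
    have "cell m y = cell m x" using cell_eq_mono[of n y x m] that by auto
    then show False using least[of m] that by auto
  qed
  then have "cell n x \<in> maximal_cells W" using n unfolding maximal_cells_def by blast
  then show ?thesis using that least by blast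
qed

lemma maximal_cells_subset: "maximal_cells W \<subseteq> W"
  by (auto simp: maximal_cells_def)

lemma maximal_cells_antimono: "p \<in> maximal_cells W \<Longrightarrow> p \<in> V \<Longrightarrow> V \<subseteq> W \<Longrightarrow> p \<in> maximal_cells V"
  unfolding maximal_cells_def by blast

text \<open>Strong subadditivity of the net content: the cells of two covers that are not maximal in
  their union, together with the common ones, still cover the intersection.\<close>

lemma net_content_increasing_step:
  assumes "A \<subseteq> net_cover V" "A \<subseteq> net_cover W"
  shows "weight \<phi> (maximal_cells (V \<union> W)) + net_content \<phi> A
    \<le> weight \<phi> (maximal_cells V) + weight \<phi> W"
proof -
  let ?\<mu> = "weight \<phi>" and ?U = "maximal_cells (V \<union> W)" and ?V = "maximal_cells V"
  let ?R = "(?V \<union> W) - ?U"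
  have sub: "?U \<subseteq> ?V \<union> W"
    using maximal_cells_antimono[of _ "V \<union> W" V] maximal_cells_subset[of "V \<union> W"] by blast
  \<comment> \<open>Around each point a cell of each family is at hand. Equal cells are common; of
    two different ones the finer is not maximal in the union and lies in \<open>?R\<close>.\<close>
  have "A \<subseteq> net_cover (?R \<union> (?V \<inter> W))"
  proof
    fix x assume "x \<in> A"
    then have "x \<in> net_cover V" "x \<in> net_cover W" using assms by auto
    then obtain m n where m: "cell m x \<in> ?V" and n: "cell n x \<in> W"
      using least_cell_maximal[of x V] unfolding net_cover_def by blast
    have mV: "cell m x \<in> V" using m maximal_cells_subset by auto
    consider "m = n" | "m < n" | "n < m" by linarith
    then show "x \<in> net_cover (?R \<union> (?V \<inter> W))"
    proof cases
      case 1
      then show ?thesis using m n by (auto simp: net_cover_def)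
    next
      case 2
      then have "cell n x \<notin> ?U" using mV unfolding maximal_cells_def by blast
      then show ?thesis using n by (auto simp: net_cover_def)
    next
      case 3
      then have "cell m x \<notin> ?U" using n unfolding maximal_cells_def by blast
      then show ?thesis using m by (auto simp: net_cover_def)
    qed
  qed
  then have "net_content \<phi> A \<le> ?\<mu> (?R \<union> (?V \<inter> W))" by (rule net_content_le)
  also have "... \<le> ?\<mu> ?R + ?\<mu> (?V \<inter> W)" by (rule emeasure_subadditive) auto
  finally have "?\<mu> ?U + net_content \<phi> A \<le> ?\<mu> ?U + (?\<mu> ?R + ?\<mu> (?V \<inter> W))"
    by (rule add_left_mono)
  also have "... = (?\<mu> ?U + ?\<mu> ?R) + ?\<mu> (?V \<inter> W)" by (simp add: add.assoc)
  also have "?\<mu> ?U + ?\<mu> ?R = ?\<mu> (?V \<union> W)"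
    using sub by (subst plus_emeasure) (auto intro!: arg_cong[where f = ?\<mu>])
  also have "?\<mu> (?V \<union> W) + ?\<mu> (?V \<inter> W) = ?\<mu> ?V + ?\<mu> W"
  proof -
    have "?\<mu> (?V \<union> W) = ?\<mu> ?V + ?\<mu> (W - ?V)"
      by (subst plus_emeasure) (auto intro!: arg_cong[where f = ?\<mu>])
    moreover have "?\<mu> W = ?\<mu> (W - ?V) + ?\<mu> (?V \<inter> W)"
      by (subst plus_emeasure) (auto intro!: arg_cong[where f = ?\<mu>])
    ultimately show ?thesis by (simp add: add.assoc)
  qed
  finally show ?thesis .
qed

text \<open>Near-optimal covers with errors summing to \<open>e\<close> are merged one at a time. By
  strong subadditivity the maximal cells of the covers up to \<open>n\<close> weigh no more than the
  content of \<open>A n\<close> plus the errors used so far. Only covers are handled, so the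
  \<open>A n\<close> may be arbitrary sets.\<close>

lemma net_content_incseq_le:
  assumes "incseq A" and bound: "\<And>n. net_content \<phi> (A n) \<le> c" and "c < top"
  shows "net_content \<phi> (\<Union>n. A n) \<le> c"
proof (rule ennreal_le_epsilon)
  fix e :: real assume e: "0 < e"
  let ?\<mu> = "weight \<phi>" and ?C = "net_content \<phi>"
  define \<epsilon> where "\<epsilon> i = ennreal (e * (1/2) ^ Suc i)" for i
  have fin: "?C (A n) < top" for n using bound[of n] \<open>c < top\<close> by (rule order.strict_trans1)
  have "\<exists>W. A i \<subseteq> net_cover W \<and> ?\<mu> W \<le> ?C (A i) + \<epsilon> i" for i
    using fin[of i] e net_content_coverE[of \<phi> "A i" "\<epsilon> i"] unfolding \<epsilon>_def by force
  then obtain W where W: "\<And>i. A i \<subseteq> net_cover (W i)" "\<And>i. ?\<mu> (W i) \<le> ?C (A i) + \<epsilon> i"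
    by metis
  define T where "T n = (\<Union>i\<le>n. W i)" for n
  define U where "U n = maximal_cells (T n)" for n
  have U: "?\<mu> (U n) \<le> ?C (A n) + (\<Sum>i\<le>n. \<epsilon> i)" for n
  proof (induction n)
    case 0
    have "?\<mu> (U 0) \<le> ?\<mu> (W 0)"
      unfolding U_def T_def using maximal_cells_subset by (intro emeasure_mono) auto
    then show ?case using W(2)[of 0] by (auto intro: order_trans)
  next
    case (Suc n)
    have "A n \<subseteq> net_cover (T n)" using W(1)[of n] by (fastforce simp: T_def net_cover_def)
    moreover have "A n \<subseteq> net_cover (W (Suc n))"
      using W(1)[of "Suc n"] \<open>incseq A\<close> by (meson incseq_SucD subset_trans)
    moreover have "T (Suc n) = T n \<union> W (Suc n)" by (auto simp: T_def atMost_Suc)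
    ultimately have "?\<mu> (U (Suc n)) + ?C (A n) \<le> ?\<mu> (U n) + ?\<mu> (W (Suc n))"
      unfolding U_def using net_content_increasing_step by metis
    also have "... \<le> (?C (A n) + (\<Sum>i\<le>n. \<epsilon> i)) + (?C (A (Suc n)) + \<epsilon> (Suc n))"
      by (intro add_mono Suc.IH W(2))
    also have "... = (?C (A (Suc n)) + (\<Sum>i\<le>Suc n. \<epsilon> i)) + ?C (A n)" by (simp add: ac_simps)
    finally show ?case using fin[of n]
      by (metis add.commute ennreal_add_left_cancel_le infinity_ennreal_def less_irrefl)
  qed
  have sum_eps: "(\<Sum>i\<le>n. \<epsilon> i) \<le> ennreal e" for n
  proof -
    have "(\<Sum>i\<le>n. \<epsilon> i) \<le> (\<Sum>i. \<epsilon> i)" by (rule sum_le_suminf) auto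
    also have "... = ennreal e"
      unfolding \<epsilon>_def by (rule suminf_ennreal_half_powers) (use e in simp)
    finally show ?thesis .
  qed
  define V where "V = maximal_cells (\<Union>i. W i)"
  have "(\<Union>n. A n) \<subseteq> net_cover V"
  proof
    fix x assume "x \<in> (\<Union>n. A n)"
    then have "x \<in> net_cover (\<Union>i. W i)" using W(1) by (fastforce simp: net_cover_def)
    then show "x \<in> net_cover V" unfolding V_def
      using least_cell_maximal by (metis (mono_tags, lifting) mem_Collect_eq net_cover_def)
  qed
  then have "?C (\<Union>n. A n) \<le> ?\<mu> V" by (rule net_content_le)
  \<comment> \<open>A maximal cell of the whole union that already occurs in \<open>T n\<close> is
    maximal there too, so the bounds on \<open>U n\<close> pass to the increasing union
    \<open>V\<close>.\<close>
  also have "?\<mu> V \<le> ?\<mu> (\<Union>n. V \<inter> T n)"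
    by (intro emeasure_mono) (auto simp: V_def T_def maximal_cells_def)
  also have "... = (SUP n. ?\<mu> (V \<inter> T n))"
    by (rule SUP_emeasure_incseq[symmetric]) (fastforce simp: incseq_def T_def)+
  also have "... \<le> c + ennreal e"
  proof (rule SUP_least)
    fix n
    have "V \<inter> T n \<subseteq> U n"
      unfolding V_def U_def using maximal_cells_antimono[of _ "\<Union>i. W i" "T n"] by (auto simp: T_def)
    then have "?\<mu> (V \<inter> T n) \<le> ?\<mu> (U n)" by (rule emeasure_mono) simp
    also have "... \<le> c + ennreal e" using U[of n] bound[of n] sum_eps[of n]
      by (meson add_mono order_trans)
    finally show "?\<mu> (V \<inter> T n) \<le> c + ennreal e" .
  qed
  finally show "?C (\<Union>n. A n) \<le> c + ennreal e" .
qed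

subsection \<open>Borel sets as projections of closed sets\<close>

text \<open>These are the analytic (Souslin) sets, written as projections along Baire space with its
  product of discrete topologies.\<close>

definition proj_closed :: "'a::metric_space set \<Rightarrow> bool" where
  "proj_closed A \<longleftrightarrow> (\<exists>R :: ('a \<times> (nat \<Rightarrow> nat)) set. closed R \<and> A = fst ` R)"

lemma proj_closed_closed: "closed A \<Longrightarrow> proj_closed A"
  unfolding proj_closed_def
  by (rule exI[of _ "A \<times> UNIV"]) (auto intro: closed_Times)

text \<open>Reading off a subsequence of the coordinates is continuous. The subsequences used are
  the tail and one row of the pairing function.\<close>

lemma closed_vimage_reindex:
  fixes R :: "('a::metric_space \<times> (nat \<Rightarrow> nat)) set"
  assumes "closed R"
  shows "closed {p. (fst p, \<lambda>n. snd p (g n :: nat)) \<in> R}"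
proof -
  have "continuous_on UNIV (\<lambda>p::'a \<times> (nat \<Rightarrow> nat). (fst p, \<lambda>n. snd p (g n)))"
    by (intro continuous_on_Pair continuous_on_fst continuous_on_id
        continuous_on_coordinatewise_then_product
        continuous_on_product_then_coordinatewise[OF continuous_on_snd[OF continuous_on_id]])
  with assms have "closed ((\<lambda>p::'a \<times> (nat \<Rightarrow> nat). (fst p, \<lambda>n. snd p (g n))) -` R)"
    by (rule closed_vimage)
  then show ?thesis by (simp add: vimage_def)
qed

lemma closed_coordinate:
  "closed {p::'a::metric_space \<times> (nat \<Rightarrow> nat). snd p m \<in> S}"
proof -
  have "continuous_on UNIV (\<lambda>p::'a \<times> (nat \<Rightarrow> nat). snd p m)"
    by (rule continuous_on_product_then_coordinatewise[OF continuous_on_snd[OF continuous_on_id]])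
  moreover have "closed S"
    unfolding closed_def by (rule discrete_topology_class.open_discrete)
  ultimately have "closed ((\<lambda>p::'a \<times> (nat \<Rightarrow> nat). snd p m) -` S)"
    by (simp add: closed_vimage)
  then show ?thesis by (simp add: vimage_def)
qed

lemma proj_closed_UN:
  fixes A :: "nat \<Rightarrow> 'a::metric_space set"
  assumes "\<And>i. proj_closed (A i)"
  shows "proj_closed (\<Union>i. A i)"
proof -
  have "\<forall>i. \<exists>R :: ('a \<times> (nat \<Rightarrow> nat)) set. closed R \<and> A i = fst ` R"
    using assms unfolding proj_closed_def by blast
  then obtain R :: "nat \<Rightarrow> ('a \<times> (nat \<Rightarrow> nat)) set"
    where R: "\<And>i. closed (R i)" "\<And>i. A i = fst ` R i"
    by metis
  \<comment> \<open>Coordinate 0 names the set to which the point belongs; the later ones carry the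
    witness for it.\<close>
  define Q where "Q = (\<Inter>i. {p. snd p 0 \<in> - {i}} \<union> {p. (fst p, \<lambda>n. snd p (Suc n)) \<in> R i})"
  have "closed Q" unfolding Q_def
    by (intro closed_INT ballI closed_Un closed_coordinate closed_vimage_reindex R)
  moreover have "(\<Union>i. A i) = fst ` Q"
  proof safe
    fix x i assume "x \<in> A i"
    then obtain s where "(x, s) \<in> R i" using R(2) by force
    then have "(x, case_nat i s) \<in> Q" by (auto simp: Q_def)
    then show "x \<in> fst ` Q" by force
  next
    fix x s assume "(x, s) \<in> Q"
    then have "(x, \<lambda>n. s (Suc n)) \<in> R (s 0)" by (auto simp: Q_def)
    then show "fst (x, s) \<in> (\<Union>i. A i)" using R(2) by force
  qed
  ultimately show ?thesis unfolding proj_closed_def by blast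
qed

lemma proj_closed_INT:
  fixes A :: "nat \<Rightarrow> 'a::metric_space set"
  assumes "\<And>i. proj_closed (A i)"
  shows "proj_closed (\<Inter>i. A i)"
proof -
  have "\<forall>i. \<exists>R :: ('a \<times> (nat \<Rightarrow> nat)) set. closed R \<and> A i = fst ` R"
    using assms unfolding proj_closed_def by blast
  then obtain R :: "nat \<Rightarrow> ('a \<times> (nat \<Rightarrow> nat)) set"
    where R: "\<And>i. closed (R i)" "\<And>i. A i = fst ` R i"
    by metis
  \<comment> \<open>One sequence stores a witness for every set, the \<open>i\<close>-th one in row
    \<open>i\<close> of the pairing.\<close>
  define Q where "Q = (\<Inter>i. {p. (fst p, \<lambda>n. snd p (prod_encode (i, n))) \<in> R i})"
  have "closed Q" unfolding Q_def
    by (intro closed_INT ballI closed_vimage_reindex R)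
  moreover have "(\<Inter>i. A i) = fst ` Q"
  proof safe
    fix x assume "x \<in> (\<Inter>i. A i)"
    then have "\<forall>i. \<exists>s. (x, s) \<in> R i" using R(2) by force
    then obtain s where "\<And>i. (x, s i) \<in> R i" by metis
    then have "(x, \<lambda>m. s (fst (prod_decode m)) (snd (prod_decode m))) \<in> Q" by (auto simp: Q_def)
    then show "x \<in> fst ` Q" by force
  next
    fix x s i assume "(x, s) \<in> Q"
    then show "fst (x, s) \<in> A i" using R(2) by (force simp: Q_def)
  qed
  ultimately show ?thesis unfolding proj_closed_def by blast
qed

text \<open>Projections of closed sets are not stable under complements, so the induction carries
  \<open>A\<close> and \<open>- A\<close> together. It starts because open sets of a metric space
  are F-sigma.\<close>

lemma proj_closed_borel:
  assumes "A \<in> sets (borel :: 'a::metric_space measure)"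
  shows "proj_closed A"
proof -
  have "A \<in> sigma_sets UNIV {S. closed S}"
    using assms by (simp add: borel_eq_closed)
  then have "proj_closed A \<and> proj_closed (- A)"
  proof (induction rule: sigma_sets.induct)
    case (Basic S)
    have "proj_closed T" if "open T" for T :: "'a set"
    proof -
      have "fsigma_in euclidean T"
        using that by (intro open_imp_fsigma_in metrizable_space_euclidean) simp
      then obtain F :: "nat \<Rightarrow> 'a set" where "\<And>n. closed (F n)" "T = (\<Union>n. F n)"
        unfolding fsigma_in_ascending by auto
      then show ?thesis using proj_closed_UN proj_closed_closed by metis
    qed
    then show ?case using Basic proj_closed_closed by (auto simp: open_Compl)
  next
    case Empty
    then show ?case using proj_closed_closed[of UNIV] proj_closed_closed[of "{}"] by simp
  next
    case (Compl a)
    then show ?case by (simp add: Compl_eq_Diff_UNIV[symmetric])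
  next
    case (Union a)
    then show ?case by (simp add: proj_closed_UN proj_closed_INT)
  qed
  then show ?thesis ..
qed

subsection \<open>Frostman's lemma for Borel sets\<close>

lemma tendsto_coordinatewise:
  fixes f :: "'c \<Rightarrow> 'a \<Rightarrow> 'b::topological_space"
  assumes "\<And>i. ((\<lambda>c. f c i) \<longlongrightarrow> l i) F"
  shows "(f \<longlongrightarrow> l) F"
proof -
  have "limitin (product_topology (\<lambda>i. euclidean) UNIV) f l F"
    unfolding limitin_componentwise using assms by simp
  then show ?thesis by (simp add: euclidean_product_topology)
qed

lemma tendsto_coordinate:
  fixes f :: "'c \<Rightarrow> 'a \<Rightarrow> 'b::topological_space"
  assumes "(f \<longlongrightarrow> l) F"
  shows "((\<lambda>c. f c i) \<longlongrightarrow> l i) F"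
proof -
  have "limitin (product_topology (\<lambda>i. euclidean) UNIV) f l F"
    using assms by (simp add: euclidean_product_topology)
  then show ?thesis unfolding limitin_componentwise by simp
qed

text \<open>A point of all the closures is a limit of points whose witnesses are bounded by
  \<open>k\<close> on longer and longer initial segments. The product of the finite sets
  \<open>{..k i}\<close> is compact, so the witnesses subconverge, and closedness of
  \<open>R\<close> keeps the limit pair in \<open>R\<close>.\<close>

lemma closure_sections_subset:
  fixes R :: "('a::metric_space \<times> (nat \<Rightarrow> nat)) set"
  assumes "closed R"
  shows "(\<Inter>n. closure {x. \<exists>s. (x, s) \<in> R \<and> (\<forall>i<n. s i \<le> k i)}) \<subseteq> fst ` R"
proof
  fix x assume x: "x \<in> (\<Inter>n. closure {x. \<exists>s. (x, s) \<in> R \<and> (\<forall>i<n. s i \<le> k i)})"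
  have "\<exists>p. p \<in> R \<and> (\<forall>i<n. snd p i \<le> k i) \<and> dist (fst p) x < inverse (Suc n)" for n
  proof -
    have "x \<in> closure {x. \<exists>s. (x, s) \<in> R \<and> (\<forall>i<n. s i \<le> k i)}" using x by blast
    then have "\<exists>y\<in>{x. \<exists>s. (x, s) \<in> R \<and> (\<forall>i<n. s i \<le> k i)}. dist y x < inverse (Suc n)"
      unfolding closure_approachable by (rule allE[of _ "inverse (Suc n)"]) simp
    then show ?thesis by force
  qed
  then have "\<exists>p. \<forall>n. p n \<in> R \<and> (\<forall>i<n. snd (p n) i \<le> k i) \<and> dist (fst (p n)) x < inverse (Suc n)"
    by (intro choice allI)
  then obtain p where p: "\<And>n. p n \<in> R" "\<And>n i. i < n \<Longrightarrow> snd (p n) i \<le> k i"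
    "\<And>n. dist (fst (p n)) x < inverse (Suc n)" by blast
  define y where "y n = fst (p n)" for n
  define s where "s n = snd (p n)" for n
  have ys: "\<And>n. (y n, s n) \<in> R" "\<And>n i. i < n \<Longrightarrow> s n i \<le> k i" "\<And>n. dist (y n) x < inverse (Suc n)"
    using p by (simp_all add: y_def s_def)
  \<comment> \<open>The bound by \<open>k\<close> holds for \<open>s n\<close> only below index
    \<open>n\<close>. Truncation moves the whole sequence into the compact box and eventually
    changes no given coordinate.\<close>
  define t where "t n i = min (s n i) (k i)" for n i
  have "compactin (product_topology (\<lambda>i. euclidean) UNIV) (PiE UNIV (\<lambda>i. {..k i}))"
    unfolding compactin_PiE by (simp add: finite_imp_compact)
  then have "compact (PiE UNIV (\<lambda>i. {..k i}))"
    by (simp add: euclidean_product_topology)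
  then have "seq_compact (PiE UNIV (\<lambda>i. {..k i}))" by (rule compact_imp_seq_compact)
  moreover have "t n \<in> PiE UNIV (\<lambda>i. {..k i})" for n by (simp add: t_def PiE_UNIV_domain)
  ultimately obtain l r where r: "strict_mono r" and lim: "(t \<circ> r) \<longlonglongrightarrow> l"
    unfolding seq_compact_def by blast
  have "(\<lambda>n. s (r n)) \<longlonglongrightarrow> l"
  proof (rule tendsto_coordinatewise)
    fix i
    have "(\<lambda>n. t (r n) i) \<longlonglongrightarrow> l i"
      using tendsto_coordinate[OF lim, of i] by (simp add: o_def)
    moreover have "\<forall>\<^sub>F n in sequentially. t (r n) i = s (r n) i"
      using eventually_gt_at_top[of i]
    proof eventually_elim
      case (elim n)
      then have "i < r n" using seq_suble[OF r, of n] by simp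
      then show ?case using ys(2) by (simp add: t_def)
    qed
    ultimately show "(\<lambda>n. s (r n) i) \<longlonglongrightarrow> l i" by (rule Lim_transform_eventually)
  qed
  moreover have "y \<longlonglongrightarrow> x"
  proof (rule metric_tendsto_imp_tendsto[OF LIMSEQ_inverse_real_of_nat])
    show "\<forall>\<^sub>F n in sequentially. dist (y n) x \<le> dist (inverse (real (Suc n))) 0"
      using ys(3) by (auto intro!: always_eventually less_imp_le)
  qed
  then have "(\<lambda>n. y (r n)) \<longlonglongrightarrow> x"
    using LIMSEQ_subseq_LIMSEQ[OF _ r, of y x] by (simp add: o_def)
  ultimately have "(\<lambda>n. (y (r n), s (r n))) \<longlonglongrightarrow> (x, l)" by (rule tendsto_Pair[rotated])
  then have "(x, l) \<in> R" by (rule closed_sequentially[OF assms, rotated]) (rule ys(1))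
  then show "x \<in> fst ` R" by force
qed

lemma open_null_if_Ioc_null:
  assumes "sets \<mu> = sets (borel :: real measure)" "open U"
    and null: "\<And>p q. {p<..q} \<subseteq> U \<Longrightarrow> emeasure \<mu> {p<..q} = 0"
  shows "U \<in> null_sets \<mu>"
proof -
  let ?I = "{I \<in> \<rat> \<times> \<rat>. {fst I<..snd I} \<subseteq> U}"
  have "U = (\<Union>I\<in>?I. {fst I<..snd I})"
  proof
    show "U \<subseteq> (\<Union>I\<in>?I. {fst I<..snd I})"
    proof
      fix x assume "x \<in> U"
      then obtain e where e: "0 < e" "ball x e \<subseteq> U" using \<open>open U\<close> open_contains_ball by blast
      obtain p where p: "p \<in> \<rat>" "x - e < p" "p < x" using Rats_dense_in_real[of "x - e" x] e by auto
      obtain q where q: "q \<in> \<rat>" "x < q" "q < x + e" using Rats_dense_in_real[of x "x + e"] e by auto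
      have "{p<..q} \<subseteq> ball x e" using p q by (auto simp: dist_real_def)
      then show "x \<in> (\<Union>I\<in>?I. {fst I<..snd I})" using p q e by (intro UN_I[of "(p, q)"]) auto
    qed
  qed auto
  moreover have "(\<Union>I\<in>?I. {fst I<..snd I}) \<in> null_sets \<mu>"
  proof (rule null_sets_UN')
    show "countable ?I" by (rule countable_subset[of _ "\<rat> \<times> \<rat>"]) (auto intro: countable_rat)
  qed (use null assms(1) in \<open>auto simp: null_sets_def\<close>)
  ultimately show ?thesis by simp
qed

text \<open>Capacitability: \<open>E\<close> is the projection of a closed set \<open>R\<close>, and the increasing sets lemma lets
  one bound the coordinates of the second component one after another without losing content.\<close>

theorem frostman_net_content:
  fixes \<phi> :: "nat \<Rightarrow> ennreal"
  assumes fin: "\<And>n. \<phi> n < top" and lim: "\<phi> \<longlonglongrightarrow> 0"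
    and E: "E \<in> sets borel" "E \<subseteq> {0..1}" and pos: "0 < net_content \<phi> E"
  obtains \<mu> where "sets \<mu> = sets borel" "finite_measure \<mu>" "emeasure \<mu> (- E) = 0" "0 < emeasure \<mu> E"
    "\<And>n a b. b - a \<le> 1 / 2 ^ n \<Longrightarrow> emeasure \<mu> {a<..b} \<le> 3 * \<phi> n"
proof -
  let ?C = "net_content \<phi>"
  obtain R :: "(real \<times> (nat \<Rightarrow> nat)) set" where R: "closed R" "E = fst ` R"
    using proj_closed_borel[OF E(1)] unfolding proj_closed_def by blast
  define P where "P k n = {x. \<exists>s. (x, s) \<in> R \<and> (\<forall>i<n. s i \<le> k i)}" for k :: "nat \<Rightarrow> nat" and n :: nat
  have P_E: "P k n \<subseteq> E" for k n unfolding P_def R(2) by force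
  have bounded: "?C A \<le> 3 * \<phi> 0" if "A \<subseteq> {0..1}" for A
    by (rule net_content_short[where s = 0]) (use that in force)
  have top: "3 * \<phi> n < top" for n using fin[of n] by (simp add: ennreal_mult_less_top)
  obtain a where a: "0 < a" "a < ?C E" using pos dense by blast
  have "a < top" using a by (meson less_trans order_less_le_trans top_greatest)
  have step: "\<exists>j. a < ?C (P (k(n := j)) (Suc n))" if "a < ?C (P k n)" for k n
  proof (rule ccontr)
    assume "\<not> ?thesis"
    then have le: "?C (P (k(n := j)) (Suc n)) \<le> a" for j by (simp add: not_less)
    have "incseq (\<lambda>j. P (k(n := j)) (Suc n))"
      unfolding incseq_def P_def by (fastforce simp: less_Suc_eq)
    then have "?C (\<Union>j. P (k(n := j)) (Suc n)) \<le> a"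
      using le \<open>a < top\<close> by (rule net_content_incseq_le)
    moreover have "P k n \<subseteq> (\<Union>j. P (k(n := j)) (Suc n))"
    proof
      fix x assume "x \<in> P k n"
      then obtain s where "(x, s) \<in> R" "\<forall>i<n. s i \<le> k i" unfolding P_def by blast
      then have "x \<in> P (k(n := s n)) (Suc n)" unfolding P_def by (auto simp: less_Suc_eq)
      then show "x \<in> (\<Union>j. P (k(n := j)) (Suc n))" by blast
    qed
    then have "?C (P k n) \<le> ?C (\<Union>j. P (k(n := j)) (Suc n))" by (rule net_content_mono)
    ultimately show False using that by (meson leD order_trans)
  qed
  have "\<exists>f. \<forall>n. a < ?C (P (f n) n) \<and> (\<exists>j. f (Suc n) = (f n)(n := j))"
  proof (rule dependent_nat_choice)
    have "P (\<lambda>_. 0) 0 = E" unfolding P_def R(2) by force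
    then show "\<exists>k. a < ?C (P k 0)" using a by metis
  qed (use step in blast)
  then obtain f where f: "\<And>n. a < ?C (P (f n) n)" "\<And>n. \<exists>j. f (Suc n) = (f n)(n := j)" by blast
  \<comment> \<open>Coordinate \<open>i\<close> is fixed at stage \<open>i + 1\<close> and never
    touched again, so each stage \<open>f n\<close> agrees below \<open>n\<close> with the single
    bound \<kappa>.\<close>
  define \<kappa> where "\<kappa> i = f (Suc i) i" for i
  have f_\<kappa>: "f n i = \<kappa> i" if "i < n" for n i
    using that
  proof (induction n)
    case (Suc n)
    show ?case
    proof (cases "i = n")
      case False
      moreover obtain j where "f (Suc n) = (f n)(n := j)" using f(2) by blast
      ultimately show ?thesis using Suc by simp
    qed (simp add: \<kappa>_def)
  qed simp
  define K where "K n = P \<kappa> n" for n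
  have K: "a < ?C (K n)" for n
  proof -
    have "P \<kappa> n = P (f n) n" unfolding P_def using f_\<kappa> by simp
    then show ?thesis using f(1) by (simp add: K_def)
  qed
  have K_E: "K n \<subseteq> E" for n using P_E by (simp add: K_def)
  have K_decseq: "K n \<subseteq> K m" if "m \<le> n" for m n unfolding K_def P_def using that by fastforce
  \<comment> \<open>Subadditivity of the content alone makes the increments of its distribution function small.\<close>
  define G where "G x = (INF n. ?C (K n \<inter> {..x}))" for x
  define F where "F x = enn2real (G x)" for x
  have G_bound: "G x \<le> 3 * \<phi> 0" for x
    unfolding G_def using K_E E(2) by (intro INF_lower2[of 0] bounded) auto
  have G_fin: "G x < top" for x using G_bound top by (rule order.strict_trans1)
  have G_mono: "G x \<le> G y" if "x \<le> y" for x y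
    unfolding G_def by (intro INF_mono' net_content_mono) (use that in auto)
  \<comment> \<open>The index \<open>n\<close> is free: passing to the larger of \<open>m\<close>
    and \<open>n\<close> shrinks both sections. So the growth of \<open>G\<close> over an interval
    is bounded by the content there of every \<open>K n\<close>.\<close>
  have G_incr: "G y \<le> G x + ?C (K n \<inter> {x<..y})" if "x \<le> y" for x y n
  proof -
    have "G y \<le> ?C (K m \<inter> {..x}) + ?C (K n \<inter> {x<..y})" for m
    proof -
      have "G y \<le> ?C (K (max m n) \<inter> {..y})" unfolding G_def by (rule INF_lower) simp
      also have "... \<le> ?C ((K m \<inter> {..x}) \<union> (K n \<inter> {x<..y}))"
        using K_decseq[of m "max m n"] K_decseq[of n "max m n"] by (intro net_content_mono) auto
      also have "... \<le> ?C (K m \<inter> {..x}) + ?C (K n \<inter> {x<..y})" by (rule net_content_Un_le)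
      finally show ?thesis .
    qed
    then have "G y \<le> (INF m. ?C (K m \<inter> {..x}) + ?C (K n \<inter> {x<..y}))" by (rule INF_greatest)
    then show ?thesis unfolding INF_ennreal_add_const by (simp add: G_def)
  qed
  have F_mono: "F x \<le> F y" if "x \<le> y" for x y
    unfolding F_def using G_mono[OF that] G_fin by (intro enn2real_mono) auto
  have F_incr: "ennreal (F y - F x) \<le> ?C (K n \<inter> {x<..y})" if "x \<le> y" for x y n
  proof -
    have "ennreal (F y - F x) = G y - G x"
      using G_fin unfolding F_def by (simp add: ennreal_minus[symmetric] ennreal_enn2real)
    also have "... \<le> ?C (K n \<inter> {x<..y})"
      using G_incr[OF that, of n] G_fin[of x] by (subst ennreal_minus_le_iff) auto
    finally show ?thesis .
  qed
  have short: "?C (K m \<inter> {x<..y}) \<le> 3 * \<phi> n" if "y - x \<le> 1 / 2 ^ n" for x y m n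
    by (rule net_content_short[where s = x]) (use that in auto)
  have F_cont: "continuous (at_right x) F" for x
  proof (subst continuous_at_right_real_increasing[OF F_mono], simp, intro allI impI)
    fix e :: real assume "0 < e"
    have "(\<lambda>n. 3 * \<phi> n) \<longlonglongrightarrow> 3 * 0" by (intro ennreal_tendsto_cmult lim) simp
    then have "\<forall>\<^sub>F n in sequentially. 3 * \<phi> n < ennreal e"
      using \<open>0 < e\<close> by (intro order_tendstoD) auto
    then obtain n where n: "3 * \<phi> n < ennreal e" by (auto simp: eventually_sequentially)
    have "ennreal (F (x + 1 / 2 ^ n) - F x) \<le> ?C (K 0 \<inter> {x<..x + 1 / 2 ^ n})" by (rule F_incr) simp
    also have "... \<le> 3 * \<phi> n" by (rule short) simp
    also note n
    finally have "F (x + 1 / 2 ^ n) - F x < e" using \<open>0 < e\<close> by (simp add: ennreal_less_iff F_mono)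
    then show "\<exists>d>0. F (x + d) - F x < e" by (intro exI[of _ "1 / 2 ^ n"]) simp
  qed
  define \<mu> where "\<mu> = interval_measure F"
  have sets: "sets \<mu> = sets borel" by (simp add: \<mu>_def)
  have \<mu>_Ioc: "emeasure \<mu> {x<..y} = ennreal (F y - F x)" if "x \<le> y" for x y
    unfolding \<mu>_def by (rule emeasure_interval_measure_Ioc[OF that F_mono F_cont])
  have \<mu>_le: "emeasure \<mu> {x<..y} \<le> ?C (K n \<inter> {x<..y})" for x y n
    using F_incr \<mu>_Ioc by (cases "x \<le> y") auto
  \<comment> \<open>The increments of \<open>F\<close> are bounded by the content of every single
    \<open>K n\<close> over the interval, so an interval that misses \<open>K n\<close> has no
    mass.\<close>
  have null: "- closure (K n) \<in> null_sets \<mu>" for n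
  proof (rule open_null_if_Ioc_null[OF sets])
    fix p q assume "{p<..q} \<subseteq> - closure (K n)"
    then have "K n \<inter> {p<..q} = {}" using closure_subset by blast
    then show "emeasure \<mu> {p<..q} = 0" using \<mu>_le[of p q n] by simp
  qed auto
  \<comment> \<open>Closedness of \<open>R\<close> enters here: the closures intersect inside
    \<open>E\<close>, so \<mu> lives on \<open>E\<close> although the \<open>K n\<close> need be
    neither closed nor measurable.\<close>
  have "- E \<subseteq> (\<Union>n. - closure (K n))"
    using closure_sections_subset[OF R(1), of \<kappa>] unfolding R(2) K_def P_def by blast
  moreover have "(\<Union>n. - closure (K n)) \<in> null_sets \<mu>" using null by (rule null_sets_UN)
  ultimately have null_E: "- E \<in> null_sets \<mu>"
    using E(1) sets by (intro null_sets_subset[of _ \<mu> "- E"]) auto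
  have "G (-1) = 0"
  proof -
    have empty: "K 0 \<inter> {..-1} = {}" using K_E[of 0] E(2) by force
    have "G (-1) \<le> ?C (K 0 \<inter> {..-1})" unfolding G_def by (rule INF_lower) simp
    then show ?thesis by (simp add: empty)
  qed
  \<comment> \<open>Every \<open>K n\<close> has content above \<open>a\<close>, so mass survives in
    the infimum without any continuity of the content along decreasing sequences.\<close>
  moreover have "a \<le> G 1"
    unfolding G_def
  proof (rule INF_greatest)
    fix n
    have "K n \<inter> {..1} = K n" using K_E[of n] E(2) by force
    then show "a \<le> ?C (K n \<inter> {..1})" using K[of n] by simp
  qed
  ultimately have "emeasure \<mu> {-1<..1} \<ge> a"
    using G_fin[of 1] by (subst \<mu>_Ioc) (auto simp: F_def ennreal_enn2real)
  also have "emeasure \<mu> {-1<..1} \<le> emeasure \<mu> (E \<union> - E)"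
    using E(1) sets by (intro emeasure_mono) auto
  also have "... = emeasure \<mu> E" using E(1) sets null_E by (intro emeasure_Un_null_set) auto
  finally have pos_E: "0 < emeasure \<mu> E" using a(1) by simp
  have "emeasure \<mu> UNIV \<le> emeasure \<mu> (- E) + emeasure \<mu> {-1<..1}"
  proof -
    have "- E \<union> {-1<..1} = UNIV" using E(2) by force
    moreover have "emeasure \<mu> (- E \<union> {-1<..1}) \<le> emeasure \<mu> (- E) + emeasure \<mu> {-1<..1}"
      using E(1) sets by (intro emeasure_subadditive) auto
    ultimately show ?thesis by simp
  qed
  also have "... < top" using null_E \<mu>_Ioc[of "-1" 1] by auto
  finally have "finite_measure \<mu>"
    by (intro finite_measureI) (simp add: \<mu>_def)
  moreover have "emeasure \<mu> {x<..y} \<le> 3 * \<phi> n" if "y - x \<le> 1 / 2 ^ n" for n x y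
    using \<mu>_le[of x y 0] short[OF that, of 0] by (rule order_trans)
  ultimately show thesis using that sets null_E pos_E by blast
qed

subsection \<open>Hausdorff contents and dimensions\<close>

lemma hcontent_le:
  assumes "\<And>n. c n \<in> S" "\<And>n. 0 \<le> r n" "\<And>n. r n \<le> \<eta>" "G \<subseteq> (\<Union>n. {y \<in> S. \<rho> (c n) y < r n})"
  shows "hcontent S \<rho> \<beta> \<eta> G \<le> (\<Sum>n. ennreal ((2 * r n) powr \<beta>))"
  unfolding hcontent_def by (rule INF_lower2[of "(c, r)"]) (use assms in auto)

lemma hcontent_coverE:
  assumes "hcontent S \<rho> \<beta> \<eta> G < e"
  obtains c r where "\<And>n. c n \<in> S" "\<And>n. 0 \<le> r n" "\<And>n. r n \<le> \<eta>"
    "G \<subseteq> (\<Union>n. {y \<in> S. \<rho> (c n) y < r n})" "(\<Sum>n. ennreal ((2 * r n) powr \<beta>)) < e"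
proof -
  obtain p where p: "p \<in> {(c, r). (\<forall>n::nat. c n \<in> S \<and> 0 \<le> r n \<and> r n \<le> \<eta>) \<and>
      G \<subseteq> (\<Union>n. {y \<in> S. \<rho> (c n) y < r n})}" "(\<Sum>n. ennreal ((2 * snd p n) powr \<beta>)) < e"
    using assms unfolding hcontent_def INF_less_iff by blast
  show ?thesis by (rule that[of "fst p" "snd p"]) (use p in \<open>auto simp: split_beta\<close>)
qed

lemma hcontent_mono: "G \<subseteq> H \<Longrightarrow> hcontent S \<rho> \<beta> \<eta> G \<le> hcontent S \<rho> \<beta> \<eta> H"
  unfolding hcontent_def by (rule INF_superset_mono) auto

lemma hcontent_UN_le: "hcontent S \<rho> \<beta> \<eta> (\<Union>i. G i) \<le> (\<Sum>i::nat. hcontent S \<rho> \<beta> \<eta> (G i))"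
  (is "_ \<le> (\<Sum>i. ?h i)")
proof (cases "\<exists>i. ?h i = top")
  case True
  then obtain i where "?h i = top" by auto
  then have "(\<Sum>i. ?h i) = top"
    using sum_le_suminf[of ?h "{i}"] by (simp add: top_unique)
  then show ?thesis by simp
next
  case False
  show ?thesis
  proof (rule ennreal_le_epsilon)
    fix e :: real assume "0 < e"
    have "\<exists>p. (\<forall>n. fst p n \<in> S \<and> 0 \<le> snd p n \<and> snd p n \<le> \<eta>) \<and>
        G i \<subseteq> (\<Union>n. {y \<in> S. \<rho> (fst p n) y < snd p n}) \<and>
        (\<Sum>n. ennreal ((2 * snd p n) powr \<beta>)) < ?h i + ennreal (e * (1/2) ^ Suc i)" for i
    proof -
      have "?h i < ?h i + ennreal (e * (1/2) ^ Suc i)"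
        using False \<open>0 < e\<close>
        by (cases "?h i") (auto simp: ennreal_less_iff simp flip: ennreal_plus)
      then obtain c r where "\<And>n. c n \<in> S" "\<And>n. 0 \<le> r n" "\<And>n. r n \<le> \<eta>"
          "G i \<subseteq> (\<Union>n. {y \<in> S. \<rho> (c n) y < r n})"
          "(\<Sum>n. ennreal ((2 * r n) powr \<beta>)) < ?h i + ennreal (e * (1/2) ^ Suc i)"
        by (rule hcontent_coverE) blast
      then show ?thesis by (intro exI[of _ "(c, r)"]) auto
    qed
    then have "\<exists>p. \<forall>i. (\<forall>n. fst (p i) n \<in> S \<and> 0 \<le> snd (p i) n \<and> snd (p i) n \<le> \<eta>) \<and>
        G i \<subseteq> (\<Union>n. {y \<in> S. \<rho> (fst (p i) n) y < snd (p i) n}) \<and>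
        (\<Sum>n. ennreal ((2 * snd (p i) n) powr \<beta>)) < ?h i + ennreal (e * (1/2) ^ Suc i)"
      by (intro choice allI)
    then obtain p where p: "\<And>i n. fst (p i) n \<in> S" "\<And>i n. 0 \<le> snd (p i) n" "\<And>i n. snd (p i) n \<le> \<eta>"
        "\<And>i. G i \<subseteq> (\<Union>n. {y \<in> S. \<rho> (fst (p i) n) y < snd (p i) n})"
        "\<And>i. (\<Sum>n. ennreal ((2 * snd (p i) n) powr \<beta>)) < ?h i + ennreal (e * (1/2) ^ Suc i)"
      by blast
    define c where "c m = fst (p (fst (prod_decode m))) (snd (prod_decode m))" for m
    define r where "r m = snd (p (fst (prod_decode m))) (snd (prod_decode m))" for m
    have "hcontent S \<rho> \<beta> \<eta> (\<Union>i. G i) \<le> (\<Sum>m. ennreal ((2 * r m) powr \<beta>))"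
    proof (rule hcontent_le)
      show "(\<Union>i. G i) \<subseteq> (\<Union>m. {y \<in> S. \<rho> (c m) y < r m})"
      proof
        fix y assume "y \<in> (\<Union>i. G i)"
        then obtain i n where "y \<in> S" "\<rho> (fst (p i) n) y < snd (p i) n" using p(4) by blast
        then show "y \<in> (\<Union>m. {y \<in> S. \<rho> (c m) y < r m})"
          by (intro UN_I[of "prod_encode (i, n)"]) (auto simp: c_def r_def)
      qed
    qed (use p in \<open>auto simp: c_def r_def\<close>)
    also have "... = (\<Sum>i. \<Sum>n. ennreal ((2 * snd (p i) n) powr \<beta>))"
      unfolding r_def
      by (rule suminf_ennreal_2dimen[of _ "\<lambda>q. ennreal ((2 * snd (p (fst q)) (snd q)) powr \<beta>)",
            unfolded fst_conv snd_conv]) simp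
    also have "... \<le> (\<Sum>i. ?h i + ennreal (e * (1/2) ^ Suc i))"
      using p(5) by (intro suminf_le) (auto intro: less_imp_le)
    also have "... = (\<Sum>i. ?h i) + (\<Sum>i. ennreal (e * (1/2) ^ Suc i))"
      by (rule suminf_add[symmetric]) auto
    finally show "hcontent S \<rho> \<beta> \<eta> (\<Union>i. G i) \<le> (\<Sum>i. ?h i) + ennreal e"
      unfolding suminf_ennreal_half_powers[OF less_imp_le[OF \<open>0 < e\<close>]] .
  qed
qed

text \<open>A cover is an infinite sequence of balls; balls of radius 0, with
  \<open>0 powr \<beta> = 0\<close>, provide the padding.\<close>

lemma hcontent_empty: "S \<noteq> {} \<Longrightarrow> 0 \<le> \<eta> \<Longrightarrow> hcontent S \<rho> \<beta> \<eta> {} = 0"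
  using hcontent_le[of "\<lambda>_. SOME s. s \<in> S" S "\<lambda>_. 0" \<eta> "{}" \<rho> \<beta>] by (simp add: some_in_eq)

text \<open>The sum over the index set is an integral over \<open>count_space\<close>, the form in
  which Fubini later exchanges it with the expectation. Numbers that code no index contribute the
  empty set.\<close>

lemma hcontent_UN_countable_le:
  fixes G :: "'w::countable \<Rightarrow> 'a set"
  assumes "S \<noteq> {}" "0 \<le> \<eta>"
  shows "hcontent S \<rho> \<beta> \<eta> (\<Union>w\<in>W. G w) \<le> (\<integral>\<^sup>+ w. hcontent S \<rho> \<beta> \<eta> (G w) \<partial>count_space W)"
proof -
  let ?G = "\<lambda>i. \<Union>(G ` {w \<in> W. to_nat w = i})" and ?h = "hcontent S \<rho> \<beta> \<eta>"
  have G: "?G (to_nat w) = G w" if "w \<in> W" for w using that by (auto simp: inj_eq)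
  have "?h (\<Union>w\<in>W. G w) \<le> ?h (\<Union>i. ?G i)" by (rule hcontent_mono) blast
  also have "... \<le> (\<Sum>i. ?h (?G i))" by (rule hcontent_UN_le)
  also have "... = (\<integral>\<^sup>+ i. ?h (?G i) \<partial>count_space UNIV)" by (rule nn_integral_count_space_nat[symmetric])
  also have "... = (\<integral>\<^sup>+ i. ?h (?G i) \<partial>count_space (to_nat ` W))"
  proof (rule nn_integral_count_space_eq)
    fix i assume "i \<in> UNIV - to_nat ` W"
    then have "?G i = {}" by auto
    then show "?h (?G i) = 0" using hcontent_empty[OF assms] by metis
  qed auto
  also have "... = (\<integral>\<^sup>+ w. ?h (?G (to_nat w)) \<partial>count_space W)"
    by (rule nn_integral_bij_count_space[symmetric]) (simp add: bij_betw_def inj_on_subset[OF inj_to_nat])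
  also have "... = (\<integral>\<^sup>+ w. ?h (G w) \<partial>count_space W)"
    by (rule nn_integral_cong) (simp only: space_count_space G)
  finally show ?thesis .
qed

lemma hcontent_ball_le:
  assumes "c \<in> S" "0 \<le> r" "r \<le> \<eta>" "G \<subseteq> {y \<in> S. \<rho> c y < r}"
  shows "hcontent S \<rho> \<beta> \<eta> G \<le> ennreal ((2 * r) powr \<beta>)"
proof -
  have "hcontent S \<rho> \<beta> \<eta> G \<le> (\<Sum>n::nat. ennreal ((2 * (if n = 0 then r else 0)) powr \<beta>))"
  proof (rule hcontent_le[of "\<lambda>_. c"])
    show "G \<subseteq> (\<Union>n::nat. {y \<in> S. \<rho> c y < (if n = 0 then r else 0)})"
      using assms(4) by (intro subset_trans[OF assms(4)] UN_upper[of 0, THEN subset_trans[rotated]]) auto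
  qed (use assms in auto)
  also have "... = (\<Sum>n\<in>{0::nat}. ennreal ((2 * (if n = 0 then r else 0)) powr \<beta>))"
    by (rule suminf_finite) auto
  finally show ?thesis by simp
qed

lemma hcontent_finite_balls_le:
  assumes C: "finite C" "C \<subseteq> S" and "0 \<le> r" "r \<le> \<eta>" "S \<noteq> {}"
    and G: "G \<subseteq> (\<Union>c\<in>C. {y \<in> S. \<rho> c y < r})"
  shows "hcontent S \<rho> \<beta> \<eta> G \<le> of_nat (card C) * ennreal ((2 * r) powr \<beta>)"
proof -
  obtain g where g: "bij_betw g {0..<card C} C" using ex_bij_betw_nat_finite[OF C(1)] by blast
  have "G \<subseteq> (\<Union>i\<in>{0..<card C}. {y \<in> S. \<rho> (g i) y < r})"
  proof
    fix y assume "y \<in> G"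
    then obtain c where "c \<in> C" "y \<in> S" "\<rho> c y < r" using G by blast
    moreover obtain i where "i \<in> {0..<card C}" "c = g i"
      using bij_betw_imp_surj_on[OF g] \<open>c \<in> C\<close> by blast
    ultimately show "y \<in> (\<Union>i\<in>{0..<card C}. {y \<in> S. \<rho> (g i) y < r})" by blast
  qed
  then have "hcontent S \<rho> \<beta> \<eta> G \<le> hcontent S \<rho> \<beta> \<eta> (\<Union>i\<in>{0..<card C}. {y \<in> S. \<rho> (g i) y < r})"
    by (rule hcontent_mono)
  also have "... \<le> (\<integral>\<^sup>+ i. hcontent S \<rho> \<beta> \<eta> {y \<in> S. \<rho> (g i) y < r} \<partial>count_space {0..<card C})"
    using assms by (intro hcontent_UN_countable_le) auto
  also have "... \<le> (\<integral>\<^sup>+ i. ennreal ((2 * r) powr \<beta>) \<partial>count_space {0..<card C})"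
    using assms bij_betwE[OF g] by (intro nn_integral_mono hcontent_ball_le) auto
  also have "... = of_nat (card C) * ennreal ((2 * r) powr \<beta>)"
    by (simp add: mult.commute emeasure_count_space)
  finally show ?thesis .
qed

lemma hmeasure_eq_0_iff: "hmeasure S \<rho> \<beta> G = 0 \<longleftrightarrow> (\<forall>\<eta>>0. hcontent S \<rho> \<beta> \<eta> G = 0)"
proof -
  have "hmeasure S \<rho> \<beta> G = bot \<longleftrightarrow> (\<forall>\<eta>\<in>{0<..}. hcontent S \<rho> \<beta> \<eta> G = bot)"
    unfolding hmeasure_def by (rule SUP_bot_conv)
  then show ?thesis by (auto simp: bot_ennreal)
qed

lemma hmeasure_eq_0I:
  assumes "\<And>\<eta> e. 0 < \<eta> \<Longrightarrow> 0 < e \<Longrightarrow> hcontent S \<rho> \<beta> \<eta> G \<le> ennreal e"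
  shows "hmeasure S \<rho> \<beta> G = 0"
  unfolding hmeasure_eq_0_iff
proof (intro allI impI)
  fix \<eta> :: real assume "0 < \<eta>"
  then have "hcontent S \<rho> \<beta> \<eta> G \<le> 0"
    using assms ennreal_le_epsilon[of 0 "hcontent S \<rho> \<beta> \<eta> G"] by simp
  then show "hcontent S \<rho> \<beta> \<eta> G = 0" by simp
qed

lemma hcontent_antimono_radius: "\<eta> \<le> \<eta>' \<Longrightarrow> hcontent S \<rho> \<beta> \<eta>' G \<le> hcontent S \<rho> \<beta> \<eta> G"
  unfolding hcontent_def by (rule INF_superset_mono) (auto intro: order_trans)

text \<open>Radii of at most 1/2 keep \<open>2 * r \<le> 1\<close>, where raising the exponent
  lowers the power.\<close>

lemma hmeasure_eq_0_mono:
  assumes "hmeasure S \<rho> \<beta> G = 0" "\<beta> \<le> \<beta>'"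
  shows "hmeasure S \<rho> \<beta>' G = 0"
proof (rule hmeasure_eq_0I)
  fix \<eta> e :: real assume "0 < \<eta>" "0 < e"
  let ?\<eta> = "min \<eta> (1/2)"
  have "hcontent S \<rho> \<beta>' ?\<eta> G \<le> hcontent S \<rho> \<beta> ?\<eta> G"
  proof (subst (2) hcontent_def, rule INF_greatest, clarify)
    fix c :: "nat \<Rightarrow> 'a" and r :: "nat \<Rightarrow> real"
    assume *: "\<forall>n. c n \<in> S \<and> 0 \<le> r n \<and> r n \<le> ?\<eta>" "G \<subseteq> (\<Union>n. {y \<in> S. \<rho> (c n) y < r n})"
    then have "hcontent S \<rho> \<beta>' ?\<eta> G \<le> (\<Sum>n. ennreal ((2 * r n) powr \<beta>'))"
      by (intro hcontent_le) auto
    also have "... \<le> (\<Sum>n. ennreal ((2 * snd (c, r) n) powr \<beta>))"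
    proof (intro suminf_le ennreal_leI, clarsimp)
      fix n
      have "r n \<le> ?\<eta>" "0 \<le> r n" using * by blast+
      then have "2 * r n \<le> 1" "0 \<le> r n" by auto
      then show "(2 * r n) powr \<beta>' \<le> (2 * r n) powr \<beta>" using assms(2) by (intro powr_mono') auto
    qed auto
    finally show "hcontent S \<rho> \<beta>' ?\<eta> G \<le> (\<Sum>n. ennreal ((2 * snd (c, r) n) powr \<beta>))" .
  qed
  also have "... = 0" using assms(1) \<open>0 < \<eta>\<close> by (simp add: hmeasure_eq_0_iff)
  finally show "hcontent S \<rho> \<beta>' \<eta> G \<le> ennreal e"
    using hcontent_antimono_radius[of ?\<eta> \<eta> S \<rho> \<beta>' G] by simp
qed

lemma hdim_nonneg: "0 \<le> hdim S \<rho> G"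
  unfolding hdim_def by (rule Sup_upper) simp

lemma hdim_geI: "0 < \<beta> \<Longrightarrow> 0 < hmeasure S \<rho> \<beta> G \<Longrightarrow> ereal \<beta> \<le> hdim S \<rho> G"
  unfolding hdim_def by (rule Sup_upper) simp

lemma hmeasure_eq_0_of_hdim_less: "hdim S \<rho> G < ereal \<beta> \<Longrightarrow> 0 < \<beta> \<Longrightarrow> hmeasure S \<rho> \<beta> G = 0"
  using hdim_geI[of \<beta> S \<rho> G] by (meson leD not_gr_zero)

lemma hdim_leI:
  assumes "0 \<le> x" "\<And>\<beta>. 0 < \<beta> \<Longrightarrow> x < ereal \<beta> \<Longrightarrow> hmeasure S \<rho> \<beta> G = 0"
  shows "hdim S \<rho> G \<le> x"
  unfolding hdim_def
proof (rule Sup_least)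
  fix y assume "y \<in> insert 0 (ereal ` {\<beta>. 0 < \<beta> \<and> 0 < hmeasure S \<rho> \<beta> G})"
  then show "y \<le> x" using assms by (auto simp: not_less[symmetric])
qed

lemma less_hdimE:
  assumes "ereal \<alpha> < hdim S \<rho> G" "0 \<le> \<alpha>"
  obtains \<beta> where "\<alpha> < \<beta>" "0 < hmeasure S \<rho> \<beta> G"
  using assms unfolding hdim_def less_Sup_iff by auto

text \<open>Dimension is determined by the exponents at which the measure vanishes, so only null
  sets are compared and no constants between the measures are tracked.\<close>

lemma hdim_mono:
  assumes "\<And>\<beta>. 0 < \<beta> \<Longrightarrow> hmeasure S' \<rho>' \<beta> G' = 0 \<Longrightarrow> hmeasure S \<rho> \<beta> G = 0"
  shows "hdim S \<rho> G \<le> hdim S' \<rho>' G'"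
  by (rule hdim_leI[OF hdim_nonneg]) (use assms hmeasure_eq_0_of_hdim_less in blast)

text \<open>A map that does not increase distances sends a ball cover to a ball cover with the same
  radii. It is applied to the two projections of the graph.\<close>

lemma hmeasure_image_eq_0:
  assumes "hmeasure S \<rho> \<beta> G = 0"
    and "\<And>x. x \<in> S \<Longrightarrow> f x \<in> S'" "\<And>x y. x \<in> S \<Longrightarrow> y \<in> S \<Longrightarrow> \<rho>' (f x) (f y) \<le> \<rho> x y"
  shows "hmeasure S' \<rho>' \<beta> (f ` G) = 0"
proof (rule hmeasure_eq_0I)
  fix \<eta> e :: real assume *: "0 < \<eta>" "0 < e"
  then have "hcontent S \<rho> \<beta> \<eta> G < ennreal e" using assms(1) by (simp add: hmeasure_eq_0_iff)
  then obtain c r where cr: "\<And>n. c n \<in> S" "\<And>n. 0 \<le> r n" "\<And>n. r n \<le> \<eta>"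
      "G \<subseteq> (\<Union>n. {y \<in> S. \<rho> (c n) y < r n})" "(\<Sum>n. ennreal ((2 * r n) powr \<beta>)) < ennreal e"
    by (rule hcontent_coverE) blast
  have "f ` G \<subseteq> (\<Union>n. {y \<in> S'. \<rho>' (f (c n)) y < r n})"
  proof
    fix z assume "z \<in> f ` G"
    then obtain y n where "z = f y" "y \<in> S" "\<rho> (c n) y < r n" using cr(4) by blast
    then show "z \<in> (\<Union>n. {y \<in> S'. \<rho>' (f (c n)) y < r n})"
      using assms(2)[of y] assms(3)[OF cr(1)[of n], of y] by (intro UN_I[of n]) auto
  qed
  then have "hcontent S' \<rho>' \<beta> \<eta> (f ` G) \<le> (\<Sum>n. ennreal ((2 * r n) powr \<beta>))"
    using assms(2) cr by (intro hcontent_le) auto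
  then show "hcontent S' \<rho>' \<beta> \<eta> (f ` G) \<le> ennreal e" using cr(5) by simp
qed

subsection \<open>Metrics comparable to a gauge of the Euclidean distance\<close>

text \<open>The range of control of \<gamma> is a dyadic length, to match a cell level. The factor 2
  in \<open>\<delta>_triangle\<close> lets \<delta> be a quasi-metric, which is what the elementary
  inequality for squares supplies.\<close>

locale gauge_metric =
  fixes \<delta> :: "real \<Rightarrow> real \<Rightarrow> real" and \<gamma> :: "real \<Rightarrow> real" and L :: real and n0 :: nat
  assumes L: "1 \<le> L"
    and cont_\<gamma>: "continuous_on {0..1 / 2 ^ n0} \<gamma>"
    and mono_\<gamma>: "strict_mono_on {0..1 / 2 ^ n0} \<gamma>"
    and \<gamma>_0: "\<gamma> 0 = 0"
    and \<delta>_sym: "\<And>s t. \<delta> s t = \<delta> t s"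
    and \<delta>_triangle: "\<And>s t u. s \<in> {0..1} \<Longrightarrow> t \<in> {0..1} \<Longrightarrow> u \<in> {0..1} \<Longrightarrow> \<delta> s u \<le> 2 * (\<delta> s t + \<delta> t u)"
    and \<gamma>_le: "\<And>s t. s \<in> {0..1} \<Longrightarrow> t \<in> {0..1} \<Longrightarrow> \<gamma> \<bar>s - t\<bar> \<le> L * \<delta> s t"
    and \<delta>_le: "\<And>s t. s \<in> {0..1} \<Longrightarrow> t \<in> {0..1} \<Longrightarrow> \<delta> s t \<le> L * \<gamma> \<bar>s - t\<bar>"
begin

text \<open>Below level \<open>n0\<close> the gauge is frozen, since \<open>\<gamma>\<close> is only controlled near \<open>0\<close>.\<close>

definition gam :: "nat \<Rightarrow> real" where
  "gam n = \<gamma> (1 / 2 ^ max n n0)"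

lemma \<gamma>_mono: "0 \<le> x \<Longrightarrow> x \<le> y \<Longrightarrow> y \<le> 1 / 2 ^ n0 \<Longrightarrow> \<gamma> x \<le> \<gamma> y"
  using strict_mono_on_less_eq[OF mono_\<gamma>, of x y] by simp

lemma \<gamma>_less_iff: "0 \<le> x \<Longrightarrow> x \<le> 1 / 2 ^ n0 \<Longrightarrow> 0 \<le> y \<Longrightarrow> y \<le> 1 / 2 ^ n0 \<Longrightarrow> \<gamma> x < \<gamma> y \<longleftrightarrow> x < y"
  using mono_\<gamma> by (simp add: strict_mono_on_less)

lemma \<gamma>_pos: "0 < x \<Longrightarrow> x \<le> 1 / 2 ^ n0 \<Longrightarrow> 0 < \<gamma> x"
  using \<gamma>_less_iff[of 0 x] by (simp add: \<gamma>_0)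

lemma half_power_le: "m \<le> n \<Longrightarrow> 1 / 2 ^ n \<le> (1 / 2 ^ m :: real)"
  by (simp add: frac_le)

lemma gam_pos: "0 < gam n"
  unfolding gam_def by (intro \<gamma>_pos half_power_le) auto

lemma gam_antimono: "m \<le> n \<Longrightarrow> gam n \<le> gam m"
  unfolding gam_def by (intro \<gamma>_mono half_power_le) auto

lemma gam_less: "gam n < gam n0 \<Longrightarrow> n0 \<le> n"
  by (rule ccontr) (simp add: gam_def max_def)

lemma gam_tendsto_0: "gam \<longlonglongrightarrow> 0"
proof -
  have "(\<lambda>n. \<gamma> (1 / 2 ^ max n n0)) \<longlonglongrightarrow> \<gamma> 0"
  proof (rule continuous_on_tendsto_compose[OF cont_\<gamma>])
    have "(\<lambda>n. 1 / 2 ^ n :: real) \<longlonglongrightarrow> 0"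
      using LIMSEQ_realpow_zero[of "1/2 :: real"] by (simp add: power_one_over)
    moreover have "\<forall>\<^sub>F n in sequentially. (1 / 2 ^ n :: real) = 1 / 2 ^ max n n0"
      using eventually_ge_at_top[of n0] by eventually_elim (simp add: max_def)
    ultimately show "(\<lambda>n. 1 / 2 ^ max n n0 :: real) \<longlonglongrightarrow> 0" by (rule Lim_transform_eventually)
  qed (auto intro!: always_eventually half_power_le)
  then show ?thesis by (simp add: gam_def[abs_def] \<gamma>_0)
qed

text \<open>The point \<open>h\<close> halves the way from 0 to \<open>2 * h\<close>, so the
  triangle inequality for \<delta> bounds \<open>\<gamma> (2 * h)\<close> by
  \<open>\<gamma> h\<close>. A factor \<open>L\<close> is lost each way between \<gamma> and
  \<delta>; the 4 is the factor 2 of the inequality times the two halves. Where the gauge is frozen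
  the claim only needs \<open>1 \<le> L\<close>.\<close>

lemma gam_doubling: "gam n \<le> 4 * L\<^sup>2 * gam (Suc n)"
proof (cases "n < n0")
  case True
  then have "gam n = gam (Suc n)" by (simp add: gam_def max_def)
  moreover have "1 \<le> L\<^sup>2" using L by (simp add: one_le_power)
  ultimately show ?thesis using gam_pos[of "Suc n"] by simp
next
  case False
  define h where "h = (1 / 2 ^ Suc n :: real)"
  have h: "0 \<le> h" "2 * h \<le> 1" by (auto simp: h_def)
  have "gam n = \<gamma> (2 * h)" "gam (Suc n) = \<gamma> h" using False by (auto simp: gam_def h_def max_def)
  have "\<gamma> (2 * h) \<le> L * \<delta> (2 * h) 0" using \<gamma>_le[of "2 * h" 0] h by simp
  also have "... \<le> L * (2 * (\<delta> (2 * h) h + \<delta> h 0))"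
    using L h by (intro mult_left_mono \<delta>_triangle) auto
  also have "... \<le> L * (2 * (L * \<gamma> h + L * \<gamma> h))"
    using L h \<delta>_le[of "2 * h" h] \<delta>_le[of h 0] by (intro mult_left_mono add_mono) auto
  also have "... = 4 * L\<^sup>2 * \<gamma> h" by (simp add: power2_eq_square)
  finally show ?thesis using \<open>gam n = _\<close> \<open>gam (Suc n) = _\<close> by simp
qed

lemma gam_scaleE:
  assumes "0 < \<rho>" "\<rho> < gam n0"
  obtains n where "n0 \<le> n" "gam (Suc n) \<le> \<rho>" "\<rho> < gam n"
proof -
  have "\<exists>n. gam n \<le> \<rho>"
    using order_tendstoD(2)[OF gam_tendsto_0 assms(1)] by (auto simp: eventually_sequentially intro: less_imp_le)
  define m where "m = (LEAST n. gam n \<le> \<rho>)"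
  have m: "gam m \<le> \<rho>" unfolding m_def by (rule LeastI_ex) fact
  then have "n0 < m" using assms(2) gam_antimono[of m n0] by (meson leD le_less_trans not_le_imp_less)
  then obtain n where n: "m = Suc n" by (cases m) auto
  have "\<rho> < gam n" using not_less_Least[of n "\<lambda>n. gam n \<le> \<rho>"] n by (simp add: m_def[symmetric])
  then show ?thesis using that[of n] m n \<open>n0 < m\<close> by auto
qed

text \<open>Monotonicity of \<gamma> can be inverted only within its range of control, hence the a
  priori bound by \<open>1 / 2 ^ n0\<close>.\<close>

lemma less_half_power_if_\<gamma>:
  assumes "n0 \<le> n" "\<bar>s - t\<bar> \<le> 1 / 2 ^ n0" "\<gamma> \<bar>s - t\<bar> < gam n"
  shows "\<bar>s - t\<bar> < 1 / 2 ^ n"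
  using assms \<gamma>_less_iff[of "\<bar>s - t\<bar>" "1 / 2 ^ n"] half_power_le[of n0 n] by (simp add: gam_def max_def)

end

lemma cell_eq_dist: "cell n x = cell n y \<Longrightarrow> \<bar>x - y\<bar> < 1 / 2 ^ n"
proof -
  assume "cell n x = cell n y"
  then have "\<bar>2 ^ n * x - 2 ^ n * y\<bar> < 1" unfolding cell_def by (simp add: abs_less_iff) linarith
  then have "\<bar>2 ^ n * (x - y)\<bar> < 1" by (simp add: right_diff_distrib)
  then have "2 ^ n * \<bar>x - y\<bar> < 1" by (simp add: abs_mult)
  then show ?thesis by (simp add: field_simps)
qed

definition cell_set :: "nat \<times> int \<Rightarrow> real set" where
  "cell_set w = {x. cell (fst w) x = w}"

lemma net_cover_eq: "net_cover W = (\<Union>w\<in>W. cell_set w)"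
  by (force simp: net_cover_def cell_set_def cell_def)

lemma cell_set_unit_interval: "{0..1} \<subseteq> (\<Union>k\<in>{0..2 ^ n}. cell_set (n, k))"
proof
  fix x :: real assume x: "x \<in> {0..1}"
  then have "\<lfloor>2 ^ n * x\<rfloor> \<le> \<lfloor>2 ^ n :: real\<rfloor>" by (intro floor_mono) simp
  then have "\<lfloor>2 ^ n * x\<rfloor> \<le> 2 ^ n" by simp
  then show "x \<in> (\<Union>k\<in>{0..2 ^ n}. cell_set (n, k))"
    using x by (intro UN_I[of "\<lfloor>2 ^ n * x\<rfloor>"]) (auto simp: cell_set_def cell_def)
qed

section \<open>Null sets of the \<delta>-Hausdorff measure and of the net content\<close>

context gauge_metric
begin

definition gauge :: "real \<Rightarrow> nat \<Rightarrow> ennreal" where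
  "gauge \<beta> n = ennreal (gam n powr \<beta>)"

text \<open>No cell weighs more than the whole cover, so a light cover consists of fine cells. The
  bound \<open>e'\<close> secures total weight, radius and level at once; the half in
  \<open>gam n0 powr \<beta> / 2\<close> makes the comparison with level \<open>n0\<close>
  strict.\<close>

lemma fine_net_coverE:
  assumes "net_content (gauge \<beta>) E = 0" "0 < \<beta>" "0 < e" "0 < \<eta>"
  obtains W where "E \<subseteq> net_cover W" "weight (gauge \<beta>) W \<le> ennreal e"
    "\<And>w. w \<in> W \<Longrightarrow> n0 \<le> fst w \<and> gam (fst w) \<le> \<eta>"
proof -
  define e' where "e' = Min {e, \<eta> powr \<beta>, gam n0 powr \<beta> / 2}"
  have "0 < e'" using assms gam_pos[of n0] by (auto simp: e'_def)
  have e': "e' \<le> e" "e' \<le> \<eta> powr \<beta>" "e' \<le> gam n0 powr \<beta> / 2" by (auto simp: e'_def)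
  obtain W where W: "E \<subseteq> net_cover W" "weight (gauge \<beta>) W \<le> ennreal e'"
    using net_content_coverE[of "gauge \<beta>" E "ennreal e'"] assms(1) \<open>0 < e'\<close> by auto
  have "n0 \<le> fst w \<and> gam (fst w) \<le> \<eta>" if "w \<in> W" for w
  proof -
    have "ennreal (gam (fst w) powr \<beta>) = weight (gauge \<beta>) {w}"
      by (simp add: emeasure_net_weight gauge_def nn_integral_count_space_finite)
    also have "... \<le> weight (gauge \<beta>) W" using that by (intro emeasure_mono) auto
    also note W(2)
    finally have le: "gam (fst w) powr \<beta> \<le> e'" using \<open>0 < e'\<close> by simp
    also have "e' < gam n0 powr \<beta>" using e'(3) \<open>0 < e'\<close> by linarith
    finally have "gam (fst w) < gam n0"
      using gam_pos assms(2) powr_less_cancel2 by blast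
    moreover have "gam (fst w) \<le> \<eta>"
      using order_trans[OF le e'(2)] gam_pos[of "fst w"] assms(2,4)
      by (metis less_imp_le not_le powr_less_mono2)
    ultimately show ?thesis using gam_less by blast
  qed
  then show ?thesis using that W e'(1) by (meson ennreal_leI order_trans)
qed

text \<open>The factor 2 buys strictness, since Hausdorff covers use open balls.\<close>

lemma \<delta>_cell_less:
  assumes "cell n s = cell n t" "n0 \<le> n" "s \<in> {0..1}" "t \<in> {0..1}"
  shows "\<delta> s t < 2 * L * gam n"
proof -
  have "\<delta> s t \<le> L * \<gamma> \<bar>s - t\<bar>" by (rule \<delta>_le[OF assms(3,4)])
  also have "... \<le> L * gam n"
    using L cell_eq_dist[OF assms(1)] half_power_le[OF assms(2)] assms(2)
    by (intro mult_left_mono) (auto simp: gam_def max_def intro!: \<gamma>_mono)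
  also have "... < 2 * L * gam n" using L gam_pos[of n] by simp
  finally show ?thesis .
qed

lemma hmeasure_eq_0_if_net_content:
  assumes "net_content (gauge \<beta>) E = 0" "0 < \<beta>" "E \<subseteq> {0..1}"
  shows "hmeasure {0..1} \<delta> \<beta> E = 0"
proof (rule hmeasure_eq_0I)
  fix \<eta> e :: real assume \<eta>: "0 < \<eta>" and e: "0 < e"
  let ?h = "hcontent {0..1} \<delta> \<beta> \<eta>"
  have L': "0 < L" using L by simp
  obtain W where W: "E \<subseteq> net_cover W" "weight (gauge \<beta>) W \<le> ennreal (e / (4 * L) powr \<beta>)"
    "\<And>w. w \<in> W \<Longrightarrow> n0 \<le> fst w \<and> gam (fst w) \<le> \<eta> / (2 * L)"
    using fine_net_coverE[OF assms(1,2), of "e / (4 * L) powr \<beta>" "\<eta> / (2 * L)"] \<eta> e L' by auto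
  have "?h E \<le> ?h (\<Union>w\<in>W. E \<inter> cell_set w)"
    using W(1) by (intro hcontent_mono) (auto simp: net_cover_eq)
  also have "... \<le> (\<integral>\<^sup>+ w. ?h (E \<inter> cell_set w) \<partial>count_space W)"
    using \<eta> by (intro hcontent_UN_countable_le) auto
  also have "... \<le> (\<integral>\<^sup>+ w. ennreal ((4 * L) powr \<beta>) * gauge \<beta> (fst w) \<partial>count_space W)"
  proof (rule nn_integral_mono)
    fix w assume "w \<in> space (count_space W)"
    then have w: "n0 \<le> fst w" "2 * L * gam (fst w) \<le> \<eta>" using W(3)[of w] L' by (auto simp: field_simps)
    show "?h (E \<inter> cell_set w) \<le> ennreal ((4 * L) powr \<beta>) * gauge \<beta> (fst w)"
    proof (cases "E \<inter> cell_set w = {}")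
      case False
      then obtain s where s: "s \<in> E" "s \<in> cell_set w" by blast
      have "?h (E \<inter> cell_set w) \<le> ennreal ((2 * (2 * L * gam (fst w))) powr \<beta>)"
      proof (rule hcontent_ball_le)
        show "E \<inter> cell_set w \<subseteq> {y \<in> {0..1}. \<delta> s y < 2 * L * gam (fst w)}"
          using s w(1) assms(3) by (auto intro!: \<delta>_cell_less simp: cell_set_def)
      qed (use s assms(3) w(2) L' gam_pos[of "fst w"] in auto)
      also have "(2 * (2 * L * gam (fst w))) powr \<beta> = (4 * L) powr \<beta> * gam (fst w) powr \<beta>"
        using L' gam_pos[of "fst w"] by (simp add: powr_mult)
      finally show ?thesis by (simp add: gauge_def ennreal_mult)
    qed (use \<eta> in \<open>simp add: hcontent_empty\<close>)
  qed
  also have "... = ennreal ((4 * L) powr \<beta>) * weight (gauge \<beta>) W"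
    by (simp add: nn_integral_cmult emeasure_net_weight)
  also have "... \<le> ennreal ((4 * L) powr \<beta>) * ennreal (e / (4 * L) powr \<beta>)"
    by (intro mult_left_mono W(2)) simp
  also have "... = ennreal e" using L' e by (simp add: ennreal_mult[symmetric])
  finally show "?h E \<le> ennreal e" .
qed

text \<open>A \<delta>-ball is known to be short only within a cell of level \<open>n0\<close>, so
  it is cut along these cells; index \<open>2 ^ n0\<close> is there for the point 1. Two points of
  the ball satisfy \<open>\<gamma> \<bar>y - s\<bar> < 4 * L * r\<close>, and doubling costs
  \<open>4 * L\<^sup>2\<close>, which together give \<open>8 * L ^ 3\<close> times the diameter
  \<open>2 * r\<close>.\<close>

lemma net_content_ball_le:
  assumes "0 < r" "4 * L * r < gam n0" "c \<in> {0..1}" "0 < \<beta>"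
  shows "net_content (gauge \<beta>) {y \<in> {0..1}. \<delta> c y < r}
    \<le> ennreal (3 * (2 ^ n0 + 1) * (8 * L ^ 3) powr \<beta> * (2 * r) powr \<beta>)"
proof -
  let ?B = "{y \<in> {0..1}. \<delta> c y < r}" and ?K = "ennreal ((8 * L ^ 3) powr \<beta> * (2 * r) powr \<beta>)"
  have L': "0 < L" using L by simp
  have piece: "net_content (gauge \<beta>) (?B \<inter> cell_set (n0, k)) \<le> 3 * ?K" for k
  proof (cases "?B \<inter> cell_set (n0, k) = {}")
    case False
    then obtain s where s: "s \<in> {0..1}" "\<delta> c s < r" "cell n0 s = (n0, k)" by (auto simp: cell_set_def)
    obtain n where n: "n0 \<le> n" "gam (Suc n) \<le> 4 * L * r" "4 * L * r < gam n"
      using gam_scaleE[of "4 * L * r"] assms L' by auto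
    have "net_content (gauge \<beta>) (?B \<inter> cell_set (n0, k)) \<le> 3 * gauge \<beta> n"
    proof (rule net_content_short[where s = s])
      fix y assume "y \<in> ?B \<inter> cell_set (n0, k)"
      then have y: "y \<in> {0..1}" "\<delta> c y < r" "cell n0 y = (n0, k)" by (auto simp: cell_set_def)
      have "\<gamma> \<bar>y - s\<bar> \<le> L * \<delta> y s" by (rule \<gamma>_le[OF y(1) s(1)])
      also have "... \<le> L * (2 * (\<delta> y c + \<delta> c s))" using L' y s assms by (intro mult_left_mono \<delta>_triangle) auto
      also have "... < L * (2 * (r + r))" using L' y s \<delta>_sym[of y c] by (intro mult_strict_left_mono) auto
      finally have "\<gamma> \<bar>y - s\<bar> < gam n" using n(3) by simp
      then have "\<bar>y - s\<bar> < 1 / 2 ^ n"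
        using cell_eq_dist[of n0 y s] y s n(1) by (intro less_half_power_if_\<gamma>) auto
      then show "\<bar>y - s\<bar> \<le> 1 / 2 ^ n" by simp
    qed
    also have "gauge \<beta> n \<le> ?K"
    proof -
      have "gam n \<le> 4 * L\<^sup>2 * gam (Suc n)" by (rule gam_doubling)
      also have "... \<le> 4 * L\<^sup>2 * (4 * L * r)" by (intro mult_left_mono n) auto
      also have "... = (8 * L ^ 3) * (2 * r)" by (simp add: power2_eq_square power3_eq_cube)
      finally have "gam n powr \<beta> \<le> ((8 * L ^ 3) * (2 * r)) powr \<beta>"
        using gam_pos[of n] assms by (intro powr_mono2) auto
      then show ?thesis using L' assms unfolding gauge_def by (intro ennreal_leI) (simp add: powr_mult[symmetric])
    qed
    finally show ?thesis by (simp add: mult_left_mono)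
  qed simp
  have "net_content (gauge \<beta>) ?B \<le> net_content (gauge \<beta>) (\<Union>k\<in>{0..2 ^ n0}. ?B \<inter> cell_set (n0, k))"
    using cell_set_unit_interval[of n0] by (intro net_content_mono) auto
  also have "... \<le> (\<Sum>k\<in>{0..2 ^ n0 :: int}. net_content (gauge \<beta>) (?B \<inter> cell_set (n0, k)))"
    by (rule net_content_UN_finite_le) simp
  also have "... \<le> (\<Sum>k\<in>{0..2 ^ n0 :: int}. 3 * ?K)" by (intro sum_mono piece)
  also have "... = of_nat (nat (2 ^ n0 + 1)) * (3 * ?K)" by simp
  also have "... = ennreal (real (nat (2 ^ n0 + 1)) * (3 * ((8 * L ^ 3) powr \<beta> * (2 * r) powr \<beta>)))"
    by (simp add: ennreal_mult ennreal_of_nat_eq_real_of_nat)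
  also have "real (nat (2 ^ n0 + 1)) = 2 ^ n0 + 1" by (simp add: of_nat_nat)
  finally show ?thesis by (simp add: algebra_simps)
qed

lemma net_content_eq_0_if_hmeasure:
  assumes "hmeasure {0..1} \<delta> \<beta> E = 0" "0 < \<beta>"
  shows "net_content (gauge \<beta>) E = 0"
proof -
  define K where "K = 3 * (2 ^ n0 + 1) * (8 * L ^ 3) powr \<beta>"
  \<comment> \<open>This mesh gives \<open>4 * L * r \<le> gam n0 / 2\<close>, so all balls are
    small enough for the comparison.\<close>
  define \<eta> where "\<eta> = gam n0 / (8 * L)"
  have L': "0 < L" using L by simp
  have \<eta>: "0 < \<eta>" using L' gam_pos[of n0] by (simp add: \<eta>_def)
  have "0 < K" using L' by (simp add: K_def add_pos_pos)
  have "net_content (gauge \<beta>) E \<le> 0 + ennreal e" if "0 < e" for e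
  proof -
    have "hcontent {0..1} \<delta> \<beta> \<eta> E < ennreal (e / K)"
      using assms(1) \<eta> \<open>0 < K\<close> that by (simp add: hmeasure_eq_0_iff)
    then obtain c r where cr: "\<And>n. c n \<in> {0..1}" "\<And>n. 0 \<le> r n" "\<And>n. r n \<le> \<eta>"
        "E \<subseteq> (\<Union>n. {y \<in> {0..1}. \<delta> (c n) y < r n})" "(\<Sum>n. ennreal ((2 * r n) powr \<beta>)) < ennreal (e / K)"
      by (rule hcontent_coverE) blast
    have "net_content (gauge \<beta>) E \<le> net_content (gauge \<beta>) (\<Union>n. {y \<in> {0..1}. \<delta> (c n) y < r n})"
      by (rule net_content_mono[OF cr(4)])
    also have "... \<le> (\<Sum>n. net_content (gauge \<beta>) {y \<in> {0..1}. \<delta> (c n) y < r n})"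
      by (rule net_content_UN_le)
    also have "... \<le> (\<Sum>n. ennreal K * ennreal ((2 * r n) powr \<beta>))"
    proof (intro suminf_le allI)
      fix n
      show "net_content (gauge \<beta>) {y \<in> {0..1}. \<delta> (c n) y < r n} \<le> ennreal K * ennreal ((2 * r n) powr \<beta>)"
      proof (cases "r n = 0")
        case True
        \<comment> \<open>Nonnegativity of \<delta> follows from \<open>\<gamma> 0 = 0\<close> and
          the triangle inequality along \<open>c n\<close>, \<open>y\<close>, \<open>c n\<close>; it
          makes balls of radius 0 empty.\<close>
        have "0 \<le> \<delta> (c n) y" if "y \<in> {0..1}" for y
          using \<delta>_triangle[of "c n" y "c n"] \<delta>_sym[of y "c n"] \<gamma>_le[of "c n" "c n"] cr(1)[of n] that L' \<gamma>_0
          by (auto simp: zero_le_mult_iff)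
        then have "{y \<in> {0..1}. \<delta> (c n) y < r n} = {}" using True by force
        then show ?thesis by (simp only: net_content_empty zero_le)
      next
        case False
        then have "0 < r n" using cr(2)[of n] by simp
        moreover have "4 * L * r n < gam n0"
        proof -
          have "4 * L * r n \<le> 4 * L * \<eta>" using L' cr(3) by simp
          also have "... < gam n0" using L' gam_pos[of n0] by (simp add: \<eta>_def)
          finally show ?thesis .
        qed
        ultimately show ?thesis
          using net_content_ball_le[of "r n" "c n" \<beta>] cr(1)[of n] assms(2) \<open>0 < K\<close>
          by (simp add: K_def ennreal_mult[symmetric])
      qed
    qed auto
    also have "... = ennreal K * (\<Sum>n. ennreal ((2 * r n) powr \<beta>))" by simp
    also have "... \<le> ennreal K * ennreal (e / K)" using cr(5) by (intro mult_left_mono) auto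
    also have "... = 0 + ennreal e" using \<open>0 < K\<close> that by (simp add: ennreal_mult[symmetric])
    finally show ?thesis .
  qed
  then have "net_content (gauge \<beta>) E \<le> 0" by (rule ennreal_le_epsilon)
  then show ?thesis by simp
qed

end

subsection \<open>Negative moments\<close>

text \<open>A layer-cake bound: if \<open>x\<close> lies between the powers of 2 with exponents
  \<open>- (k + 1)\<close> and \<open>- k\<close>, the \<open>k\<close>-th term alone dominates; the
  added 1 serves \<open>x \<ge> 1\<close>; at \<open>x = 0\<close> all indicators are 1 and both
  sides are infinite.\<close>

lemma inverse_powr_le_dyadic_sum:
  fixes x \<alpha> :: real
  assumes "0 \<le> x" "0 \<le> \<alpha>"
  shows "inverse (ennreal (x powr \<alpha>))
    \<le> 1 + (\<Sum>k. ennreal (2 powr (\<alpha> * (real k + 1))) * indicator {..<2 powr - real k} x)"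
proof -
  let ?a = "\<lambda>k. ennreal (2 powr (\<alpha> * (real k + 1)))"
  consider "x = 0" | "0 < x" "x < 1" | "1 \<le> x" using assms by linarith
  then show ?thesis
  proof cases
    case 1
    have "(\<integral>\<^sup>+ k. 1 \<partial>count_space (UNIV :: nat set)) = (\<Sum>k::nat. 1 :: ennreal)"
      by (rule nn_integral_count_space_nat)
    then have "top = (\<Sum>k::nat. 1 :: ennreal)" by simp
    also have "... \<le> (\<Sum>k. ?a k * indicator {..<2 powr - real k} x)"
      using 1 assms(2) by (intro suminf_le) (auto simp: ge_one_powr_ge_zero)
    finally show ?thesis by (simp add: top_unique)
  next
    case 2
    have "\<exists>n. 2 powr - real n \<le> x"
    proof -
      obtain n :: nat where "- log 2 x < n" using reals_Archimedean2 by blast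
      then have "2 powr - real n \<le> 2 powr (log 2 x)" by (intro powr_mono) auto
      then show ?thesis using 2 by auto
    qed
    define m where "m = (LEAST n. 2 powr - real n \<le> x)"
    have m: "2 powr - real m \<le> x" unfolding m_def by (rule LeastI_ex) fact
    then have "m \<noteq> 0" using 2 by (intro notI) auto
    then obtain k where k: "m = Suc k" by (cases m) auto
    have xk: "x < 2 powr - real k" using not_less_Least[of k "\<lambda>n. 2 powr - real n \<le> x"] k by (simp add: m_def[symmetric])
    have "inverse (ennreal (x powr \<alpha>)) = ennreal (inverse (x powr \<alpha>))"
      using 2 by (intro inverse_ennreal) simp
    also have "inverse (x powr \<alpha>) \<le> inverse ((2 powr - real m) powr \<alpha>)"
      using m assms by (intro le_imp_inverse_le powr_mono2) auto
    also have "... = 2 powr (\<alpha> * (real k + 1))"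
      by (simp add: k powr_powr powr_minus[symmetric] algebra_simps)
    finally have "inverse (ennreal (x powr \<alpha>)) \<le> ?a k * indicator {..<2 powr - real k} x"
      using xk by (simp add: ennreal_leI)
    also have "... = (\<Sum>j\<in>{k}. ?a j * indicator {..<2 powr - real j} x)"
      by (subst sum.insert) auto
    also have "... \<le> (\<Sum>j. ?a j * indicator {..<2 powr - real j} x)" by (rule sum_le_suminf) auto
    finally show ?thesis by (simp add: add_increasing)
  next
    case 3
    have "inverse (ennreal (x powr \<alpha>)) = ennreal (inverse (x powr \<alpha>))"
      using 3 by (intro inverse_ennreal) simp
    also have "... \<le> 1"
      using 3 assms(2) ge_one_powr_ge_zero[of x \<alpha>] by (simp add: inverse_le_1_iff)
    finally show ?thesis by (simp add: add_increasing2)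
  qed
qed

text \<open>The value of the geometric series with terms
  \<open>2 powr (\<alpha> * (k + 1)) * 2 powr (- k * b)\<close>, which converges for
  \<open>\<alpha> < b\<close>.\<close>

definition potential_const :: "real \<Rightarrow> real \<Rightarrow> real" where
  "potential_const \<alpha> b = 2 powr \<alpha> / (1 - 2 powr (\<alpha> - b))"

lemma potential_const_nonneg: "\<alpha> < b \<Longrightarrow> 0 \<le> potential_const \<alpha> b"
  unfolding potential_const_def using powr_less_mono[of "\<alpha> - b" 0 "2::real"] by simp

text \<open>Small-ball decay of order \<open>b\<close> gives negative moments of every order below
  \<open>b\<close>. It serves both integrations of the energy: over \<omega>, where \<open>b\<close>
  is the number of components, and over the Frostman measure, where \<open>b\<close> is its growth
  exponent.\<close>

lemma nn_integral_inverse_powr_le: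
  assumes [measurable]: "f \<in> borel_measurable \<nu>"
    and "\<And>x. x \<in> space \<nu> \<Longrightarrow> 0 \<le> f x"
    and small: "\<And>\<rho>. 0 < \<rho> \<Longrightarrow> emeasure \<nu> {x \<in> space \<nu>. f x < \<rho>} \<le> ennreal (C * \<rho> powr b)"
    and "0 \<le> \<alpha>" "\<alpha> < b" "0 \<le> C"
  shows "(\<integral>\<^sup>+ x. inverse (ennreal (f x powr \<alpha>)) \<partial>\<nu>)
    \<le> emeasure \<nu> (space \<nu>) + ennreal (C * potential_const \<alpha> b)"
proof -
  let ?B = "\<lambda>k. {x \<in> space \<nu>. f x < 2 powr - real k}" and ?k = "\<lambda>x. inverse (ennreal (f x powr \<alpha>))"
  let ?a = "\<lambda>k. ennreal (2 powr (\<alpha> * (real k + 1)))"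
  have q: "norm (2 powr (\<alpha> - b) :: real) < 1"
    using powr_less_mono[of "\<alpha> - b" 0 "2::real"] assms by simp
  have "(\<integral>\<^sup>+ x. ?k x \<partial>\<nu>)
    \<le> (\<integral>\<^sup>+ x. 1 + (\<Sum>k. ?a k * indicator (?B k) x) \<partial>\<nu>)"
  proof (rule nn_integral_mono)
    fix x assume x: "x \<in> space \<nu>"
    have "(\<Sum>k. ?a k * indicator {..<2 powr - real k} (f x))
        = (\<Sum>k. ?a k * indicator (?B k) x)"
      using x by (intro arg_cong[where f = suminf] ext) (auto split: split_indicator)
    then show "?k x
        \<le> 1 + (\<Sum>k. ?a k * indicator (?B k) x)"
      using inverse_powr_le_dyadic_sum[of "f x" \<alpha>] assms(2)[OF x] assms(4) by simp
  qed
  also have "... = emeasure \<nu> (space \<nu>) + (\<Sum>k. ?a k * emeasure \<nu> (?B k))"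
    by (subst nn_integral_add) (auto simp: nn_integral_suminf nn_integral_cmult_indicator)
  also have "(\<Sum>k. ?a k * emeasure \<nu> (?B k))
    \<le> (\<Sum>k. ennreal (C * 2 powr \<alpha> * (2 powr (\<alpha> - b)) ^ k))"
  proof (intro suminf_le allI)
    fix k
    have "?a k * emeasure \<nu> (?B k)
        \<le> ?a k * ennreal (C * (2 powr - real k) powr b)"
      by (intro mult_left_mono small) auto
    also have "... = ennreal (C * 2 powr \<alpha> * (2 powr (\<alpha> - b)) ^ k)"
      using \<open>0 \<le> C\<close>
      by (simp add: ennreal_mult[symmetric] powr_powr powr_realpow[symmetric] powr_add[symmetric] algebra_simps)
    finally show "?a k * emeasure \<nu> (?B k)
        \<le> ennreal (C * 2 powr \<alpha> * (2 powr (\<alpha> - b)) ^ k)" .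
  qed auto
  also have "... = ennreal (C * potential_const \<alpha> b)"
    using sums_mult[OF geometric_sums[OF q], of "C * 2 powr \<alpha>"] \<open>0 \<le> C\<close>
    by (intro suminf_ennreal_eq) (auto simp: potential_const_def)
  finally show ?thesis by (simp add: add_left_mono)
qed

text \<open>The homogeneous version, through \<open>f / D\<close>; a zero of \<open>f\<close> makes
  both integrands infinite.\<close>

lemma nn_integral_inverse_powr_scaled_le:
  assumes [measurable]: "f \<in> borel_measurable \<nu>"
    and "\<And>x. x \<in> space \<nu> \<Longrightarrow> 0 \<le> f x" and "emeasure \<nu> (space \<nu>) \<le> 1" and D: "0 < D"
    and small: "\<And>\<rho>. 0 < \<rho> \<Longrightarrow> emeasure \<nu> {x \<in> space \<nu>. f x < \<rho>} \<le> ennreal ((\<rho> / D) powr b)"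
    and "0 \<le> \<alpha>" "\<alpha> < b"
  shows "(\<integral>\<^sup>+ x. inverse (ennreal (f x powr \<alpha>)) \<partial>\<nu>)
    \<le> ennreal (1 + potential_const \<alpha> b) * inverse (ennreal (D powr \<alpha>))"
proof -
  let ?k = "\<lambda>x. inverse (ennreal ((f x / D) powr \<alpha>))" and ?D = "inverse (ennreal (D powr \<alpha>))"
  have "(\<integral>\<^sup>+ x. ?k x \<partial>\<nu>)
    \<le> emeasure \<nu> (space \<nu>) + ennreal (1 * potential_const \<alpha> b)"
  proof (rule nn_integral_inverse_powr_le)
    fix \<rho> :: real assume "0 < \<rho>"
    then show "emeasure \<nu> {x \<in> space \<nu>. f x / D < \<rho>} \<le> ennreal (1 * \<rho> powr b)"
      using small[of "\<rho> * D"] D by (simp add: divide_less_eq)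
  qed (use assms in auto)
  also have "... \<le> ennreal (1 + potential_const \<alpha> b)"
    using assms(3) potential_const_nonneg[OF assms(7)] by (simp add: add_right_mono ennreal_plus)
  finally have "(\<integral>\<^sup>+ x. ?k x \<partial>\<nu>) * ?D
    \<le> ennreal (1 + potential_const \<alpha> b) * ?D"
    by (rule mult_right_mono) simp
  also have "(\<integral>\<^sup>+ x. ?k x \<partial>\<nu>) * ?D
    = (\<integral>\<^sup>+ x. ?k x * ?D \<partial>\<nu>)"
    by (rule nn_integral_multc[symmetric]) measurable
  also have "... = (\<integral>\<^sup>+ x. inverse (ennreal (f x powr \<alpha>)) \<partial>\<nu>)"
  proof (rule nn_integral_cong)
    fix x assume x: "x \<in> space \<nu>"
    show "?k x * ?D = inverse (ennreal (f x powr \<alpha>))"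
    proof (cases "f x = 0")
      case True
      then show ?thesis using D by (simp add: ennreal_top_mult inverse_ennreal)
    next
      case False
      then have "0 < f x" using assms(2)[OF x] by simp
      then show ?thesis using D
        by (simp add: inverse_ennreal ennreal_mult[symmetric] powr_divide inverse_eq_divide)
    qed
  qed
  finally show ?thesis .
qed

subsection \<open>Gaussian increments\<close>

text \<open>The density is at most \<open>1 / (2 * \<sigma>)\<close> because
  \<open>2 * pi \<ge> 4\<close>, and the interval has length \<open>2 * \<rho>\<close>.\<close>

lemma normal_small_ball:
  assumes "distributed M lborel Z (normal_density 0 \<sigma>)" "0 < \<sigma>" "0 \<le> \<rho>"
  shows "emeasure M (Z -` {-\<rho><..<\<rho>} \<inter> space M) \<le> ennreal (\<rho> / \<sigma>)"
proof -
  have "emeasure M (Z -` {-\<rho><..<\<rho>} \<inter> space M)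
    = (\<integral>\<^sup>+ x. ennreal (normal_density 0 \<sigma> x) * indicator {-\<rho><..<\<rho>} x \<partial>lborel)"
    by (rule distributed_emeasure[OF assms(1)]) simp
  also have "... \<le> (\<integral>\<^sup>+ x. ennreal (1 / (2 * \<sigma>)) * indicator {-\<rho><..<\<rho>} x \<partial>lborel)"
  proof (intro nn_integral_mono mult_right_mono ennreal_leI)
    fix x :: real
    have "2 * \<sigma> = sqrt (4 * \<sigma>\<^sup>2)" using assms(2) by (simp add: real_sqrt_mult)
    also have "... \<le> sqrt (2 * pi * \<sigma>\<^sup>2)" using pi_ge_two by (intro real_sqrt_le_mono mult_right_mono) auto
    finally have "1 / sqrt (2 * pi * \<sigma>\<^sup>2) \<le> 1 / (2 * \<sigma>)" using assms(2) by (intro divide_left_mono) auto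
    moreover have "exp (- (x - 0)\<^sup>2 / (2 * \<sigma>\<^sup>2)) \<le> 1" by simp
    ultimately have "1 / sqrt (2 * pi * \<sigma>\<^sup>2) * exp (- (x - 0)\<^sup>2 / (2 * \<sigma>\<^sup>2)) \<le> 1 / (2 * \<sigma>) * 1"
      using assms(2) by (intro mult_mono) auto
    then show "normal_density 0 \<sigma> x \<le> 1 / (2 * \<sigma>)" by (simp add: normal_density_def)
  qed simp
  also have "... = ennreal (\<rho> / \<sigma>)"
    using assms(2,3) by (simp add: nn_integral_cmult_indicator ennreal_mult[symmetric])
  finally show ?thesis .
qed

text \<open>Multiplying the density of deviation \<tau> by
  \<open>exp (x\<^sup>2 / (4 * \<tau>\<^sup>2))\<close> gives \<open>sqrt 2\<close> times the
  density of deviation \<open>sqrt 2 * \<tau>\<close>, so the moment is at most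
  \<open>sqrt 2\<close>; a larger \<sigma> only lowers it.\<close>

lemma normal_exp_square_le:
  assumes "distributed M lborel Z (normal_density 0 \<tau>)" "0 < \<tau>" "\<tau> \<le> \<sigma>"
  shows "(\<integral>\<^sup>+ \<omega>. ennreal (exp ((Z \<omega>)\<^sup>2 / (4 * \<sigma>\<^sup>2))) \<partial>M) \<le> 2"
proof -
  have "(\<integral>\<^sup>+ \<omega>. ennreal (exp ((Z \<omega>)\<^sup>2 / (4 * \<sigma>\<^sup>2))) \<partial>M)
    = (\<integral>\<^sup>+ x. ennreal (normal_density 0 \<tau> x) * ennreal (exp (x\<^sup>2 / (4 * \<sigma>\<^sup>2))) \<partial>lborel)"
    by (rule distributed_nn_integral[OF assms(1), symmetric]) measurable
  also have "... \<le> (\<integral>\<^sup>+ x. ennreal (sqrt 2) * ennreal (normal_density 0 (sqrt 2 * \<tau>) x) \<partial>lborel)"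
  proof (intro nn_integral_mono)
    fix x :: real
    have "x\<^sup>2 / (4 * \<sigma>\<^sup>2) \<le> x\<^sup>2 / (4 * \<tau>\<^sup>2)"
      using assms(2,3) by (intro divide_left_mono mult_left_mono power_mono) auto
    then have "normal_density 0 \<tau> x * exp (x\<^sup>2 / (4 * \<sigma>\<^sup>2)) \<le> normal_density 0 \<tau> x * exp (x\<^sup>2 / (4 * \<tau>\<^sup>2))"
      by (intro mult_left_mono) auto
    also have "... = 1 / sqrt (2 * pi * \<tau>\<^sup>2) * (exp (- x\<^sup>2 / (2 * \<tau>\<^sup>2)) * exp (x\<^sup>2 / (4 * \<tau>\<^sup>2)))"
      by (simp add: normal_density_def)
    also have "exp (- x\<^sup>2 / (2 * \<tau>\<^sup>2)) * exp (x\<^sup>2 / (4 * \<tau>\<^sup>2)) = exp (- x\<^sup>2 / (2 * \<tau>\<^sup>2) + x\<^sup>2 / (4 * \<tau>\<^sup>2))"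
      by (rule exp_add[symmetric])
    also have "- x\<^sup>2 / (2 * \<tau>\<^sup>2) + x\<^sup>2 / (4 * \<tau>\<^sup>2) = - (x\<^sup>2 / (4 * \<tau>\<^sup>2))"
      using assms(2) by (simp add: field_simps)
    also have "1 / sqrt (2 * pi * \<tau>\<^sup>2) * exp (- (x\<^sup>2 / (4 * \<tau>\<^sup>2))) = sqrt 2 * normal_density 0 (sqrt 2 * \<tau>) x"
    proof -
      have "sqrt (2 * pi * (sqrt 2 * \<tau>)\<^sup>2) = sqrt 2 * sqrt (2 * pi * \<tau>\<^sup>2)"
        by (simp add: power_mult_distrib real_sqrt_mult[symmetric] ac_simps)
      then show ?thesis unfolding normal_density_def by (simp add: power_mult_distrib)
    qed
    finally show "ennreal (normal_density 0 \<tau> x) * ennreal (exp (x\<^sup>2 / (4 * \<sigma>\<^sup>2)))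
        \<le> ennreal (sqrt 2) * ennreal (normal_density 0 (sqrt 2 * \<tau>) x)"
      by (simp add: ennreal_mult[symmetric] ennreal_leI)
  qed
  also have "... = ennreal (sqrt 2) * (\<integral>\<^sup>+ x. ennreal (normal_density 0 (sqrt 2 * \<tau>) x) \<partial>lborel)"
    by (rule nn_integral_cmult) measurable
  also have "(\<integral>\<^sup>+ x. ennreal (normal_density 0 (sqrt 2 * \<tau>) x) \<partial>lborel) = 1"
    using assms(2) by (subst nn_integral_eq_integral) auto
  also have "ennreal (sqrt 2) * 1 \<le> ennreal 2"
    using real_sqrt_le_mono[of 2 4] by (simp add: ennreal_leI del: ennreal_numeral)
  finally show ?thesis by simp
qed

lemma borel_measurable_PiM_increment:
  assumes "s \<in> I" "t \<in> I"
  shows "(\<lambda>f. f s - f t :: real) \<in> borel_measurable (\<Pi>\<^sub>M t\<in>I. borel)"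
  using assms[THEN measurable_component_singleton, of "\<lambda>_. borel :: real measure"]
  by (intro borel_measurable_diff)

locale iid_gaussian = prob_space M
  for M :: "'a measure" +
  fixes X :: "'a \<Rightarrow> real \<Rightarrow> real ^ 'd" and X0 :: "'a \<Rightarrow> real \<Rightarrow> real"
  assumes cont: "\<forall>\<omega>\<in>space M. continuous_on {0..1} (X \<omega>)"
    and X0_meas: "(\<lambda>\<omega>. restrict (X0 \<omega>) {0..1}) \<in> M \<rightarrow>\<^sub>M (\<Pi>\<^sub>M t\<in>{0..1}. borel)"
    and X0_gauss: "centered_gaussian_process M X0"
    and indep: "indep_vars (\<lambda>_. \<Pi>\<^sub>M t\<in>{0..1}. borel)
                  (\<lambda>i \<omega>. restrict (\<lambda>t. X \<omega> t $ i) {0..1}) UNIV"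
    and ident: "\<forall>i. distr M (\<Pi>\<^sub>M t\<in>{0..1}. borel) (\<lambda>\<omega>. restrict (\<lambda>t. X \<omega> t $ i) {0..1})
                   = distr M (\<Pi>\<^sub>M t\<in>{0..1}. borel) (\<lambda>\<omega>. restrict (X0 \<omega>) {0..1})"
begin

abbreviation "\<delta> \<equiv> can_metric M X0"

lemma increment_gaussian:
  assumes "s \<in> {0..1}" "t \<in> {0..1}"
  shows "centered_gaussian_rv M (\<lambda>\<omega>. X0 \<omega> s - X0 \<omega> t)"
proof -
  have "centered_gaussian_rv M (\<lambda>\<omega>. \<Sum>i<2. (if i = 0 then 1 else -1) * X0 \<omega> (if i = (0::nat) then s else t))"
    using X0_gauss assms unfolding centered_gaussian_process_def by (elim allE impE) auto
  then show ?thesis by (simp add: numeral_2_eq_2)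
qed

text \<open>The second moment identifies the deviation of the increment as
  \<open>\<delta> s t\<close>. Integrability is recorded because the integral in
  \<open>can_metric\<close> would otherwise default to 0.\<close>

lemma increment_cases:
  assumes "s \<in> {0..1}" "t \<in> {0..1}"
  obtains "\<delta> s t = 0" "AE \<omega> in M. X0 \<omega> s - X0 \<omega> t = 0"
    "integrable M (\<lambda>\<omega>. (X0 \<omega> s - X0 \<omega> t)\<^sup>2)"
  | "0 < \<delta> s t" "distributed M lborel (\<lambda>\<omega>. X0 \<omega> s - X0 \<omega> t) (normal_density 0 (\<delta> s t))"
    "integrable M (\<lambda>\<omega>. (X0 \<omega> s - X0 \<omega> t)\<^sup>2)"
proof -
  let ?Z = "\<lambda>\<omega>. X0 \<omega> s - X0 \<omega> t"
  have [measurable]: "?Z \<in> borel_measurable M"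
    using increment_gaussian[OF assms] by (simp add: centered_gaussian_rv_def)
  consider "AE \<omega> in M. ?Z \<omega> = 0" | \<sigma> where "0 < \<sigma>" "distributed M lborel ?Z (normal_density 0 \<sigma>)"
    using increment_gaussian[OF assms] unfolding centered_gaussian_rv_def by blast
  then show thesis
  proof cases
    case 1
    then have "(\<integral>\<omega>. (?Z \<omega>)\<^sup>2 \<partial>M) = (\<integral>\<omega>. 0 \<partial>M)"
      by (intro integral_cong_AE) auto
    moreover have "integrable M (\<lambda>\<omega>. (?Z \<omega>)\<^sup>2)"
      by (subst integrable_cong_AE[where g = "\<lambda>_. 0"]) (use 1 in auto)
    ultimately show ?thesis using that(1) 1 by (simp add: can_metric_def)
  next
    case 2
    have "(\<integral>\<omega>. (?Z \<omega>)\<^sup>2 \<partial>M) = (\<integral>x. normal_density 0 \<sigma> x * x\<^sup>2 \<partial>lborel)"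
      by (rule distributed_integral[OF 2(2), symmetric]) auto
    also have "... = \<sigma>\<^sup>2"
      using integral_normal_moment_even[OF 2(1), of 0 1] 2(1) by (simp add: fact_numeral numeral_2_eq_2)
    finally have "\<delta> s t = \<sigma>" using 2(1) by (simp add: can_metric_def)
    moreover have "integrable M (\<lambda>\<omega>. (?Z \<omega>)\<^sup>2)"
      using integrable_normal_moment[OF 2(1), of 0 2]
      by (subst distributed_integrable[OF 2(2), symmetric]) auto
    ultimately show ?thesis using that(2) 2 by simp
  qed
qed

lemma can_metric_sym: "\<delta> s t = \<delta> t s"
  unfolding can_metric_def by (simp add: power2_commute)

lemma can_metric_nonneg: "0 \<le> \<delta> s t"
  unfolding can_metric_def by simp

text \<open>This is \<open>(a + b)\<^sup>2 \<le> 2 * a\<^sup>2 + 2 * b\<^sup>2\<close> under the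
  expectation; the constant 2 is harmless for null sets.\<close>

lemma can_metric_triangle:
  assumes "s \<in> {0..1}" "t \<in> {0..1}" "u \<in> {0..1}"
  shows "\<delta> s u \<le> 2 * (\<delta> s t + \<delta> t u)"
proof -
  have int: "integrable M (\<lambda>\<omega>. (X0 \<omega> a - X0 \<omega> b)\<^sup>2)" if "a \<in> {0..1}" "b \<in> {0..1}" for a b
    using that by (rule increment_cases)
  have sq: "(\<delta> a b)\<^sup>2 = (\<integral>\<omega>. (X0 \<omega> a - X0 \<omega> b)\<^sup>2 \<partial>M)" for a b
    unfolding can_metric_def by simp
  have "(\<delta> s u)\<^sup>2 \<le> (\<integral>\<omega>. 2 * (X0 \<omega> s - X0 \<omega> t)\<^sup>2 + 2 * (X0 \<omega> t - X0 \<omega> u)\<^sup>2 \<partial>M)"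
    unfolding sq
  proof (rule integral_mono)
    fix \<omega>
    have "0 \<le> ((X0 \<omega> s - X0 \<omega> t) - (X0 \<omega> t - X0 \<omega> u))\<^sup>2" by simp
    then show "(X0 \<omega> s - X0 \<omega> u)\<^sup>2 \<le> 2 * (X0 \<omega> s - X0 \<omega> t)\<^sup>2 + 2 * (X0 \<omega> t - X0 \<omega> u)\<^sup>2"
      by (simp add: power2_eq_square algebra_simps)
  qed (use int assms in auto)
  also have "... = 2 * (\<delta> s t)\<^sup>2 + 2 * (\<delta> t u)\<^sup>2"
    unfolding sq using int assms by simp
  also have "... \<le> (2 * (\<delta> s t + \<delta> t u))\<^sup>2"
    using can_metric_nonneg[of s t] can_metric_nonneg[of t u] mult_nonneg_nonneg[of "\<delta> s t" "\<delta> t u"]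
    by (simp add: power2_eq_square algebra_simps)
  finally have "(\<delta> s u)\<^sup>2 \<le> (2 * (\<delta> s t + \<delta> t u))\<^sup>2" .
  then show ?thesis by (rule power2_le_imp_le) (simp add: can_metric_nonneg)
qed

lemma component_measurable:
  "(\<lambda>\<omega>. restrict (\<lambda>t. X \<omega> t $ i) {0..1}) \<in> M \<rightarrow>\<^sub>M (\<Pi>\<^sub>M t\<in>{0..1}. borel)"
  using indep unfolding indep_vars_def by auto

lemma component_measurable_at [measurable]:
  assumes "t \<in> {0..1}"
  shows "(\<lambda>\<omega>. X \<omega> t $ i) \<in> borel_measurable M"
  using measurable_compose[OF component_measurable[of i] measurable_component_singleton[OF assms]] assms
  by simp

lemma X_measurable_at:
  assumes "t \<in> {0..1}"
  shows "(\<lambda>\<omega>. X \<omega> t) \<in> borel_measurable M"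
proof (subst borel_measurable_euclidean_space, intro ballI)
  fix b :: "real ^ 'd" assume "b \<in> Basis"
  then obtain i where "b = axis i 1" by (auto simp: Basis_vec_def)
  then show "(\<lambda>\<omega>. X \<omega> t \<bullet> b) \<in> borel_measurable M"
    using component_measurable_at[OF assms, of i] by (simp add: inner_axis)
qed

lemma X0_measurable_at:
  assumes "t \<in> {0..1}"
  shows "(\<lambda>\<omega>. X0 \<omega> t) \<in> borel_measurable M"
  using measurable_compose[OF X0_meas measurable_component_singleton[OF assms]] assms by simp

lemma increment_measurable:
  assumes "s \<in> {0..1}" "t \<in> {0..1}"
  shows "(\<lambda>\<omega>. X \<omega> s $ i - X \<omega> t $ i) \<in> borel_measurable M"
    and "(\<lambda>\<omega>. X0 \<omega> s - X0 \<omega> t) \<in> borel_measurable M"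
  using assms component_measurable_at X0_measurable_at by (auto intro!: borel_measurable_diff)

lemma increment_distr:
  assumes s: "s \<in> {0..1}" and t: "t \<in> {0..1}"
  shows "distr M borel (\<lambda>\<omega>. X \<omega> s $ i - X \<omega> t $ i) = distr M borel (\<lambda>\<omega>. X0 \<omega> s - X0 \<omega> t)"
proof -
  let ?P = "\<Pi>\<^sub>M t\<in>{0..1::real}. (borel :: real measure)"
  note m = borel_measurable_PiM_increment[OF s t]
  have "distr M borel (\<lambda>\<omega>. X \<omega> s $ i - X \<omega> t $ i)
      = distr (distr M ?P (\<lambda>\<omega>. restrict (\<lambda>t. X \<omega> t $ i) {0..1})) borel (\<lambda>f. f s - f t)"
    using s t by (subst distr_distr[OF m component_measurable]) (simp add: o_def)
  also have "... = distr (distr M ?P (\<lambda>\<omega>. restrict (X0 \<omega>) {0..1})) borel (\<lambda>f. f s - f t)"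
    using ident by simp
  also have "... = distr M borel (\<lambda>\<omega>. X0 \<omega> s - X0 \<omega> t)"
    using s t by (subst distr_distr[OF m X0_meas]) (simp add: o_def)
  finally show ?thesis .
qed

lemma increment_small_ball:
  assumes s: "s \<in> {0..1}" and t: "t \<in> {0..1}" and "0 < \<delta> s t" "0 \<le> \<rho>"
  shows "emeasure M {\<omega> \<in> space M. norm (X \<omega> s - X \<omega> t) < \<rho>} \<le> ennreal ((\<rho> / \<delta> s t) powr CARD('d))"
proof -
  let ?P = "\<Pi>\<^sub>M t\<in>{0..1::real}. (borel :: real measure)"
  let ?Y = "\<lambda>i \<omega>. restrict (\<lambda>t. X \<omega> t $ i) {0..1}"
  \<comment> \<open>Independence is stated for whole restricted paths, so the increment event is
    placed in path space, where one set serves all components.\<close>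
  define A where "A = (\<lambda>f. f s - f t) -` {-\<rho><..<\<rho>} \<inter> space ?P"
  have A: "A \<in> sets ?P" unfolding A_def 
    by (rule measurable_sets[OF borel_measurable_PiM_increment[OF s t]]) simp
  have vimage: "?Y i -` A \<inter> space M = {\<omega> \<in> space M. \<bar>X \<omega> s $ i - X \<omega> t $ i\<bar> < \<rho>}" for i
    using s t by (auto simp: A_def space_PiM)
  have "emeasure M {\<omega> \<in> space M. norm (X \<omega> s - X \<omega> t) < \<rho>} \<le> emeasure M (\<Inter>i\<in>UNIV. ?Y i -` A \<inter> space M)"
  proof (rule emeasure_mono)
    show "{\<omega> \<in> space M. norm (X \<omega> s - X \<omega> t) < \<rho>} \<subseteq> (\<Inter>i\<in>UNIV. ?Y i -` A \<inter> space M)"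
      unfolding vimage using component_le_norm_cart[of "X _ s - X _ t"] by (auto intro: le_less_trans)
    show "(\<Inter>i\<in>UNIV. ?Y i -` A \<inter> space M) \<in> sets M"
      using measurable_sets[OF component_measurable A] by (intro sets.finite_INT) auto
  qed
  also have "... = ennreal (prob (\<Inter>i\<in>UNIV. ?Y i -` A \<inter> space M))" by (rule emeasure_eq_measure)
  also have "prob (\<Inter>i\<in>UNIV. ?Y i -` A \<inter> space M) = (\<Prod>i\<in>UNIV. prob (?Y i -` A \<inter> space M))"
    by (rule indep_varsD_finite[OF indep]) (use A in auto)
  also have "... \<le> (\<Prod>i\<in>(UNIV :: 'd set). \<rho> / \<delta> s t)"
  proof (rule prod_mono, intro conjI)
    fix i :: 'd
    have D: "distributed M lborel (\<lambda>\<omega>. X0 \<omega> s - X0 \<omega> t) (normal_density 0 (\<delta> s t))"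
      by (cases rule: increment_cases[OF s t]) (use assms(3) in auto)
    have "emeasure M (?Y i -` A \<inter> space M)
        = emeasure (distr M borel (\<lambda>\<omega>. X \<omega> s $ i - X \<omega> t $ i)) {-\<rho><..<\<rho>}"
      unfolding vimage by (subst emeasure_distr[OF increment_measurable(1)[OF s t]]) (auto intro!: arg_cong[where f = "emeasure M"])
    also have "... = emeasure M ((\<lambda>\<omega>. X0 \<omega> s - X0 \<omega> t) -` {-\<rho><..<\<rho>} \<inter> space M)"
      unfolding increment_distr[OF s t] by (rule emeasure_distr[OF increment_measurable(2)[OF s t]]) simp
    also have "... \<le> ennreal (\<rho> / \<delta> s t)" by (rule normal_small_ball[OF D assms(3,4)])
    finally show "prob (?Y i -` A \<inter> space M) \<le> \<rho> / \<delta> s t"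
      using assms(3,4) by (simp add: emeasure_eq_measure)
  qed simp
  also have "... = (\<rho> / \<delta> s t) ^ CARD('d)" by simp
  also have "... = (\<rho> / \<delta> s t) powr CARD('d)"
    using assms(3,4) by (cases "\<rho> = 0") (auto simp: powr_realpow)
  finally show ?thesis by (simp add: ennreal_leI)
qed

lemma increment_exp_square_le:
  assumes s: "s \<in> {0..1}" and t: "t \<in> {0..1}" and "\<delta> s t \<le> \<sigma>" "0 < \<sigma>"
  shows "(\<integral>\<^sup>+ \<omega>. ennreal (exp ((X \<omega> s $ i - X \<omega> t $ i)\<^sup>2 / (4 * \<sigma>\<^sup>2))) \<partial>M) \<le> 2"
proof -
  let ?g = "\<lambda>x::real. ennreal (exp (x\<^sup>2 / (4 * \<sigma>\<^sup>2)))"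
  have "(\<integral>\<^sup>+ \<omega>. ?g (X \<omega> s $ i - X \<omega> t $ i) \<partial>M) = (\<integral>\<^sup>+ x. ?g x \<partial>distr M borel (\<lambda>\<omega>. X \<omega> s $ i - X \<omega> t $ i))"
    by (rule nn_integral_distr[OF increment_measurable(1)[OF s t], symmetric]) measurable
  also have "... = (\<integral>\<^sup>+ \<omega>. ?g (X0 \<omega> s - X0 \<omega> t) \<partial>M)"
    unfolding increment_distr[OF s t] by (rule nn_integral_distr[OF increment_measurable(2)[OF s t]]) measurable
  also have "... \<le> 2"
    using s t
  proof (cases rule: increment_cases)
    case 1
    have "(\<integral>\<^sup>+ \<omega>. ?g (X0 \<omega> s - X0 \<omega> t) \<partial>M) = (\<integral>\<^sup>+ \<omega>. 1 \<partial>M)"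
      using 1(2) by (intro nn_integral_cong_AE) auto
    also have "... \<le> 2" by (simp add: emeasure_space_1)
    finally show ?thesis .
  next
    case 2
    show ?thesis by (rule normal_exp_square_le[OF 2(2,1) assms(3)])
  qed
  finally show ?thesis .
qed

end

subsection \<open>Energy and Hausdorff measure of images\<close>

lemma one_le_mult_inverse_ennreal:
  assumes "0 \<le> x" "x \<le> y" "0 < y"
  shows "1 \<le> ennreal y * inverse (ennreal x)"
proof (cases "x = 0")
  case True
  then show ?thesis using assms by (simp add: ennreal_mult_top)
next
  case False
  then have "1 \<le> y * inverse x" using assms by (simp add: field_simps)
  then show ?thesis using assms False
    by (simp add: inverse_ennreal ennreal_mult[symmetric] flip: ennreal_1)
qed

text \<open>Mass distribution: let \<open>A N\<close> be the part of \<open>E\<close> where the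
  potential is at most \<open>N\<close>; for some \<open>N\<close> it has positive mass. The
  preimage of a ball of radius \<open>r\<close> meets it in mass at most
  \<open>N * (2 * r) powr \<alpha>\<close>, and summing over a cover bounds the weight of the cover
  from below.\<close>

lemma hmeasure_pos_if_finite_energy:
  fixes f :: "real \<Rightarrow> 'v::euclidean_space"
  assumes sets_\<mu> [measurable_cong]: "sets \<mu> = sets borel" and "finite_measure \<mu>"
    and E: "E \<in> sets borel" and pos: "0 < emeasure \<mu> E"
    and f: "continuous_on UNIV f" and "0 < \<alpha>"
    and energy: "AE t in \<mu>. (\<integral>\<^sup>+ s. inverse (ennreal (dist (f s) (f t) powr \<alpha>)) \<partial>\<mu>) < top"
  shows "0 < hmeasure UNIV dist \<alpha> (f ` E)"
proof (rule ccontr)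
  let ?k = "\<lambda>s t. inverse (ennreal (dist (f s) (f t) powr \<alpha>))"
  interpret finite_measure \<mu> by fact
  have [measurable]: "f \<in> borel_measurable borel"
    using f by (rule borel_measurable_continuous_onI)
  define h where "h t = (\<integral>\<^sup>+ s. ?k s t \<partial>\<mu>)" for t
  have h [measurable]: "h \<in> borel_measurable borel" unfolding h_def by measurable
  have space_\<mu>: "space \<mu> = UNIV" using sets_eq_imp_space_eq[OF sets_\<mu>] by simp
  define A where "A N = {t \<in> E. h t \<le> of_nat N}" for N :: nat
  have A: "A N \<in> sets \<mu>" for N
  proof -
    have "{t \<in> space borel. h t \<le> of_nat N} \<in> sets borel" by measurable
    then have "{t \<in> space borel. h t \<le> of_nat N} \<inter> E \<in> sets borel" using E by (rule sets.Int)
    moreover have "A N = {t \<in> space borel. h t \<le> of_nat N} \<inter> E" by (auto simp: A_def)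
    ultimately show ?thesis by (simp add: sets_\<mu>)
  qed
  have "\<exists>N. emeasure \<mu> (A N) \<noteq> 0"
  proof (rule ccontr)
    assume "\<not> ?thesis"
    then have "(\<Union>N. A N) \<in> null_sets \<mu>" using A by (intro null_sets_UN) auto
    then have "AE t in \<mu>. t \<notin> (\<Union>N. A N)" by (rule AE_not_in)
    with energy have "AE t in \<mu>. t \<notin> E"
    proof eventually_elim
      case (elim t)
      then obtain N :: nat where "h t \<le> of_nat N"
      proof (cases "h t" rule: ennreal_cases)
        case (real r)
        obtain N :: nat where "r \<le> real N" using real_arch_simple by blast
        then show ?thesis using that[of N] real by (simp add: ennreal_of_nat_eq_real_of_nat ennreal_leI)
      qed (simp add: h_def[symmetric])
      then show ?case using elim by (auto simp: A_def)
    qed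
    then have "emeasure \<mu> E = 0"
      using E by (subst (asm) AE_iff_measurable[where N = E]) (auto simp: sets_\<mu> space_\<mu>)
    then show False using pos by simp
  qed
  then obtain N where N: "emeasure \<mu> (A N) \<noteq> 0" by blast
  define m where "m = measure \<mu> (A N)"
  have m: "0 < m" "emeasure \<mu> (A N) = ennreal m"
    using N by (auto simp: m_def emeasure_eq_measure zero_less_measure_iff)
  assume "\<not> 0 < hmeasure UNIV dist \<alpha> (f ` E)"
  then have "hmeasure UNIV dist \<alpha> (f ` E) = 0" by simp
  \<comment> \<open>One mesh suffices. The denominator \<open>N + 1\<close> makes the final
    comparison strict and admits \<open>N = 0\<close>.\<close>
  then have "hcontent UNIV dist \<alpha> 1 (f ` E) < ennreal (m / (real N + 1))"
    using m by (simp add: hmeasure_eq_0_iff)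
  then obtain c r where cr: "\<And>n. 0 \<le> r n"
      "f ` E \<subseteq> (\<Union>n. {y \<in> UNIV. dist (c n) y < r n})"
      "(\<Sum>n. ennreal ((2 * r n) powr \<alpha>)) < ennreal (m / (real N + 1))"
    by (rule hcontent_coverE) blast
  define B where "B n = {s. dist (c n) (f s) < r n}" for n
  have B: "B n \<in> sets \<mu>" for n
  proof -
    have "{s \<in> space borel. dist (c n) (f s) < r n} \<in> sets borel" by measurable
    then show ?thesis by (simp add: B_def sets_\<mu>)
  qed
  have AB: "emeasure \<mu> (A N \<inter> B n) \<le> of_nat N * ennreal ((2 * r n) powr \<alpha>)" for n
  proof (cases "A N \<inter> B n = {}")
    case False
    \<comment> \<open>The centre of the ball need not be a value of \<open>f\<close> on
      \<open>A N\<close>, so the potential is taken at a point \<open>t\<close> of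
      \<open>A N\<close> that the ball captures; this turns the radius into the diameter
      \<open>2 * r n\<close>.\<close>
    then obtain t where t: "h t \<le> of_nat N" "dist (c n) (f t) < r n" by (auto simp: A_def B_def)
    have "0 < r n" using t(2) zero_le_dist[of "c n" "f t"] by linarith
    have "emeasure \<mu> (A N \<inter> B n) \<le> emeasure \<mu> (B n)" using B by (intro emeasure_mono) auto
    also have "... = (\<integral>\<^sup>+ s. indicator (B n) s \<partial>\<mu>)" using B by simp
    also have "... \<le> (\<integral>\<^sup>+ s. ennreal ((2 * r n) powr \<alpha>) * ?k s t \<partial>\<mu>)"
    proof (rule nn_integral_mono)
      fix s
      show "indicator (B n) s \<le> ennreal ((2 * r n) powr \<alpha>) * ?k s t"
      proof (cases "s \<in> B n")
        case True
        then have "dist (f s) (f t) \<le> 2 * r n"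
          using t(2) dist_triangle3[of "f s" "f t" "c n"] by (simp add: B_def)
        then have "dist (f s) (f t) powr \<alpha> \<le> (2 * r n) powr \<alpha>"
          using \<open>0 < \<alpha>\<close> by (intro powr_mono2) auto
        then show ?thesis using True \<open>0 < r n\<close> one_le_mult_inverse_ennreal by simp
      qed simp
    qed
    also have "... = ennreal ((2 * r n) powr \<alpha>) * h t"
      unfolding h_def by (rule nn_integral_cmult) measurable
    also have "... \<le> ennreal ((2 * r n) powr \<alpha>) * of_nat N" using t(1) by (rule mult_left_mono) simp
    finally show ?thesis by (simp add: mult.commute)
  qed simp
  have "ennreal m = emeasure \<mu> (A N)" by (simp add: m)
  also have "... \<le> emeasure \<mu> (\<Union>n. A N \<inter> B n)"
    using cr(2) A B by (intro emeasure_mono) (auto simp: A_def B_def)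
  also have "... \<le> (\<Sum>n. emeasure \<mu> (A N \<inter> B n))"
    using A B by (intro emeasure_subadditive_countably) auto
  also have "... \<le> (\<Sum>n. of_nat N * ennreal ((2 * r n) powr \<alpha>))" by (intro suminf_le allI AB) auto
  also have "... = of_nat N * (\<Sum>n. ennreal ((2 * r n) powr \<alpha>))" by simp
  also have "... \<le> of_nat N * ennreal (m / (real N + 1))" using cr(3) by (intro mult_left_mono) auto
  also have "... = ennreal (real N * (m / (real N + 1)))"
    unfolding ennreal_of_nat_eq_real_of_nat by (rule ennreal_mult[symmetric]) (use m in auto)
  finally have "m \<le> real N * (m / (real N + 1))" using m by (simp add: ennreal_le_iff)
  then show False using m by (simp add: field_simps)
qed

section \<open>Growth of Frostman measures in the gauge distance\<close>

context gauge_metric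
begin

text \<open>Capping the argument makes the function continuous on the whole plane, hence jointly
  measurable; inside one level-\<open>n0\<close> cell the cap has no effect.\<close>

definition gdist :: "real \<Rightarrow> real \<Rightarrow> real" where
  "gdist s t = \<gamma> (min \<bar>s - t\<bar> (1 / 2 ^ n0))"

lemma gdist_nonneg: "0 \<le> gdist s t"
  unfolding gdist_def using \<gamma>_mono[of 0 "min \<bar>s - t\<bar> (1 / 2 ^ n0)"] by (simp add: \<gamma>_0)

lemma gdist_measurable [measurable]: "case_prod gdist \<in> borel_measurable (borel \<Otimes>\<^sub>M borel)"
proof -
  have "continuous_on UNIV (\<lambda>x::real. \<gamma> (min \<bar>x\<bar> (1 / 2 ^ n0)))"
    by (rule continuous_on_compose2[OF cont_\<gamma>]) (auto intro!: continuous_intros)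
  then have "(\<lambda>x::real. \<gamma> (min \<bar>x\<bar> (1 / 2 ^ n0))) \<in> borel_measurable borel"
    by (rule borel_measurable_continuous_onI)
  then have "(\<lambda>p. (\<lambda>x::real. \<gamma> (min \<bar>x\<bar> (1 / 2 ^ n0))) (fst p - snd p)) \<in> borel_measurable (borel \<Otimes>\<^sub>M borel)"
    by measurable
  then show ?thesis by (simp add: gdist_def split_beta')
qed

lemma gauge_less_top: "gauge \<beta> n < top"
  by (simp add: gauge_def)

lemma gauge_tendsto_0: "0 < \<beta> \<Longrightarrow> gauge \<beta> \<longlonglongrightarrow> 0"
proof -
  assume "0 < \<beta>"
  then have "(\<lambda>n. gam n powr \<beta>) \<longlonglongrightarrow> 0"
    using tendsto_zero_powrI[OF gam_tendsto_0 tendsto_const[of \<beta>]] gam_pos by (simp add: less_imp_le)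
  then show ?thesis unfolding gauge_def using tendsto_ennrealI[of _ 0] by fastforce
qed

text \<open>Up to the null set \<open>- E\<close>, a gauge ball around \<open>t\<close> lies in two
  intervals of length \<open>1 / 2 ^ n\<close> on either side of \<open>t\<close>, which gives 6 as
  twice 3; doubling then replaces \<open>gam n\<close> by \<rho>. The constant \<open>C2\<close>
  serves radii from \<open>gam n0\<close> on, where the total mass is the bound.\<close>

lemma frostman_growth:
  assumes sets_\<mu>: "sets \<mu> = sets borel" and "finite_measure \<mu>" and "0 < \<beta>"
    and null: "emeasure \<mu> (- E) = 0" and E: "E \<in> sets borel" "E \<subseteq> cell_set (n0, k)"
    and growth: "\<And>n a b. b - a \<le> 1 / 2 ^ n \<Longrightarrow> emeasure \<mu> {a<..b} \<le> 3 * gauge \<beta> n"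
  obtains C where "0 \<le> C"
    "\<And>t \<rho>. t \<in> E \<Longrightarrow> 0 < \<rho> \<Longrightarrow> emeasure \<mu> {s. gdist s t < \<rho>} \<le> ennreal (C * \<rho> powr \<beta>)"
proof -
  let ?I = "\<lambda>n t. {t - 1 / 2 ^ n<..t} \<union> {t<..t + 1 / 2 ^ n :: real}"
  interpret finite_measure \<mu> by fact
  have space_\<mu>: "space \<mu> = UNIV" using sets_eq_imp_space_eq[OF sets_\<mu>] by simp
  define C1 where "C1 = 6 * (4 * L\<^sup>2) powr \<beta>"
  define C2 where "C2 = measure \<mu> UNIV / gam n0 powr \<beta>"
  have C: "0 \<le> C1" "0 \<le> C2" by (auto simp: C1_def C2_def)
  have "emeasure \<mu> {s. gdist s t < \<rho>} \<le> ennreal ((C1 + C2) * \<rho> powr \<beta>)" if t: "t \<in> E" and "0 < \<rho>" for t \<rho>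
  proof (cases "\<rho> < gam n0")
    case True
    obtain n where n: "n0 \<le> n" "gam (Suc n) \<le> \<rho>" "\<rho> < gam n" using gam_scaleE \<open>0 < \<rho>\<close> True by blast
    have "{s. gdist s t < \<rho>} \<subseteq> - E \<union> (?I n t)"
    proof
      fix s assume s: "s \<in> {s. gdist s t < \<rho>}"
      show "s \<in> - E \<union> (?I n t)"
      proof (cases "s \<in> E")
        case True
        then have "cell n0 s = cell n0 t"
          using subsetD[OF E(2), of s] subsetD[OF E(2), of t] t by (simp add: cell_set_def)
        then have "\<bar>s - t\<bar> < 1 / 2 ^ n0" by (rule cell_eq_dist)
        moreover have "\<gamma> \<bar>s - t\<bar> < gam n" using s n(3) calculation by (simp add: gdist_def min_def)
        ultimately have "\<bar>s - t\<bar> < 1 / 2 ^ n" using n(1) by (intro less_half_power_if_\<gamma>) auto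
        then show ?thesis by (auto simp: abs_less_iff)
      qed simp
    qed
    then have "emeasure \<mu> {s. gdist s t < \<rho>}
        \<le> emeasure \<mu> (- E \<union> (?I n t))"
      using E(1) by (intro emeasure_mono) (auto simp: sets_\<mu>)
    also have "... \<le> emeasure \<mu> (- E) + emeasure \<mu> (?I n t)"
      using E(1) by (intro emeasure_subadditive) (auto simp: sets_\<mu>)
    also have "... \<le> 0 + (emeasure \<mu> {t - 1 / 2 ^ n<..t} + emeasure \<mu> {t<..t + 1 / 2 ^ n})"
      unfolding null by (intro add_left_mono emeasure_subadditive) (auto simp: sets_\<mu>)
    also have "... \<le> 0 + (3 * gauge \<beta> n + 3 * gauge \<beta> n)"
      by (intro add_left_mono add_mono growth) auto
    also have "... = ennreal (6 * gam n powr \<beta>)"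
      by (simp add: gauge_def ennreal_mult mult_2[symmetric] distrib_right[symmetric])
    also have "... \<le> ennreal ((C1 + C2) * \<rho> powr \<beta>)"
    proof (rule ennreal_leI)
      have "gam n \<le> 4 * L\<^sup>2 * gam (Suc n)" by (rule gam_doubling)
      also have "... \<le> 4 * L\<^sup>2 * \<rho>" by (intro mult_left_mono n) auto
      finally have "gam n powr \<beta> \<le> (4 * L\<^sup>2 * \<rho>) powr \<beta>" using gam_pos[of n] assms(3) by (intro powr_mono2) auto
      also have "... = (4 * L\<^sup>2) powr \<beta> * \<rho> powr \<beta>" using \<open>0 < \<rho>\<close> by (simp add: powr_mult)
      finally have "6 * gam n powr \<beta> \<le> C1 * \<rho> powr \<beta>" by (simp add: C1_def)
      also have "... \<le> (C1 + C2) * \<rho> powr \<beta>" using C by (intro mult_right_mono) auto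
      finally show "6 * gam n powr \<beta> \<le> (C1 + C2) * \<rho> powr \<beta>" .
    qed
    finally show ?thesis .
  next
    case False
    have "emeasure \<mu> {s. gdist s t < \<rho>} \<le> emeasure \<mu> UNIV"
      using sets.top[of \<mu>] by (intro emeasure_mono) (auto simp: space_\<mu>)
    also have "... = ennreal (C2 * gam n0 powr \<beta>)"
      using gam_pos[of n0] by (simp add: C2_def emeasure_eq_measure)
    also have "... \<le> ennreal ((C1 + C2) * \<rho> powr \<beta>)"
      using False C gam_pos[of n0] assms(3) by (intro ennreal_leI mult_mono powr_mono2) auto
    finally show ?thesis .
  qed
  then show thesis using that[of "C1 + C2"] C by simp
qed

end

locale gaussian_gauge = iid_gaussian M X X0 + gauge_metric "can_metric M X0" \<gamma> L n0
  for M :: "'a measure" and X :: "'a \<Rightarrow> real \<Rightarrow> real ^ 'd" and X0 \<gamma> L n0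

section \<open>Continuous extension of the paths and joint measurability\<close>

context iid_gaussian
begin

text \<open>Clamping time to the unit interval gives a process on the whole line, so that measures
  on \<open>borel\<close> and grid points beyond 1 raise no side conditions.\<close>

definition path :: "'a \<Rightarrow> real \<Rightarrow> real ^ 'd" where
  "path \<omega> s = X \<omega> (max 0 (min 1 s))"

lemma path_eq: "s \<in> {0..1} \<Longrightarrow> path \<omega> s = X \<omega> s"
  by (simp add: path_def)

lemma path_continuous: "\<omega> \<in> space M \<Longrightarrow> continuous_on UNIV (path \<omega>)"
  unfolding path_def
  by (rule continuous_on_compose2[of "{0..1}" "X \<omega>"]) (use cont in \<open>auto intro!: continuous_intros\<close>)

lemma path_measurable_at [measurable]: "(\<lambda>\<omega>. path \<omega> s) \<in> borel_measurable M"
  unfolding path_def by (rule X_measurable_at) auto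

text \<open>By continuity the path is the limit of its values at times rounded down to multiples of
  \<open>1 / (n + 1)\<close>, and each approximation involves countably many measurable
  coordinates.\<close>

lemma path_measurable_joint: "(\<lambda>p. path (fst p) (snd p)) \<in> borel_measurable (M \<Otimes>\<^sub>M borel)"
proof (rule borel_measurable_LIMSEQ_metric)
  fix n :: nat
  show "(\<lambda>p. path (fst p) (real_of_int \<lfloor>real (Suc n) * snd p\<rfloor> / real (Suc n))) \<in> borel_measurable (M \<Otimes>\<^sub>M borel)"
  proof (rule measurable_compose_countable[where f = "\<lambda>i p. path (fst p) (real_of_int i / real (Suc n))"])
    fix i :: int
    show "(\<lambda>p. path (fst p) (real_of_int i / real (Suc n))) \<in> borel_measurable (M \<Otimes>\<^sub>M (borel :: real measure))"
      by (rule measurable_compose[OF measurable_fst path_measurable_at])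
  qed measurable
next
  fix p assume "p \<in> space (M \<Otimes>\<^sub>M (borel :: real measure))"
  then have "fst p \<in> space M" by (auto simp: space_pair_measure)
  have "(\<lambda>n. real_of_int \<lfloor>real (Suc n) * snd p\<rfloor> / real (Suc n)) \<longlonglongrightarrow> snd p"
  proof (rule metric_tendsto_imp_tendsto[OF LIMSEQ_inverse_real_of_nat], intro always_eventually allI)
    fix n
    have "\<bar>real_of_int \<lfloor>real (Suc n) * snd p\<rfloor> - real (Suc n) * snd p\<bar> \<le> 1" by linarith
    then have "\<bar>(real_of_int \<lfloor>real (Suc n) * snd p\<rfloor> - real (Suc n) * snd p) / real (Suc n)\<bar> \<le> inverse (real (Suc n))"
      by (simp add: abs_divide divide_right_mono inverse_eq_divide del: of_nat_Suc)
    then show "dist (real_of_int \<lfloor>real (Suc n) * snd p\<rfloor> / real (Suc n)) (snd p) \<le> dist (inverse (real (Suc n))) 0"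
      by (simp add: dist_real_def diff_divide_distrib del: of_nat_Suc)
  qed
  then show "(\<lambda>n. path (fst p) (real_of_int \<lfloor>real (Suc n) * snd p\<rfloor> / real (Suc n))) \<longlonglongrightarrow> path (fst p) (snd p)"
    by (rule continuous_on_tendsto_compose[OF path_continuous[OF \<open>fst p \<in> space M\<close>]]) auto
qed

lemma path_measurable:
  assumes "f \<in> N \<rightarrow>\<^sub>M M" "g \<in> borel_measurable N"
  shows "(\<lambda>x. path (f x) (g x)) \<in> borel_measurable N"
  using measurable_compose[OF measurable_Pair[OF assms] path_measurable_joint] by simp

end

section \<open>Expected energy and the lower bound for the image\<close>

context gaussian_gauge
begin

text \<open>Negative moments of order \<alpha> below the number of components scale like
  \<open>\<delta> s t powr - \<alpha>\<close>, and \<delta> is at least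
  \<open>gdist s t / L\<close>. On the diagonal the right side is infinite.\<close>

lemma increment_potential:
  fixes \<alpha> :: real
  assumes s: "s \<in> {0..1}" and t: "t \<in> {0..1}" and "\<bar>s - t\<bar> \<le> 1 / 2 ^ n0" and "0 < \<alpha>" "\<alpha> < CARD('d)"
  shows "(\<integral>\<^sup>+ \<omega>. inverse (ennreal (dist (path \<omega> s) (path \<omega> t) powr \<alpha>)) \<partial>M)
    \<le> ennreal ((1 + potential_const \<alpha> CARD('d)) * L powr \<alpha>) * inverse (ennreal (gdist s t powr \<alpha>))"
proof (cases "s = t")
  case True
  then show ?thesis
    using potential_const_nonneg[OF assms(5)] L by (simp add: gdist_def \<gamma>_0 ennreal_mult_top add_pos_nonneg)
next
  case False
  have g: "gdist s t = \<gamma> \<bar>s - t\<bar>" using assms(3) by (simp add: gdist_def min_def)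
  have g_pos: "0 < gdist s t" unfolding g by (rule \<gamma>_pos) (use False assms(3) in auto)
  have g_le: "gdist s t \<le> L * \<delta> s t" unfolding g by (rule \<gamma>_le[OF s t])
  have \<delta>_pos: "0 < \<delta> s t" using g_pos g_le L zero_less_mult_iff[of L "\<delta> s t"] by linarith
  have "(\<integral>\<^sup>+ \<omega>. inverse (ennreal (dist (path \<omega> s) (path \<omega> t) powr \<alpha>)) \<partial>M)
      \<le> ennreal (1 + potential_const \<alpha> CARD('d)) * inverse (ennreal (\<delta> s t powr \<alpha>))"
  proof (rule nn_integral_inverse_powr_scaled_le)
    fix \<rho> :: real assume "0 < \<rho>"
    then show "emeasure M {\<omega> \<in> space M. dist (path \<omega> s) (path \<omega> t) < \<rho>} \<le> ennreal ((\<rho> / \<delta> s t) powr CARD('d))"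
      using increment_small_ball[OF s t \<delta>_pos, of \<rho>] s t by (simp add: path_eq dist_norm)
  qed (use \<delta>_pos assms emeasure_space_1 in auto)
  also have "inverse (ennreal (\<delta> s t powr \<alpha>)) \<le> ennreal (L powr \<alpha>) * inverse (ennreal (gdist s t powr \<alpha>))"
  proof -
    have "gdist s t powr \<alpha> \<le> (L * \<delta> s t) powr \<alpha>" using g_pos g_le assms(4) by (intro powr_mono2) auto
    also have "... = L powr \<alpha> * \<delta> s t powr \<alpha>" using L \<delta>_pos by (simp add: powr_mult)
    finally have "inverse (\<delta> s t powr \<alpha>) \<le> L powr \<alpha> * inverse (gdist s t powr \<alpha>)"
      using \<delta>_pos g_pos by (simp add: field_simps)
    then show ?thesis using \<delta>_pos g_pos
      by (simp add: inverse_ennreal ennreal_mult[symmetric])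
  qed
  finally show ?thesis
    using potential_const_nonneg[OF assms(5)] by (simp add: ennreal_mult mult.assoc mult_left_mono)
qed

text \<open>Two strict inequalities keep the expected energy finite: \<alpha> below the number of
  components for the expected kernel, and \<alpha> below the Frostman exponent \<beta> for
  integrating the power \<open>- \<alpha>\<close> of \<open>gdist\<close>.\<close>

theorem image_hmeasure_pos:
  fixes \<alpha> \<beta> :: real
  assumes E: "E \<in> sets borel" "E \<subseteq> {0..1}" and pos: "0 < hmeasure {0..1} \<delta> \<beta> E"
    and \<alpha>: "0 < \<alpha>" "\<alpha> < \<beta>" "\<alpha> < CARD('d)"
  shows "AE \<omega> in M. 0 < hmeasure UNIV dist \<alpha> (X \<omega> ` E)"
proof -
  have "0 < \<beta>" using \<alpha> by simp
  have "net_content (gauge \<beta>) E \<noteq> 0"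
    using hmeasure_eq_0_if_net_content[OF _ \<open>0 < \<beta>\<close> E(2)] pos by auto
  moreover have "net_content (gauge \<beta>) E \<le> (\<Sum>k\<in>{0..2 ^ n0 :: int}. net_content (gauge \<beta>) (E \<inter> cell_set (n0, k)))"
  proof -
    have "net_content (gauge \<beta>) E \<le> net_content (gauge \<beta>) (\<Union>k\<in>{0..2 ^ n0}. E \<inter> cell_set (n0, k))"
      using cell_set_unit_interval[of n0] E(2) by (intro net_content_mono) auto
    also have "... \<le> (\<Sum>k\<in>{0..2 ^ n0 :: int}. net_content (gauge \<beta>) (E \<inter> cell_set (n0, k)))"
      by (rule net_content_UN_finite_le) simp
    finally show ?thesis .
  qed
  \<comment> \<open>By subadditivity some level-\<open>n0\<close> cell retains positive content;
    inside it \<gamma> controls all distances.\<close>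
  ultimately obtain k where "net_content (gauge \<beta>) (E \<inter> cell_set (n0, k)) \<noteq> 0"
    by (metis (no_types, lifting) le_zero_eq sum.neutral)
  then have k: "0 < net_content (gauge \<beta>) (E \<inter> cell_set (n0, k))" by (simp add: zero_less_iff_neq_zero)
  define E' where "E' = E \<inter> cell_set (n0, k)"
  have E': "E' \<in> sets borel" "E' \<subseteq> {0..1}" "E' \<subseteq> cell_set (n0, k)"
  proof -
    have "{x \<in> space borel. \<lfloor>2 ^ n0 * x :: real\<rfloor> = k} \<in> sets borel" by measurable
    then show "E' \<in> sets borel" using E(1) by (simp add: E'_def cell_set_def cell_def)
  qed (use E in \<open>auto simp: E'_def\<close>)
  obtain \<mu> where \<mu>: "sets \<mu> = sets borel" "finite_measure \<mu>" "emeasure \<mu> (- E') = 0" "0 < emeasure \<mu> E'"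
    "\<And>n a b. b - a \<le> 1 / 2 ^ n \<Longrightarrow> emeasure \<mu> {a<..b} \<le> 3 * gauge \<beta> n"
    using frostman_net_content[OF gauge_less_top gauge_tendsto_0[OF \<open>0 < \<beta>\<close>] E'(1,2)] k
    unfolding E'_def by metis
  obtain C where C: "0 \<le> C"
    "\<And>t \<rho>. t \<in> E' \<Longrightarrow> 0 < \<rho> \<Longrightarrow> emeasure \<mu> {s. gdist s t < \<rho>} \<le> ennreal (C * \<rho> powr \<beta>)"
    by (rule frostman_growth[OF \<mu>(1,2) \<open>0 < \<beta>\<close> \<mu>(3) E'(1,3)]) (use \<mu>(5) that in blast)+
  interpret \<mu>: finite_measure \<mu> by fact
  interpret \<mu>\<mu>: pair_sigma_finite \<mu> \<mu> ..
  interpret P: pair_sigma_finite M "\<mu> \<Otimes>\<^sub>M \<mu>" ..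
  have sf: "sigma_finite_measure (\<mu> \<Otimes>\<^sub>M \<mu>)" by unfold_locales
  note [measurable_cong] = \<mu>(1)
  have space_\<mu>: "space \<mu> = UNIV" using sets_eq_imp_space_eq[OF \<mu>(1)] by simp
  have AE_E': "AE s in \<mu>. s \<in> E'"
    using \<mu>(1,3) E'(1) by (subst AE_iff_measurable[where N = "- E'"]) (auto simp: space_\<mu>)
  have [measurable]:
      "(\<lambda>p. path (fst p) (fst (snd p))) \<in> borel_measurable (M \<Otimes>\<^sub>M (\<mu> \<Otimes>\<^sub>M \<mu>))"
      "(\<lambda>p. path (fst p) (snd (snd p))) \<in> borel_measurable (M \<Otimes>\<^sub>M (\<mu> \<Otimes>\<^sub>M \<mu>))"
      "(\<lambda>p. path (snd p) (fst (fst p))) \<in> borel_measurable ((\<mu> \<Otimes>\<^sub>M \<mu>) \<Otimes>\<^sub>M M)"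
      "(\<lambda>p. path (snd p) (snd (fst p))) \<in> borel_measurable ((\<mu> \<Otimes>\<^sub>M \<mu>) \<Otimes>\<^sub>M M)"
    by (rule path_measurable; measurable)+
  define K where "K = (1 + potential_const \<alpha> CARD('d)) * L powr \<alpha>"
  define K' where "K' = emeasure \<mu> UNIV + ennreal (C * potential_const \<alpha> \<beta>)"
  let ?k = "\<lambda>\<omega> s t. inverse (ennreal (dist (path \<omega> s) (path \<omega> t) powr \<alpha>))"
  have "(\<integral>\<^sup>+ \<omega>. (\<integral>\<^sup>+ q. ?k \<omega> (fst q) (snd q) \<partial>(\<mu> \<Otimes>\<^sub>M \<mu>)) \<partial>M)
      = (\<integral>\<^sup>+ q. (\<integral>\<^sup>+ \<omega>. ?k \<omega> (fst q) (snd q) \<partial>M) \<partial>(\<mu> \<Otimes>\<^sub>M \<mu>))"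
    using P.Fubini[of "\<lambda>p. ?k (fst p) (fst (snd p)) (snd (snd p))"] by simp
  also have "... = (\<integral>\<^sup>+ t. (\<integral>\<^sup>+ s. (\<integral>\<^sup>+ \<omega>. ?k \<omega> s t \<partial>M) \<partial>\<mu>) \<partial>\<mu>)"
  proof -
    have "(\<lambda>q. \<integral>\<^sup>+ \<omega>. ?k \<omega> (fst q) (snd q) \<partial>M) \<in> borel_measurable (\<mu> \<Otimes>\<^sub>M \<mu>)"
    proof (rule borel_measurable_nn_integral)
      show "case_prod (\<lambda>q \<omega>. ?k \<omega> (fst q) (snd q)) \<in> borel_measurable ((\<mu> \<Otimes>\<^sub>M \<mu>) \<Otimes>\<^sub>M M)"
        unfolding split_beta' by measurable
    qed
    from \<mu>\<mu>.nn_integral_snd[OF this] show ?thesis by simp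
  qed
  also have "... \<le> (\<integral>\<^sup>+ t. ennreal K * K' \<partial>\<mu>)"
  proof (rule nn_integral_mono_AE)
    show "AE t in \<mu>. (\<integral>\<^sup>+ s. (\<integral>\<^sup>+ \<omega>. ?k \<omega> s t \<partial>M) \<partial>\<mu>) \<le> ennreal K * K'"
      using AE_E'
    proof eventually_elim
      case t: (elim t)
      have [measurable]: "(\<lambda>s. gdist s t) \<in> borel_measurable borel"
      proof -
        have "(\<lambda>s. (s, t)) \<in> borel \<rightarrow>\<^sub>M borel \<Otimes>\<^sub>M borel" by measurable
        from measurable_compose[OF this gdist_measurable] show ?thesis by simp
      qed
      have "(\<integral>\<^sup>+ s. (\<integral>\<^sup>+ \<omega>. ?k \<omega> s t \<partial>M) \<partial>\<mu>) \<le> (\<integral>\<^sup>+ s. ennreal K * inverse (ennreal (gdist s t powr \<alpha>)) \<partial>\<mu>)"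
      proof (rule nn_integral_mono_AE)
        show "AE s in \<mu>. (\<integral>\<^sup>+ \<omega>. ?k \<omega> s t \<partial>M) \<le> ennreal K * inverse (ennreal (gdist s t powr \<alpha>))"
          using AE_E'
        proof eventually_elim
          case (elim s)
          then have "cell n0 s = cell n0 t"
            using subsetD[OF E'(3), of s] subsetD[OF E'(3), of t] t by (simp add: cell_set_def)
          then have "\<bar>s - t\<bar> \<le> 1 / 2 ^ n0" using cell_eq_dist by (simp add: less_imp_le)
          then show ?case unfolding K_def using elim t E'(2) \<alpha> by (intro increment_potential) auto
        qed
      qed
      also have "... = ennreal K * (\<integral>\<^sup>+ s. inverse (ennreal (gdist s t powr \<alpha>)) \<partial>\<mu>)"
        by (rule nn_integral_cmult) measurable
      also have "... \<le> ennreal K * (emeasure \<mu> (space \<mu>) + ennreal (C * potential_const \<alpha> \<beta>))"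
        using C t gdist_nonneg \<alpha> by (intro mult_left_mono nn_integral_inverse_powr_le) (auto simp: space_\<mu>)
      finally show ?case by (simp add: K'_def space_\<mu>)
    qed
  qed
  also have "... = ennreal K * K' * emeasure \<mu> UNIV" by (simp add: space_\<mu>)
  also have "... < top" unfolding K'_def by (simp add: ennreal_mult_less_top \<mu>.emeasure_eq_measure)
  finally have "AE \<omega> in M. (\<integral>\<^sup>+ q. ?k \<omega> (fst q) (snd q) \<partial>(\<mu> \<Otimes>\<^sub>M \<mu>)) \<noteq> \<infinity>"
    using sigma_finite_measure.borel_measurable_nn_integral_fst[OF sf, of "\<lambda>p. ?k (fst p) (fst (snd p)) (snd (snd p))" M]
    by (intro nn_integral_PInf_AE) auto
  then show ?thesis
    using AE_space
  proof eventually_elim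
    case (elim \<omega>)
    have [measurable]: "path \<omega> \<in> borel_measurable borel"
      using path_continuous[OF elim(2)] by (rule borel_measurable_continuous_onI)
    have m: "(\<lambda>q. ?k \<omega> (fst q) (snd q)) \<in> borel_measurable (\<mu> \<Otimes>\<^sub>M \<mu>)" by measurable
    have "(\<integral>\<^sup>+ t. (\<integral>\<^sup>+ s. ?k \<omega> s t \<partial>\<mu>) \<partial>\<mu>) \<noteq> \<infinity>"
      using \<mu>\<mu>.nn_integral_snd[OF m] elim(1) by simp
    then have "AE t in \<mu>. (\<integral>\<^sup>+ s. ?k \<omega> s t \<partial>\<mu>) \<noteq> \<infinity>"
      by (rule nn_integral_PInf_AE[rotated]) measurable
    then have "0 < hmeasure UNIV dist \<alpha> (path \<omega> ` E')"
      using \<mu> E' \<alpha> path_continuous[OF elim(2)]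
      by (intro hmeasure_pos_if_finite_energy[where \<mu> = \<mu>]) (auto simp: less_top)
    moreover have "path \<omega> ` E' = X \<omega> ` E'" using E'(2) path_eq by (intro image_cong) auto
    moreover have "hmeasure UNIV dist \<alpha> (X \<omega> ` E') \<le> hmeasure UNIV dist \<alpha> (X \<omega> ` E)"
      unfolding hmeasure_def by (intro SUP_mono') (auto intro!: hcontent_mono simp: E'_def)
    ultimately show ?case by (simp add: less_le_trans)
  qed
qed

text \<open>The exceptional null set depends on the exponent, so positivity is used for the
  countably many rational exponents, which are dense below the minimum.\<close>

theorem image_dim_ge:
  assumes E: "E \<in> sets borel" "E \<subseteq> {0..1}"
  shows "AE \<omega> in M. min (ereal CARD('d)) (hdim {0..1} \<delta> E) \<le> hdim UNIV dist (X \<omega> ` E)"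
proof -
  have "AE \<omega> in M. \<forall>q::rat. 0 < q \<longrightarrow> ereal (of_rat q) < min (ereal CARD('d)) (hdim {0..1} \<delta> E) \<longrightarrow>
      ereal (of_rat q) \<le> hdim UNIV dist (X \<omega> ` E)"
  proof (subst AE_all_countable, intro allI AE_impI)
    fix q :: rat assume q: "0 < q" "ereal (of_rat q) < min (ereal CARD('d)) (hdim {0..1} \<delta> E)"
    then obtain \<beta> where "of_rat q < \<beta>" "0 < hmeasure {0..1} \<delta> \<beta> E"
      using less_hdimE[of "of_rat q" "{0..1}" \<delta> E] by auto
    then have "AE \<omega> in M. 0 < hmeasure UNIV dist (of_rat q) (X \<omega> ` E)"
      using q by (intro image_hmeasure_pos[OF E]) auto
    then show "AE \<omega> in M. ereal (of_rat q) \<le> hdim UNIV dist (X \<omega> ` E)"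
      by eventually_elim (use q(1) in \<open>simp add: hdim_geI\<close>)
  qed
  then show ?thesis
  proof eventually_elim
    case (elim \<omega>)
    show ?case
    proof (rule ccontr)
      assume "\<not> ?thesis"
      then obtain x :: real where x: "hdim UNIV dist (X \<omega> ` E) < ereal x"
          "ereal x < min (ereal CARD('d)) (hdim {0..1} \<delta> E)"
        using ereal_dense2 by (metis not_le)
      then obtain y :: real where y: "ereal x < ereal y" "ereal y < min (ereal CARD('d)) (hdim {0..1} \<delta> E)"
        using ereal_dense2 by blast
      then obtain q where q: "x < of_rat q" "of_rat q < y" using of_rat_dense[of x y] by auto
      have "0 < x" using x(1) hdim_nonneg[of UNIV dist "X \<omega> ` E"] by (metis ereal_less(2) le_less_trans)
      then have "0 < q" using q(1) by (metis less_trans zero_less_of_rat_iff)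
      moreover have "ereal (of_rat q) < min (ereal CARD('d)) (hdim {0..1} \<delta> E)"
        using q(2) y(2) by (metis ereal_less_eq(3) le_less_trans less_imp_le)
      ultimately have "ereal (of_rat q) \<le> hdim UNIV dist (X \<omega> ` E)" using elim by blast
      then show False using x(1) q(1) by (metis ereal_less_eq(3) leD le_less_trans less_imp_le)
    qed
  qed
qed

end

lemma hdim_graph_ge:
  assumes "E \<subseteq> {0..1}"
  shows "hdim {0..1} d E \<le> hdim ({0..1} \<times> UNIV) (graph_metric d) ((\<lambda>t. (t, x t)) ` E)"
proof (rule hdim_mono)
  fix \<beta> :: real
  assume "hmeasure ({0..1} \<times> UNIV) (graph_metric d) \<beta> ((\<lambda>t. (t, x t)) ` E) = 0"
  then have "hmeasure {0..1} d \<beta> (fst ` ((\<lambda>t. (t, x t)) ` E)) = 0"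
    by (rule hmeasure_image_eq_0) (auto simp: graph_metric_def)
  then show "hmeasure {0..1} d \<beta> E = 0" by (simp add: image_image)
qed

subsection \<open>Chaining along doubly exponential grids\<close>

text \<open>Unlike dyadic grids, these lose only the factor \<open>2\<^bsup>j/2\<^esup>\<close> per level that the weight
  \<open>1 / (y sqrt (ln (1/y)))\<close> of the entropy condition can absorb.\<close>

definition chain_size :: "nat \<Rightarrow> nat" where
  "chain_size j = (case j of 0 \<Rightarrow> 1 | Suc i \<Rightarrow> 2 ^ 2 ^ i)"

lemma chain_size_pos: "0 < chain_size j"
  by (simp add: chain_size_def split: nat.split)

lemma chain_size_mono_Suc: "chain_size j \<le> chain_size (Suc j)"
  by (auto simp: chain_size_def split: nat.split)

lemma ln_chain_size_le: "ln (chain_size (Suc j)) \<le> 2 ^ j"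
  using ln_2_less_1 by (simp add: chain_size_def ln_realpow mult_le_cancel_left1)

definition chain_const :: "nat \<Rightarrow> real" where
  "chain_const j = 2 ^ Suc j * chain_size (Suc j) * chain_size j"

lemma chain_const_pos: "0 < chain_const j"
  using chain_size_pos by (simp add: chain_const_def)

text \<open>Each of the three factors has logarithm at most \<open>2 ^ j\<close>.\<close>

lemma ln_chain_const_le: "ln (chain_const j) \<le> 3 * 2 ^ j"
proof -
  have "real (Suc j) * ln 2 \<le> real (Suc j) * 1"
    using ln_2_less_1 by (intro mult_left_mono) auto
  also have "real (Suc j) * 1 \<le> 2 ^ j" by (induction j) auto
  finally have "ln (2 ^ Suc j :: real) \<le> 2 ^ j" by (simp add: ln_realpow del: power_Suc)
  moreover have "ln (chain_size j) \<le> ln (chain_size (Suc j))"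
    using chain_size_pos[of j] chain_size_mono_Suc[of j] by (simp add: ln_mono)
  moreover have "ln (chain_const j) = ln (2 ^ Suc j :: real) + ln (chain_size (Suc j)) + ln (chain_size j)"
    unfolding chain_const_def using chain_size_pos by (simp add: ln_mult)
  ultimately show ?thesis using ln_chain_size_le[of j] by linarith
qed

text \<open>Taking logarithms, the level costs a multiple of \<open>2 ^ j\<close> and the energy
  costs \<open>ln q\<close>. The sum of the square roots is bounded by a product, so that
  \<open>q\<close> factors out of the sum over levels.\<close>

lemma link_bound:
  assumes "exp (x\<^sup>2 / (4 * \<sigma>\<^sup>2)) \<le> chain_const j * q" "1 \<le> q" "0 < \<sigma>"
  shows "\<bar>x\<bar> \<le> 4 * \<sigma> * sqrt (2 ^ j) * (1 + sqrt (ln q))"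
proof -
  have q: "0 \<le> ln q" using assms(2) by simp
  have "x\<^sup>2 / (4 * \<sigma>\<^sup>2) \<le> ln (chain_const j * q)"
    using assms chain_const_pos[of j] by (subst ln_ge_iff) auto
  also have "... = ln (chain_const j) + ln q"
    using assms(2) chain_const_pos[of j] by (simp add: ln_mult)
  also have "... \<le> 4 * 2 ^ j + ln q"
    using ln_chain_const_le[of j] zero_le_power[of "2::real" j] by linarith
  finally have "x\<^sup>2 \<le> (4 * 2 ^ j + ln q) * (4 * \<sigma>\<^sup>2)"
    using assms(3) by (simp add: pos_divide_le_eq)
  then have "\<bar>x\<bar> \<le> sqrt ((4 * 2 ^ j + ln q) * (4 * \<sigma>\<^sup>2))"
    by (metis real_sqrt_abs real_sqrt_le_iff)
  also have "... = 2 * \<sigma> * sqrt (4 * 2 ^ j + ln q)" using assms(3) by (simp add: real_sqrt_mult)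
  also have "... \<le> 2 * \<sigma> * (sqrt (4 * 2 ^ j) + sqrt (ln q))"
    using assms(3) q by (intro mult_left_mono sqrt_add_le_add_sqrt) auto
  also have "... = 4 * \<sigma> * sqrt (2 ^ j) + 2 * \<sigma> * sqrt (ln q)" by (simp add: real_sqrt_mult algebra_simps)
  also have "... \<le> 4 * \<sigma> * sqrt (2 ^ j) + 4 * \<sigma> * sqrt (2 ^ j) * sqrt (ln q)"
  proof -
    have "1 \<le> sqrt (2 ^ j :: real)" by simp
    then have "2 * \<sigma> * 1 \<le> 4 * \<sigma> * sqrt (2 ^ j)" using assms(3) by (intro mult_mono) auto
    then show ?thesis using q by (intro add_left_mono mult_right_mono) auto
  qed
  finally show ?thesis by (simp add: algebra_simps)
qed

definition grid_point :: "real \<Rightarrow> real \<Rightarrow> nat \<Rightarrow> nat \<Rightarrow> real" where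
  "grid_point a h j i = a + h * real i / chain_size j"

text \<open>Rounding down places the \<open>j\<close>-th approximant at most
  \<open>h / chain_size j\<close> below \<open>t\<close>, so consecutive ones are within the
  distance at which links are counted. Strictness of \<open>t < a + h\<close> keeps the index below
  \<open>chain_size j\<close>.\<close>

lemma grid_approximation:
  assumes "a \<le> t" "t < a + h"
  obtains p where "\<And>j. p j < chain_size j" "\<And>j. grid_point a h j (p j) \<le> t"
    "\<And>j. t - grid_point a h j (p j) \<le> h / chain_size j" "grid_point a h 0 (p 0) = a"
proof -
  have h: "0 < h" using assms by simp
  define p where "p j = nat \<lfloor>chain_size j * ((t - a) / h)\<rfloor>" for j
  have u: "0 \<le> (t - a) / h" "(t - a) / h < 1" using assms h by auto
  have nn: "0 \<le> chain_size j * ((t - a) / h)" for j by (intro mult_nonneg_nonneg u) simp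
  have p: "real (p j) \<le> chain_size j * ((t - a) / h)" "chain_size j * ((t - a) / h) < real (p j) + 1" for j
    using nn[of j] unfolding p_def by (auto simp: of_nat_nat)
  have pos: "0 < real (chain_size j)" for j using chain_size_pos by simp
  have "p j < chain_size j" for j
  proof -
    have "chain_size j * ((t - a) / h) < real (chain_size j) * 1" using pos u by (intro mult_strict_left_mono)
    then have "real (p j) < chain_size j" using p(1)[of j] by linarith
    then show ?thesis by simp
  qed
  moreover have "grid_point a h j (p j) \<le> t" for j
    using p(1)[of j] h pos[of j] by (simp add: grid_point_def field_simps)
  moreover have "t - grid_point a h j (p j) \<le> h / chain_size j" for j
  proof -
    have "(t - a) / h < (real (p j) + 1) / chain_size j"
      using p(2)[of j] pos[of j] by (simp add: pos_less_divide_eq mult.commute)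
    then have "t - a < h * ((real (p j) + 1) / chain_size j)" using h by (simp add: pos_divide_less_eq mult.commute)
    then show ?thesis by (simp add: grid_point_def add_divide_distrib distrib_left)
  qed
  moreover have "grid_point a h 0 (p 0) = a"
    using calculation(1)[of 0] by (simp add: grid_point_def chain_size_def)
  ultimately show ?thesis using that by blast
qed

lemma chain_size_filterlim: "filterlim (\<lambda>j. real (chain_size j)) at_top sequentially"
proof (rule filterlim_at_top_mono[OF filterlim_real_sequentially], rule always_eventually, rule allI)
  fix j
  show "real j \<le> real (chain_size j)"
  proof (cases j)
    case (Suc i)
    have "Suc i \<le> 2 ^ i" by (induction i) auto
    also have "(2::nat) ^ i \<le> 2 ^ 2 ^ i" by (intro power_increasing) (auto simp: less_exp less_imp_le)
    finally show ?thesis using Suc by (simp only: chain_size_def nat.case of_nat_le_iff)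
  qed simp
qed

section \<open>Exponential moments along chains\<close>

context gaussian_gauge
begin

lemma path_increment_exp_le:
  assumes "0 < x" "x \<le> 1 / 2 ^ n0" "\<bar>s - t\<bar> \<le> x"
  shows "(\<integral>\<^sup>+ \<omega>. ennreal (exp ((path \<omega> s $ c - path \<omega> t $ c)\<^sup>2 / (4 * (L * \<gamma> x)\<^sup>2))) \<partial>M) \<le> 2"
  unfolding path_def
proof (rule increment_exp_square_le)
  let ?s = "max 0 (min 1 s)" and ?t = "max 0 (min 1 t)"
  show st: "?s \<in> {0..1}" "?t \<in> {0..1}" by auto
  have "\<bar>?s - ?t\<bar> \<le> x" using assms(3) by linarith
  then have "\<gamma> \<bar>?s - ?t\<bar> \<le> \<gamma> x" using assms by (intro \<gamma>_mono) auto
  then show "\<delta> ?s ?t \<le> L * \<gamma> x" using \<delta>_le[OF st] L by (meson mult_left_mono order_trans zero_le_one)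
  show "0 < L * \<gamma> x" using L \<gamma>_pos[OF assms(1,2)] by simp
qed

text \<open>Each link contributes the exponential moment of its normalised square, with mean at most 2; since
  \<^term>\<open>chain_const j\<close> exceeds the number of links of level \<open>j\<close> by a factor \<open>2\<^bsup>j+1\<^esup>\<close>, the sum is
  integrable, and a finite value bounds all links at once.\<close>

definition link_energy :: "real \<Rightarrow> real \<Rightarrow> 'd \<Rightarrow> nat \<Rightarrow> nat \<Rightarrow> nat \<Rightarrow> 'a \<Rightarrow> ennreal" where
  "link_energy a h c j i i' \<omega> = ennreal (exp ((path \<omega> (grid_point a h (Suc j) i) $ c
     - path \<omega> (grid_point a h j i') $ c)\<^sup>2 / (4 * (L * \<gamma> (h / chain_size j))\<^sup>2)))"

definition chain_energy :: "real \<Rightarrow> real \<Rightarrow> 'd \<Rightarrow> 'a \<Rightarrow> ennreal" where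
  "chain_energy a h c \<omega> = (\<Sum>j. \<Sum>i<chain_size (Suc j). \<Sum>i'<chain_size j.
     if \<bar>grid_point a h (Suc j) i - grid_point a h j i'\<bar> \<le> h / chain_size j
     then ennreal (1 / chain_const j) * link_energy a h c j i i' \<omega> else 0)"

lemma path_component_measurable [measurable]: "(\<lambda>\<omega>. path \<omega> s $ c) \<in> borel_measurable M"
  unfolding path_def by (rule component_measurable_at) auto

lemma link_energy_measurable [measurable]: "link_energy a h c j i i' \<in> borel_measurable M"
  unfolding link_energy_def[abs_def] by measurable

lemma chain_energy_measurable [measurable]: "chain_energy a h c \<in> borel_measurable M"
  unfolding chain_energy_def[abs_def] by measurable

lemma chain_energy_le:
  assumes h: "0 < h" "h \<le> 1 / 2 ^ n0"
  shows "(\<integral>\<^sup>+ \<omega>. chain_energy a h c \<omega> \<partial>M) \<le> 2"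
proof -
  let ?e = "link_energy a h c"
  let ?b = "\<lambda>j i i'. \<bar>grid_point a h (Suc j) i - grid_point a h j i'\<bar> \<le> h / chain_size j"
  have "(\<integral>\<^sup>+ \<omega>. chain_energy a h c \<omega> \<partial>M)
      = (\<Sum>j. \<Sum>i<chain_size (Suc j). \<Sum>i'<chain_size j.
          \<integral>\<^sup>+ \<omega>. (if ?b j i i' then ennreal (1 / chain_const j) * ?e j i i' \<omega> else 0) \<partial>M)"
    unfolding chain_energy_def by (simp add: nn_integral_suminf nn_integral_sum)
  also have "... \<le> (\<Sum>j. \<Sum>i<chain_size (Suc j). \<Sum>i'<chain_size j. ennreal (1 / chain_const j) * 2)"
  proof (intro suminf_le allI sum_mono)
    fix j i i'
    have "0 < h / chain_size j" using h chain_size_pos by simp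
    moreover have "h / chain_size j \<le> 1 / 2 ^ n0"
    proof -
      have "h / chain_size j \<le> h / 1" using h chain_size_pos[of j] by (intro divide_left_mono) auto
      then show ?thesis using h by simp
    qed
    ultimately have "(\<integral>\<^sup>+ \<omega>. ?e j i i' \<omega> \<partial>M) \<le> 2" if "?b j i i'"
      using that unfolding link_energy_def by (rule path_increment_exp_le)
    then show "(\<integral>\<^sup>+ \<omega>. (if ?b j i i' then ennreal (1 / chain_const j) * ?e j i i' \<omega> else 0) \<partial>M)
        \<le> ennreal (1 / chain_const j) * 2"
      by (cases "?b j i i'") (simp_all add: nn_integral_cmult mult_left_mono)
  qed auto
  also have "... = (\<Sum>j. ennreal (2 * (1/2) ^ Suc j))"
  proof (intro arg_cong[where f = suminf] ext)
    fix j
    have "(\<Sum>i<chain_size (Suc j). \<Sum>i'<chain_size j. ennreal (1 / chain_const j) * 2)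
        = ennreal (real (chain_size (Suc j)) * (real (chain_size j) * (1 / chain_const j * 2)))"
    proof -
      have "ennreal (real (chain_size (Suc j)) * (real (chain_size j) * (1 / chain_const j * 2)))
          = ennreal (real (chain_size (Suc j))) * (ennreal (real (chain_size j)) * (ennreal (1 / chain_const j) * ennreal 2))"
        using chain_const_pos[of j]
        by (simp only: ennreal_mult of_nat_0_le_iff mult_nonneg_nonneg divide_nonneg_pos zero_le_one zero_le_numeral)
      then show ?thesis by (simp add: ennreal_of_nat_eq_real_of_nat)
    qed
    also have "real (chain_size (Suc j)) * (real (chain_size j) * (1 / chain_const j * 2)) = 2 * (1/2) ^ Suc j"
      using chain_size_pos[of j] chain_size_pos[of "Suc j"] unfolding chain_const_def
      by (simp add: power_one_over field_simps)
    finally show "(\<Sum>i<chain_size (Suc j). \<Sum>i'<chain_size j. ennreal (1 / chain_const j) * 2)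
        = ennreal (2 * (1/2) ^ Suc j)" .
  qed
  also have "... = ennreal 2" by (rule suminf_ennreal_half_powers) simp
  finally show ?thesis by simp
qed

text \<open>The estimate is pathwise: each link on the chain from \<open>a\<close> to
  \<open>t\<close> is a single term of the energy, the links telescope, and continuity of the path
  gives the limit. Since the energy does not depend on \<open>t\<close>, all \<open>t\<close> of the
  interval are treated at once and no supremum has to be measured.\<close>

lemma chain_energy_oscillation:
  assumes h: "0 < h" "h \<le> 1 / 2 ^ n0" and t: "a \<le> t" "t < a + h" and \<omega>: "\<omega> \<in> space M"
    and q: "chain_energy a h c \<omega> \<le> ennreal q" "1 \<le> q"
    and S: "\<And>J. (\<Sum>j<J. sqrt (2 ^ j) * \<gamma> (h / chain_size j)) \<le> S"
  shows "\<bar>path \<omega> t $ c - path \<omega> a $ c\<bar> \<le> 4 * L * (1 + sqrt (ln q)) * S"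
proof -
  obtain p where p: "\<And>j. p j < chain_size j" "\<And>j. grid_point a h j (p j) \<le> t"
    "\<And>j. t - grid_point a h j (p j) \<le> h / chain_size j" "grid_point a h 0 (p 0) = a"
    using grid_approximation[OF t] by blast
  define x where "x j = path \<omega> (grid_point a h j (p j)) $ c" for j
  have link: "\<bar>x (Suc j) - x j\<bar> \<le> 4 * (L * \<gamma> (h / chain_size j)) * sqrt (2 ^ j) * (1 + sqrt (ln q))" for j
  proof (rule link_bound)
    let ?f = "\<lambda>j i i'. if \<bar>grid_point a h (Suc j) i - grid_point a h j i'\<bar> \<le> h / chain_size j
     then ennreal (1 / chain_const j) * link_energy a h c j i i' \<omega> else 0"
    have "h / chain_size (Suc j) \<le> h / chain_size j"
      using h chain_size_pos[of j] chain_size_mono_Suc[of j] by (intro divide_left_mono) auto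
    then have "\<bar>grid_point a h (Suc j) (p (Suc j)) - grid_point a h j (p j)\<bar> \<le> h / chain_size j"
      using p(2,3)[of j] p(2,3)[of "Suc j"] by linarith
    then have "ennreal (1 / chain_const j) * ennreal (exp ((x (Suc j) - x j)\<^sup>2 / (4 * (L * \<gamma> (h / chain_size j))\<^sup>2)))
        = ?f j (p (Suc j)) (p j)"
      by (simp add: x_def link_energy_def)
    also have "... \<le> (\<Sum>i'<chain_size j. ?f j (p (Suc j)) i')"
      by (rule member_le_sum) (use p(1) in auto)
    also have "... \<le> (\<Sum>i<chain_size (Suc j). \<Sum>i'<chain_size j. ?f j i i')"
      by (rule member_le_sum[where f = "\<lambda>i. \<Sum>i'<chain_size j. ?f j i i'"]) (use p(1) in auto)
    also have "... = (\<Sum>j\<in>{j}. \<Sum>i<chain_size (Suc j). \<Sum>i'<chain_size j. ?f j i i')"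
      by (subst sum.insert) auto
    also have "... \<le> chain_energy a h c \<omega>" unfolding chain_energy_def by (rule sum_le_suminf) auto
    also note q(1)
    finally have "1 / chain_const j * exp ((x (Suc j) - x j)\<^sup>2 / (4 * (L * \<gamma> (h / chain_size j))\<^sup>2)) \<le> q"
      using q(2) chain_const_pos[of j] by (simp add: ennreal_mult[symmetric])
    then show "exp ((x (Suc j) - x j)\<^sup>2 / (4 * (L * \<gamma> (h / chain_size j))\<^sup>2)) \<le> chain_const j * q"
      using chain_const_pos[of j] by (simp add: field_simps)
    have "h / chain_size j \<le> h / 1" using h chain_size_pos[of j] by (intro divide_left_mono) auto
    then show "0 < L * \<gamma> (h / chain_size j)"
      using L h chain_size_pos[of j] by (intro mult_pos_pos \<gamma>_pos) auto
  qed (rule q(2))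
  have "\<bar>x J - path \<omega> a $ c\<bar> \<le> 4 * L * (1 + sqrt (ln q)) * S" for J
  proof -
    have "x J - path \<omega> a $ c = (\<Sum>j<J. x (Suc j) - x j)"
      using p(4) sum_lessThan_telescope[of x J] by (simp add: x_def)
    also have "\<bar>...\<bar> \<le> (\<Sum>j<J. \<bar>x (Suc j) - x j\<bar>)" by (rule sum_abs)
    also have "... \<le> (\<Sum>j<J. 4 * (L * \<gamma> (h / chain_size j)) * sqrt (2 ^ j) * (1 + sqrt (ln q)))"
      by (intro sum_mono link)
    also have "... = 4 * L * (1 + sqrt (ln q)) * (\<Sum>j<J. sqrt (2 ^ j) * \<gamma> (h / chain_size j))"
      by (simp add: sum_distrib_left algebra_simps)
    also have "... \<le> 4 * L * (1 + sqrt (ln q)) * S"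
      using L q(2) by (intro mult_left_mono S) auto
    finally show ?thesis .
  qed
  moreover have "(\<lambda>J. \<bar>x J - path \<omega> a $ c\<bar>) \<longlonglongrightarrow> \<bar>path \<omega> t $ c - path \<omega> a $ c\<bar>"
  proof (intro tendsto_rabs tendsto_diff tendsto_const)
    have "(\<lambda>j. t - grid_point a h j (p j)) \<longlonglongrightarrow> 0"
    proof (rule tendsto_sandwich[where f = "\<lambda>_. 0" and h = "\<lambda>j. h / chain_size j"])
      show "(\<lambda>j. h / chain_size j) \<longlonglongrightarrow> 0"
        by (rule real_tendsto_divide_at_top[OF tendsto_const chain_size_filterlim])
    qed (use p(2,3) in \<open>auto intro!: always_eventually\<close>)
    then have "(\<lambda>j. t - (t - grid_point a h j (p j))) \<longlonglongrightarrow> t - 0" by (intro tendsto_diff tendsto_const)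
    then have "(\<lambda>j. path \<omega> (grid_point a h j (p j))) \<longlonglongrightarrow> path \<omega> t"
      by (intro continuous_on_tendsto_compose[OF path_continuous[OF \<omega>]]) auto
    then show "x \<longlonglongrightarrow> path \<omega> t $ c" unfolding x_def by (rule tendsto_vec_nth)
  qed
  ultimately show ?thesis by (intro LIMSEQ_le_const2) auto
qed

end

subsection \<open>The entropy condition\<close>

lemma nn_integral_inverse_Ioc:
  fixes a b :: real
  assumes "0 < a" "a \<le> b"
  shows "(\<integral>\<^sup>+ y. ennreal (1 / y) * indicator {a<..b} y \<partial>lborel) = ennreal (ln b - ln a)"
proof -
  have "(\<integral>\<^sup>+ y. ennreal (1 / y) * indicator {a<..b} y \<partial>lborel) = (\<integral>\<^sup>+ y. ennreal (1 / y) * indicator {a..b} y \<partial>lborel)"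
    by (rule nn_integral_cong_AE)
       (use AE_lborel_singleton[of a] in \<open>eventually_elim, auto split: split_indicator\<close>)
  also have "... = ennreal (ln b - ln a)"
    using assms by (intro nn_integral_FTC_Icc) (auto intro!: derivative_eq_intros)
  finally show ?thesis .
qed

context gauge_metric
begin

text \<open>On the block \<open>{b (Suc k)<..b k}\<close> with \<open>b k = 1 / 2 ^ 2 ^ k\<close>
  the measure \<open>dy / y\<close> has mass \<open>2 ^ k * ln 2\<close>, and
  \<open>ln (1 / y)\<close> is at most \<open>2 ^ Suc k\<close>. So the block contributes at least a
  quarter of \<open>sqrt (2 ^ Suc k) * \<gamma> (h * b (Suc k))\<close>. The blocks match the grids,
  since \<open>chain_size (k + 2)\<close> is the reciprocal of \<open>b (k + 1)\<close>.\<close>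

lemma entropy_sum_le:
  assumes "condition_C \<gamma> \<epsilon>" "0 < \<epsilon>"
  obtains C n1 where "0 < C" "n0 \<le> n1"
    "\<And>n J. n1 \<le> n \<Longrightarrow> (\<Sum>j<J. sqrt (2 ^ j) * \<gamma> (1 / 2 ^ n / chain_size j)) \<le> C * gam n powr (1 - \<epsilon>)"
proof -
  obtain c x0 where c: "0 < c" and x0: "0 < x0" and
    int: "\<And>x. 0 < x \<Longrightarrow> x < x0 \<Longrightarrow>
      (\<integral>\<^sup>+ y \<in> {0<..1/2}. ennreal (\<gamma> (x * y) / (y * sqrt (ln (1 / y)))) \<partial>lborel) \<le> ennreal (c * \<gamma> x powr (1 - \<epsilon>))"
    using assms(1) unfolding condition_C_def by blast
  obtain m :: nat where m: "(1 / 2) ^ m < x0" using real_arch_pow_inv[OF x0, of "1/2"] by auto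
  define n1 where "n1 = max m n0"
  \<comment> \<open>The 3 accounts for levels 0 and 1, which no block represents; there
    \<open>\<gamma> h \<le> gam n0 powr \<epsilon> * \<gamma> h powr (1 - \<epsilon>)\<close> is
    used. The 8 undoes the quarter and includes \<open>sqrt 2 \<le> 2\<close>, as level
    \<open>k + 2\<close> is compared with block \<open>k\<close>.\<close>
  define C where "C = 3 * gam n0 powr \<epsilon> + 8 * c"
  define b where "b k = (1 / 2 ^ 2 ^ k :: real)" for k :: nat
  let ?I = "\<lambda>k. indicator {b (Suc k)<..b k}" and ?l = "\<lambda>k. ln (b k) - ln (b (Suc k))"
  let ?g = "\<lambda>h k. sqrt (2 ^ Suc k) * \<gamma> (h * b (Suc k))"
  have b_pos: "0 < b k" for k by (simp add: b_def)
  have b_anti: "b (Suc k) \<le> b k" for k unfolding b_def by (intro half_power_le) simp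
  have b_half: "b k \<le> 1 / 2" for k
    unfolding b_def using half_power_le[of 1 "2 ^ k"] by simp
  have ind: "(\<Sum>k<J. ?I k y) \<le> (indicator {b J<..1/2} y :: ennreal)" for J y
  proof (induction J)
    case (Suc J)
    have "(\<Sum>k<Suc J. ?I k y)
        \<le> indicator {b J<..1/2} y + (indicator {b (Suc J)<..b J} y :: ennreal)"
      using Suc by (simp add: add_right_mono)
    also have "... \<le> indicator {b (Suc J)<..1/2} y"
      using b_anti[of J] b_half[of J] by (auto split: split_indicator)
    finally show ?case .
  qed simp
  have "(\<Sum>j<J. sqrt (2 ^ j) * \<gamma> (1 / 2 ^ n / chain_size j)) \<le> C * gam n powr (1 - \<epsilon>)" if n: "n1 \<le> n" for n J
  proof -
    define h where "h = (1 / 2 ^ n :: real)"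
    have h: "0 < h" "h \<le> 1 / 2 ^ n0" "h < x0"
    proof -
      have "h \<le> (1 / 2) ^ m" unfolding h_def using half_power_le[of m n] n by (simp add: n1_def power_one_over)
      then show "h < x0" using m by simp
    qed (use n half_power_le[of n0 n] in \<open>auto simp: h_def n1_def\<close>)
    have "n0 \<le> n" using n by (simp add: n1_def)
    then have gam_n: "gam n = \<gamma> h" by (simp add: gam_def h_def max_absorb1)
    have hb: "0 < h * b k" "h * b k \<le> 1 / 2 ^ n0" for k
    proof -
      have "h * b k \<le> h * 1" using h b_half[of k] by (intro mult_left_mono) auto
      then show "h * b k \<le> 1 / 2 ^ n0" using h(2) by linarith
    qed (use h b_pos[of k] in auto)
    have \<gamma>_hb: "0 \<le> \<gamma> (h * b k)" for k using \<gamma>_pos[OF hb] by (simp add: less_imp_le)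
    have "(\<Sum>k<J. ?g h k / 4) \<le> c * \<gamma> h powr (1 - \<epsilon>)" for J
    proof -
      let ?c = "\<lambda>k. \<gamma> (h * b (Suc k)) / sqrt (2 ^ Suc k)"
      have c_nn: "0 \<le> ?c k" for k using \<gamma>_hb by simp
      have "ennreal (\<Sum>k<J. ?g h k / 4) \<le> ennreal (\<Sum>k<J. ?c k * (?l k))"
      proof (intro ennreal_leI sum_mono)
        fix k
        have "?l k = 2 ^ k * ln 2"
          by (simp add: b_def ln_div ln_realpow)
        moreover have "2 ^ k * (1 / 2) \<le> 2 ^ k * ln (2::real)" using ln2_ge_two_thirds by (intro mult_left_mono) auto
        ultimately have "?c k * (2 ^ k * (1 / 2)) \<le> ?c k * (?l k)"
          using c_nn by (intro mult_left_mono) auto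
        moreover have "?c k * (2 ^ k * (1 / 2)) = ?g h k / 4"
        proof -
          have "sqrt (2 ^ Suc k) * sqrt (2 ^ Suc k) = (2 * 2 ^ k :: real)" by simp
          then have "2 ^ k * (1 / 2) = sqrt (2 ^ Suc k) * (sqrt (2 ^ Suc k) / 4 :: real)" by simp
          then have "?c k * (2 ^ k * (1 / 2)) = ?c k * (sqrt (2 ^ Suc k) * (sqrt (2 ^ Suc k) / 4))" by (simp only:)
          also have "... = ?g h k / 4"
          proof -
            have *: "g / s * (s * (s / 4)) = s * g / 4" if "0 < s" for g s :: real
              using that by (simp add: field_simps)
            show ?thesis by (rule *) simp
          qed
          finally show ?thesis .
        qed
        ultimately show "?g h k / 4 \<le> ?c k * (?l k)"
          by (simp only:)
      qed
      also have "... = (\<Sum>k<J. ennreal (?c k) * ennreal (?l k))"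
      proof -
        have d_nn: "0 \<le> ?l k" for k using b_pos b_anti by (simp add: ln_mono)
        have "(\<Sum>k<J. ennreal (?c k) * ennreal (?l k))
            = (\<Sum>k<J. ennreal (?c k * (?l k)))"
          by (intro sum.cong refl ennreal_mult[symmetric] c_nn d_nn)
        also have "... = ennreal (\<Sum>k<J. ?c k * (?l k))"
          by (intro sum_ennreal mult_nonneg_nonneg c_nn d_nn)
        finally show ?thesis by (rule sym)
      qed
      also have "... = (\<Sum>k<J. ennreal (?c k) * (\<integral>\<^sup>+ y. ennreal (1 / y) * ?I k y \<partial>lborel))"
        using nn_integral_inverse_Ioc[OF b_pos b_anti] by simp
      also have "... = (\<integral>\<^sup>+ y. (\<Sum>k<J. ennreal (?c k) * (ennreal (1 / y) * ?I k y)) \<partial>lborel)"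
        by (simp add: nn_integral_sum nn_integral_cmult del: power_Suc)
      also have "... \<le> (\<integral>\<^sup>+ y \<in> {0<..1/2}. ennreal (\<gamma> (h * y) / (y * sqrt (ln (1 / y)))) \<partial>lborel)"
      proof (rule nn_integral_mono)
        fix y :: real
        let ?f = "ennreal (\<gamma> (h * y) / (y * sqrt (ln (1 / y))))"
        have "ennreal (?c k) * (ennreal (1 / y) * ?I k y) \<le> ?f * ?I k y" for k
        proof (cases "y \<in> {b (Suc k)<..b k}")
          case True
          have y: "0 < y" "y \<le> 1 / 2" using True b_pos[of "Suc k"] b_half[of k] by auto
          have "ln (1 / y) \<le> ln (1 / b (Suc k))"
            using y True b_pos[of "Suc k"] by (intro ln_mono divide_left_mono) auto
          also have "... = 2 ^ Suc k * ln 2" by (simp add: b_def ln_realpow)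
          also have "... \<le> 2 ^ Suc k * 1" using ln_2_less_1 by (intro mult_left_mono) auto
          finally have "sqrt (ln (1 / y)) \<le> sqrt (2 ^ Suc k)" by simp
          moreover have "0 < ln (1 / y)" using y by simp
          moreover have "\<gamma> (h * b (Suc k)) \<le> \<gamma> (h * y)"
          proof (rule \<gamma>_mono)
            have "h * y \<le> h * 1" using y h by (intro mult_left_mono) auto
            then show "h * y \<le> 1 / 2 ^ n0" using h(2) by linarith
          qed (use h True b_pos[of "Suc k"] in \<open>auto intro!: mult_left_mono\<close>)
          ultimately have "?c k * (1 / y) \<le> \<gamma> (h * y) / sqrt (ln (1 / y)) * (1 / y)"
            using y \<gamma>_hb[of "Suc k"] by (intro mult_right_mono frac_le) auto
          then show ?thesis using True y c_nn[of k]
            by (simp add: ennreal_mult[symmetric] ennreal_leI mult.commute del: power_Suc)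
        qed simp
        then have "(\<Sum>k<J. ennreal (?c k) * (ennreal (1 / y) * ?I k y))
            \<le> (\<Sum>k<J. ?f * ?I k y)" by (rule sum_mono)
        also have "... = ?f * (\<Sum>k<J. ?I k y)" by (simp add: sum_distrib_left)
        also have "... \<le> ?f * indicator {b J<..1/2} y" by (intro mult_left_mono ind) simp
        also have "... \<le> ?f * indicator {0<..1/2} y"
          using b_pos[of J] by (intro mult_left_mono) (auto split: split_indicator)
        finally show "(\<Sum>k<J. ennreal (?c k) * (ennreal (1 / y) * ?I k y)) \<le> ?f * indicator {0<..1/2} y" .
      qed
      also have "... \<le> ennreal (c * \<gamma> h powr (1 - \<epsilon>))" by (rule int[OF h(1,3)])
      finally show ?thesis using c by (subst (asm) ennreal_le_iff) auto
    qed
    note key = this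
    have "(\<Sum>j<J. sqrt (2 ^ j) * \<gamma> (h / chain_size j)) \<le> (\<Sum>j<Suc (Suc J). sqrt (2 ^ j) * \<gamma> (h / chain_size j))"
    proof (rule sum_mono2)
      fix j
      have "h / chain_size j \<le> h / 1" using h chain_size_pos[of j] by (intro divide_left_mono) auto
      then show "0 \<le> sqrt (2 ^ j) * \<gamma> (h / chain_size j)"
        using h chain_size_pos[of j] by (intro mult_nonneg_nonneg less_imp_le[OF \<gamma>_pos]) auto
    qed auto
    also have "... = \<gamma> h + sqrt 2 * \<gamma> (h / 2) + (\<Sum>k<J. sqrt (2 ^ Suc (Suc k)) * \<gamma> (h * b (Suc k)))"
      unfolding sum.lessThan_Suc_shift by (simp add: chain_size_def b_def o_def)
    also have "... \<le> \<gamma> h + 2 * \<gamma> h + 8 * (c * \<gamma> h powr (1 - \<epsilon>))"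
    proof (intro add_mono mult_mono order_refl)
      show "sqrt 2 \<le> 2" using real_sqrt_le_mono[of 2 4] by simp
      show "\<gamma> (h / 2) \<le> \<gamma> h" using h by (intro \<gamma>_mono) auto
      show "0 \<le> \<gamma> (h / 2)" using h by (intro less_imp_le[OF \<gamma>_pos]) auto
      have "(\<Sum>k<J. sqrt (2 ^ Suc (Suc k)) * \<gamma> (h * b (Suc k))) \<le> (\<Sum>k<J. 8 * (?g h k / 4))"
      proof (rule sum_mono)
        fix k
        have "sqrt 2 \<le> (2::real)" using real_sqrt_le_mono[of 2 4] by simp
        then have "sqrt 2 * (?g h k) \<le> 2 * (?g h k)"
          using \<gamma>_hb by (intro mult_right_mono mult_nonneg_nonneg) auto
        moreover have "sqrt (2 ^ Suc (Suc k)) = sqrt 2 * sqrt (2 ^ Suc k :: real)"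
          by (subst real_sqrt_mult[symmetric]) simp
        ultimately show "sqrt (2 ^ Suc (Suc k)) * \<gamma> (h * b (Suc k)) \<le> 8 * (?g h k / 4)"
          by simp
      qed
      also have "... = 8 * (\<Sum>k<J. ?g h k / 4)" by (simp add: sum_distrib_left)
      also have "... \<le> 8 * (c * \<gamma> h powr (1 - \<epsilon>))" by (intro mult_left_mono key) simp
      finally show "(\<Sum>k<J. sqrt (2 ^ Suc (Suc k)) * \<gamma> (h * b (Suc k))) \<le> 8 * (c * \<gamma> h powr (1 - \<epsilon>))" .
    qed auto
    also have "... \<le> C * gam n powr (1 - \<epsilon>)"
    proof -
      have "gam n = gam n powr \<epsilon> * gam n powr (1 - \<epsilon>)"
        using gam_pos[of n] by (simp add: powr_add[symmetric])
      also have "... \<le> gam n0 powr \<epsilon> * gam n powr (1 - \<epsilon>)"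
        using n gam_pos[of n] gam_antimono[of n0 n] assms(2)
        by (intro mult_right_mono powr_mono2) (auto simp: n1_def)
      finally show ?thesis unfolding gam_n C_def by (simp add: algebra_simps)
    qed
    finally show ?thesis by (simp add: h_def)
  qed
  moreover have "0 < C" using c by (simp add: C_def add_nonneg_pos)
  ultimately show thesis using that[of C n1] by (simp add: n1_def)
qed

end

subsection \<open>Covering cubes by balls\<close>

text \<open>Rounding every coordinate down to a lattice of spacing \<tau> around \<open>x\<close>
  errs by less than \<tau> per coordinate, and the Euclidean norm is at most the sum of the absolute
  coordinates. The count comes from lattice indices in \<open>{- int m - 1..int m}\<close>.\<close>

lemma cube_netE:
  fixes x :: "real ^ 'd" and \<tau> :: real
  assumes "0 < \<tau>"
  obtains Z where "finite Z" "card Z \<le> (2 * m + 2) ^ CARD('d)"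
    "\<And>y. (\<And>c. \<bar>y $ c - x $ c\<bar> \<le> real m * \<tau>) \<Longrightarrow> \<exists>z\<in>Z. norm (z - y) < CARD('d) * \<tau>"
proof -
  define I where "I = PiE (UNIV :: 'd set) (\<lambda>_. {- int m - 1..int m})"
  define g :: "('d \<Rightarrow> int) \<Rightarrow> real ^ 'd" where "g f = (\<chi> c. x $ c + \<tau> * of_int (f c))" for f
  have "finite I" unfolding I_def by (intro finite_PiE) auto
  moreover have "card I = (2 * m + 2) ^ CARD('d)"
  proof -
    have "card {- int m - 1..int m} = 2 * m + 2" by simp
    then show ?thesis unfolding I_def by (simp add: card_PiE del: card_atLeastAtMost_int)
  qed
  ultimately have "finite (g ` I)" "card (g ` I) \<le> (2 * m + 2) ^ CARD('d)"
    using card_image_le[of I g] by auto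
  moreover have "\<exists>z\<in>g ` I. norm (z - y) < CARD('d) * \<tau>" if y: "\<And>c. \<bar>y $ c - x $ c\<bar> \<le> real m * \<tau>" for y
  proof -
    define f where "f c = \<lfloor>(y $ c - x $ c) / \<tau>\<rfloor>" for c
    have "f c \<in> {- int m - 1..int m}" for c
    proof -
      have "\<bar>(y $ c - x $ c) / \<tau>\<bar> \<le> real m" using y[of c] assms by (simp add: abs_divide pos_divide_le_eq)
      then have "- real m \<le> (y $ c - x $ c) / \<tau>" "(y $ c - x $ c) / \<tau> \<le> real m" by linarith+
      then have "- int m \<le> f c" "f c \<le> int m" unfolding f_def by linarith+
      then show ?thesis by simp
    qed
    then have "f \<in> I" by (simp add: I_def PiE_UNIV_domain)
    moreover have "norm (g f - y) < CARD('d) * \<tau>"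
    proof -
      have "\<bar>(g f - y) $ c\<bar> < \<tau>" for c
      proof -
        have "(y $ c - x $ c) / \<tau> - 1 < of_int (f c)" "of_int (f c) \<le> (y $ c - x $ c) / \<tau>"
          unfolding f_def by linarith+
        then have "y $ c - x $ c - \<tau> < \<tau> * of_int (f c)" "\<tau> * of_int (f c) \<le> y $ c - x $ c"
          using assms by (simp_all add: field_simps)
        then show ?thesis by (simp add: g_def abs_less_iff)
      qed
      then have "(\<Sum>c\<in>UNIV. \<bar>(g f - y) $ c\<bar>) < (\<Sum>c\<in>(UNIV :: 'd set). \<tau>)"
        by (intro sum_strict_mono) auto
      then show ?thesis using norm_le_l1_cart[of "g f - y"] by simp
    qed
    ultimately show ?thesis by blast
  qed
  ultimately show ?thesis using that by blast
qed

text \<open>With d components, a bounded set needs of the order of \<open>R powr - d\<close> balls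
  of radius \<open>R\<close>. Their total weight is at most \<open>K * R powr (\<beta> - d)\<close>
  with positive exponent, and \<open>R\<close> is chosen to bring this below
  \<open>e\<close>.\<close>

lemma hmeasure_bounded_eq_0:
  fixes G :: "(real ^ 'd) set" and \<beta> :: real
  assumes "bounded G" and \<beta>: "CARD('d) < \<beta>"
  shows "hmeasure UNIV dist \<beta> G = 0"
proof (rule hmeasure_eq_0I)
  fix \<eta> e :: real assume \<eta>: "0 < \<eta>" and e: "0 < e"
  let ?d = "real CARD('d)"
  obtain B where B: "0 < B" "\<And>y. y \<in> G \<Longrightarrow> norm y \<le> B" using assms(1) unfolding bounded_pos by blast
  define K where "K = (2 * B * ?d + 4) powr ?d * 2 powr \<beta>"
  have d: "0 < ?d" by simp
  have "0 < 2 * B * ?d + 4" using B(1) d by (intro add_pos_pos mult_pos_pos) auto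
  then have "0 < (2 * B * ?d + 4) powr ?d" by (metis less_irrefl powr_gt_zero)
  then have "0 < K" unfolding K_def by (intro mult_pos_pos) auto
  define R where "R = min (min \<eta> 1) ((e / K) powr (1 / (\<beta> - ?d)))"
  have R: "0 < R" "R \<le> \<eta>" "R \<le> 1" "R \<le> (e / K) powr (1 / (\<beta> - ?d))"
    using \<eta> e \<open>0 < K\<close> by (auto simp: R_def)
  define \<tau> where "\<tau> = R / ?d"
  have \<tau>: "0 < \<tau>" "?d * \<tau> = R" using R d by (auto simp: \<tau>_def)
  define m where "m = nat \<lceil>B / \<tau>\<rceil>"
  have m: "B / \<tau> \<le> real m" "real m \<le> B / \<tau> + 1"
    using divide_pos_pos[OF B(1) \<tau>(1)] unfolding m_def by linarith+
  obtain Z where Z: "finite Z" "card Z \<le> (2 * m + 2) ^ CARD('d)"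
    "\<And>y. (\<And>c. \<bar>y $ c - (0 :: real ^ 'd) $ c\<bar> \<le> real m * \<tau>) \<Longrightarrow> \<exists>z\<in>Z. norm (z - y) < ?d * \<tau>"
    by (rule cube_netE[OF \<tau>(1), of m "0 :: real ^ 'd"]) blast
  have "hcontent UNIV dist \<beta> \<eta> G \<le> of_nat (card Z) * ennreal ((2 * R) powr \<beta>)"
  proof (rule hcontent_finite_balls_le)
    show "G \<subseteq> (\<Union>c\<in>Z. {y \<in> UNIV. dist c y < R})"
    proof
      fix y assume "y \<in> G"
      have "\<bar>y $ c - (0 :: real ^ 'd) $ c\<bar> \<le> real m * \<tau>" for c
      proof -
        have "\<bar>y $ c\<bar> \<le> B" using component_le_norm_cart[of y c] B(2)[OF \<open>y \<in> G\<close>] by linarith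
        also have "B \<le> real m * \<tau>" using m(1) \<tau>(1) by (simp add: pos_divide_le_eq)
        finally show ?thesis by simp
      qed
      then show "y \<in> (\<Union>c\<in>Z. {y \<in> UNIV. dist c y < R})" using Z(3)[of y] \<tau>(2) by (auto simp: dist_norm)
    qed
  qed (use Z R in auto)
  also have "... = ennreal (real (card Z) * (2 * R) powr \<beta>)"
    by (simp add: ennreal_mult ennreal_of_nat_eq_real_of_nat)
  also have "... \<le> ennreal e"
  proof (rule ennreal_leI)
    have "real (card Z) \<le> real ((2 * m + 2) ^ CARD('d))" using Z(2) by (simp only: of_nat_le_iff)
    also have "... = (2 * real m + 2) powr ?d" by (simp add: powr_realpow add.commute)
    also have "... \<le> ((2 * B * ?d + 4) / R) powr ?d"
    proof (rule powr_mono2)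
      have "2 * real m + 2 \<le> 2 * (B / \<tau>) + 4" using m(2) by simp
      also have "... \<le> 2 * (B / \<tau>) + 4 / R" using R by (simp add: le_divide_eq)
      also have "... = (2 * B * ?d + 4) / R" using R d by (simp add: \<tau>_def field_simps)
      finally show "2 * real m + 2 \<le> (2 * B * ?d + 4) / R" .
    qed auto
    finally have "real (card Z) * (2 * R) powr \<beta> \<le> ((2 * B * ?d + 4) / R) powr ?d * (2 * R) powr \<beta>"
      by (intro mult_right_mono) auto
    also have "... = K * R powr (\<beta> - ?d)"
      using R B d by (simp add: K_def powr_divide powr_mult powr_diff)
    also have "... \<le> K * ((e / K) powr (1 / (\<beta> - ?d))) powr (\<beta> - ?d)"
      using R \<beta> \<open>0 < K\<close> by (intro mult_left_mono powr_mono2) auto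
    also have "... = e" using \<beta> e \<open>0 < K\<close> by (simp add: powr_powr)
    finally show "real (card Z) * (2 * R) powr \<beta> \<le> e" .
  qed
  finally show "hcontent UNIV dist \<beta> \<eta> G \<le> ennreal e" .
qed

text \<open>The inequality \<open>1 + u / d \<le> exp (u / d)\<close>, raised to the power
  \<open>d\<close>, returns \<open>exp u = q\<close>. Linearity in \<open>q\<close> is what lets the
  first moment of the energy control the \<open>d\<close>-th power of the oscillation.\<close>

lemma one_plus_sqrt_ln_power_le:
  assumes "1 \<le> q" "0 < d"
  shows "(1 + sqrt (ln q)) ^ d \<le> (2 * real d) ^ d * q"
proof -
  define u where "u = ln q"
  have u: "0 \<le> u" using assms(1) by (simp add: u_def)
  have d: "1 \<le> real d" using assms(2) by simp
  have "sqrt u \<le> 1 + u"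
    by (rule real_le_lsqrt) (use u in \<open>auto simp: power2_eq_square algebra_simps\<close>)
  have "1 + u / d \<le> exp (u / d)" by (rule exp_ge_add_one_self)
  then have "2 * d * (1 + u / d) \<le> 2 * d * exp (u / d)" using d by (intro mult_left_mono) auto
  moreover have "2 * d * (1 + u / d) = 2 * real d + 2 * u" using d by (simp add: field_simps)
  ultimately have "1 + sqrt u \<le> 2 * d * exp (u / d)" using \<open>sqrt u \<le> 1 + u\<close> u d by linarith
  then have "(1 + sqrt u) ^ d \<le> (2 * d * exp (u / d)) ^ d" using u by (intro power_mono) auto
  also have "... = (2 * real d) ^ d * exp u"
    using d by (simp add: power_mult_distrib exp_of_nat_mult[symmetric])
  finally show ?thesis using assms(1) by (simp add: u_def)
qed

subsection \<open>The graph over a dyadic cell\<close>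

context gaussian_gauge
begin

abbreviation "graph \<omega> E \<equiv> (\<lambda>t. (t, X \<omega> t)) ` E"
abbreviation "graph_content \<equiv> hcontent ({0..1} \<times> UNIV) (graph_metric \<delta>)"
abbreviation "graph_hmeasure \<equiv> hmeasure ({0..1} \<times> UNIV) (graph_metric \<delta>)"
abbreviation "graph_dim \<equiv> hdim ({0..1} \<times> UNIV) (graph_metric \<delta>)"

text \<open>The added 1 keeps the value at least 1, so that its logarithm is nonnegative when the
  oscillation bound is applied.\<close>

definition cell_energy :: "nat \<times> int \<Rightarrow> 'a \<Rightarrow> ennreal" where
  "cell_energy w \<omega> = 1 + (\<Sum>c\<in>UNIV. chain_energy (of_int (snd w) / 2 ^ fst w) (1 / 2 ^ fst w) c \<omega>)"

lemma cell_energy_measurable [measurable]: "cell_energy w \<in> borel_measurable M"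
  unfolding cell_energy_def[abs_def] by measurable

lemma cell_energy_le:
  assumes "n0 \<le> fst w"
  shows "(\<integral>\<^sup>+ \<omega>. cell_energy w \<omega> \<partial>M) \<le> ennreal (1 + 2 * CARD('d))"
proof -
  let ?e = "chain_energy (of_int (snd w) / 2 ^ fst w) (1 / 2 ^ fst w)"
  have "(\<integral>\<^sup>+ \<omega>. cell_energy w \<omega> \<partial>M) = 1 + (\<Sum>c\<in>UNIV. \<integral>\<^sup>+ \<omega>. ?e c \<omega> \<partial>M)"
    unfolding cell_energy_def by (simp add: nn_integral_add nn_integral_sum emeasure_space_1)
  also have "... \<le> 1 + (\<Sum>c\<in>(UNIV :: 'd set). 2)"
    using half_power_le[OF assms] by (intro add_left_mono sum_mono chain_energy_le) auto
  also have "... = ennreal (1 + 2 * CARD('d))"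
    by (simp add: ennreal_plus ennreal_mult ennreal_of_nat_eq_real_of_nat mult.commute)
  finally show ?thesis .
qed

text \<open>With \<rho> = \<open>gam (fst w)\<close>, the ball radius is of order \<rho> and the
  oscillation of order \<open>\<rho> powr (1 - \<epsilon>)\<close> times a function of the energy.
  So about \<open>\<rho> powr (- \<epsilon>)\<close> lattice steps are needed per coordinate, which
  lowers the exponent of the gauge by \<epsilon> for each component. \<open>K\<close> is uniform in
  the cell, the sample point and the mesh.\<close>

lemma hcontent_graph_cell_le:
  fixes \<beta> \<epsilon> :: real
  assumes C: "0 < C" "\<And>n J. n1 \<le> n \<Longrightarrow> (\<Sum>j<J. sqrt (2 ^ j) * \<gamma> (1 / 2 ^ n / chain_size j)) \<le> C * gam n powr (1 - \<epsilon>)"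
    and "0 < \<epsilon>" "n0 \<le> n1"
  shows "\<exists>K>0. \<forall>w \<omega> \<eta>. n1 \<le> fst w \<longrightarrow> \<omega> \<in> space M \<longrightarrow> 2 * L * gam (fst w) \<le> \<eta> \<longrightarrow>
      graph_content \<beta> \<eta> (graph \<omega> ({0..1} \<inter> cell_set w))
      \<le> ennreal K * gauge (\<beta> - \<epsilon> * CARD('d)) (fst w) * cell_energy w \<omega>"
proof -
  let ?d = "real CARD('d)"
  \<comment> \<open>The first summand counts the lattice steps of the oscillation; the second
    absorbs the 4 lost to rounding, by means of \<open>\<rho> \<le> gam n0\<close>.\<close>
  define A where "A = 4 * ?d * C + 4 * gam n0 powr \<epsilon>"
  define K where "K = A ^ CARD('d) * (2 * ?d) ^ CARD('d) * (4 * L) powr \<beta>"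
  have d: "1 \<le> ?d" by simp
  have L': "0 < L" using L by simp
  have "0 < A" using C(1) d by (simp add: A_def add_pos_nonneg)
  then have "0 < K" using L' d by (simp add: K_def)
  have "graph_content \<beta> \<eta> (graph \<omega> ({0..1} \<inter> cell_set w))
      \<le> ennreal K * gauge (\<beta> - \<epsilon> * ?d) (fst w) * cell_energy w \<omega>"
    if n1: "n1 \<le> fst w" and \<omega>: "\<omega> \<in> space M" and \<eta>: "2 * L * gam (fst w) \<le> \<eta>" for w \<omega> \<eta>
  proof (cases "{0..1} \<inter> cell_set w = {} \<or> cell_energy w \<omega> = top")
    \<comment> \<open>An infinite energy makes the right side infinite, as its other factors are
      positive; an empty piece has content 0.\<close>
    case True
    have "0 \<le> 2 * L * gam (fst w)" using L' gam_pos[of "fst w"] by simp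
    then have "0 \<le> \<eta>" using \<eta> by linarith
    moreover have "ennreal K * gauge (\<beta> - \<epsilon> * ?d) (fst w) \<noteq> 0"
      using \<open>0 < K\<close> gam_pos[of "fst w"] by (simp add: gauge_def ennreal_mult[symmetric])
    ultimately show ?thesis using True by (auto simp: hcontent_empty ennreal_mult_top)
  next
    case False
    then obtain q where q: "cell_energy w \<omega> = ennreal q" "0 \<le> q" by (cases "cell_energy w \<omega>") auto
    have "1 \<le> cell_energy w \<omega>" by (simp add: cell_energy_def)
    then have "1 \<le> q" using q by (simp add: ennreal_1[symmetric] del: ennreal_1)
    define n where "n = fst w"
    define h where "h = (1 / 2 ^ n :: real)"
    define a where "a = of_int (snd w) / (2 ^ n :: real)"
    define \<rho> where "\<rho> = gam n"
    have n: "n0 \<le> n" using n1 assms(4) by (simp add: n_def)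
    have h: "0 < h" "h \<le> 1 / 2 ^ n0" using half_power_le[OF n] by (auto simp: h_def)
    have \<rho>: "0 < \<rho>" by (simp add: \<rho>_def gam_pos)
    have cell: "a \<le> t" "t < a + h" "cell n t = w" if "t \<in> cell_set w" for t
    proof -
      show *: "cell n t = w" using that by (simp add: cell_set_def n_def)
      then have "\<lfloor>2 ^ n * t\<rfloor> = snd w" unfolding cell_def by auto
      then have "of_int (snd w) \<le> 2 ^ n * t" "2 ^ n * t < of_int (snd w) + 1" by linarith+
      then show "a \<le> t" "t < a + h" by (simp_all add: a_def h_def field_simps)
    qed
    have cell_a: "cell n a = w" by (simp add: cell_def a_def n_def)
    obtain t0 where t0: "t0 \<in> {0..1}" "t0 \<in> cell_set w" using False by blast
    \<comment> \<open>The left end \<open>a\<close> of the cell is the time coordinate of all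
      centres, so it must lie in the unit interval; the point \<open>t0\<close> of the cell
      guarantees this.\<close>
    have "0 \<le> snd w"
    proof -
      have "snd w = \<lfloor>2 ^ n * t0\<rfloor>" using cell(3)[OF t0(2)] by (auto simp: cell_def)
      then show ?thesis using t0(1) by simp
    qed
    then have "0 \<le> a" by (simp add: a_def)
    then have a01: "a \<in> {0..1}" using cell(1)[OF t0(2)] t0(1) by simp
    define S where "S = C * \<rho> powr (1 - \<epsilon>)"
    have osc: "\<bar>X \<omega> t $ c - X \<omega> a $ c\<bar> \<le> 4 * L * (1 + sqrt (ln q)) * S" if t: "t \<in> {0..1} \<inter> cell_set w" for t c
    proof -
      have "chain_energy a h c \<omega> \<le> (\<Sum>c\<in>UNIV. chain_energy a h c \<omega>)"
        by (rule member_le_sum) auto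
      also have "... \<le> cell_energy w \<omega>" by (simp add: cell_energy_def a_def h_def n_def)
      finally have "chain_energy a h c \<omega> \<le> ennreal q" using q by simp
      then have "\<bar>path \<omega> t $ c - path \<omega> a $ c\<bar> \<le> 4 * L * (1 + sqrt (ln q)) * S"
        using t cell[of t] h \<omega> \<open>1 \<le> q\<close> C(2)[of n] n1
        by (intro chain_energy_oscillation) (auto simp: S_def \<rho>_def h_def n_def)
      then show ?thesis using t a01 by (simp add: path_eq)
    qed
    define R where "R = 2 * L * \<rho>"
    have R: "0 < R" "R \<le> \<eta>" using L' \<rho> \<eta> by (auto simp: R_def \<rho>_def n_def)
    define \<tau> where "\<tau> = R / ?d"
    have \<tau>: "0 < \<tau>" "?d * \<tau> = R" using R d by (auto simp: \<tau>_def)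
    define b where "b = 4 * L * (1 + sqrt (ln q)) * S"
    have "0 \<le> b" unfolding b_def S_def using L' \<open>1 \<le> q\<close> C(1) by (intro mult_nonneg_nonneg) auto
    define m where "m = nat \<lceil>b / \<tau>\<rceil>"
    have m: "b / \<tau> \<le> real m" "real m \<le> b / \<tau> + 1"
      using divide_nonneg_pos[OF \<open>0 \<le> b\<close> \<tau>(1)] unfolding m_def by linarith+
    obtain Z where Z: "finite Z" "card Z \<le> (2 * m + 2) ^ CARD('d)"
      "\<And>y. (\<And>c. \<bar>y $ c - X \<omega> a $ c\<bar> \<le> real m * \<tau>) \<Longrightarrow> \<exists>z\<in>Z. norm (z - y) < ?d * \<tau>"
      by (rule cube_netE[OF \<tau>(1), of m "X \<omega> a"]) blast
    have "graph_content \<beta> \<eta> (graph \<omega> ({0..1} \<inter> cell_set w))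
        \<le> of_nat (card ({a} \<times> Z)) * ennreal ((2 * R) powr \<beta>)"
    proof (rule hcontent_finite_balls_le)
      show "graph \<omega> ({0..1} \<inter> cell_set w)
          \<subseteq> (\<Union>c\<in>{a} \<times> Z. {y \<in> {0..1} \<times> UNIV. graph_metric \<delta> c y < R})"
      proof
        fix p assume "p \<in> graph \<omega> ({0..1} \<inter> cell_set w)"
        then obtain t where t: "t \<in> {0..1} \<inter> cell_set w" "p = (t, X \<omega> t)" by blast
        have "\<bar>X \<omega> t $ c - X \<omega> a $ c\<bar> \<le> real m * \<tau>" for c
        proof -
          have "b \<le> real m * \<tau>" using m(1) \<tau>(1) by (simp add: pos_divide_le_eq)
          then show ?thesis using osc[OF t(1), of c] by (simp add: b_def)
        qed
        then obtain z where z: "z \<in> Z" "norm (z - X \<omega> t) < R" using Z(3)[of "X \<omega> t"] \<tau>(2) by auto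
        have "\<delta> a t < R"
          using \<delta>_cell_less[of n a t] cell_a cell(3)[of t] t(1) n a01 by (simp add: R_def \<rho>_def)
        then have "graph_metric \<delta> (a, z) p < R" using z t by (simp add: graph_metric_def)
        then show "p \<in> (\<Union>c\<in>{a} \<times> Z. {y \<in> {0..1} \<times> UNIV. graph_metric \<delta> c y < R})"
          using z(1) t by auto
      qed
    qed (use Z(1) R a01 in auto)
    also have "... = ennreal (real (card Z) * (2 * R) powr \<beta>)"
      by (simp add: ennreal_mult ennreal_of_nat_eq_real_of_nat card_cartesian_product)
    also have "... \<le> ennreal (K * \<rho> powr (\<beta> - \<epsilon> * ?d) * q)"
    proof (rule ennreal_leI)
      have "2 * real m + 2 \<le> \<rho> powr (- \<epsilon>) * (1 + sqrt (ln q)) * A"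
      proof -
        have "b / \<tau> = 2 * ?d * (1 + sqrt (ln q)) * C * \<rho> powr (- \<epsilon>)"
        proof -
          have "\<rho> powr (1 - \<epsilon>) = \<rho> * \<rho> powr (- \<epsilon>)"
            using \<rho> powr_add[of \<rho> 1 "- \<epsilon>"] by simp
          then show ?thesis using L' \<rho> d by (simp add: b_def \<tau>_def R_def S_def)
        qed
        moreover have "4 \<le> 4 * gam n0 powr \<epsilon> * \<rho> powr (- \<epsilon>) * (1 + sqrt (ln q))"
        proof -
          have "1 \<le> gam n0 powr \<epsilon> * \<rho> powr (- \<epsilon>)"
          proof -
            have "\<rho> powr \<epsilon> \<le> gam n0 powr \<epsilon>"
              using gam_antimono[OF n] \<rho> assms(3) by (intro powr_mono2) (auto simp: \<rho>_def)
            then show ?thesis using \<rho> by (simp add: powr_minus divide_inverse[symmetric] le_divide_eq)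
          qed
          moreover have "1 \<le> 1 + sqrt (ln q)" using \<open>1 \<le> q\<close> by simp
          ultimately have "1 * 1 \<le> (gam n0 powr \<epsilon> * \<rho> powr (- \<epsilon>)) * (1 + sqrt (ln q))" by (intro mult_mono) auto
          then show ?thesis by simp
        qed
        moreover have "2 * real m + 2 \<le> 2 * (b / \<tau>) + 4" using m(2) by simp
        ultimately show ?thesis by (simp add: A_def algebra_simps)
      qed
      then have "(2 * real m + 2) ^ CARD('d) \<le> (\<rho> powr (- \<epsilon>) * (1 + sqrt (ln q)) * A) ^ CARD('d)"
        by (intro power_mono) auto
      also have "... = (\<rho> powr (- \<epsilon>)) ^ CARD('d) * A ^ CARD('d) * (1 + sqrt (ln q)) ^ CARD('d)"
        by (simp add: power_mult_distrib)
      also have "... \<le> (\<rho> powr (- \<epsilon>)) ^ CARD('d) * A ^ CARD('d) * ((2 * ?d) ^ CARD('d) * q)"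
        using \<open>0 < A\<close> \<open>1 \<le> q\<close> by (intro mult_left_mono one_plus_sqrt_ln_power_le) auto
      finally have card: "(2 * real m + 2) ^ CARD('d)
        \<le> (\<rho> powr (- \<epsilon>)) ^ CARD('d) * A ^ CARD('d) * ((2 * ?d) ^ CARD('d) * q)" .
      have "real (card Z) \<le> real ((2 * m + 2) ^ CARD('d))" using Z(2) by (simp only: of_nat_le_iff)
      also have "... = (2 * real m + 2) ^ CARD('d)" by (simp add: add.commute)
      also note card
      finally have "real (card Z) * (2 * R) powr \<beta>
          \<le> (\<rho> powr (- \<epsilon>)) ^ CARD('d) * A ^ CARD('d) * ((2 * ?d) ^ CARD('d) * q) * (2 * R) powr \<beta>"
        by (rule mult_right_mono) simp
      also have RR: "(2 * R) powr \<beta> = (4 * L) powr \<beta> * \<rho> powr \<beta>"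
        using L' \<rho> by (simp add: R_def powr_mult flip: mult.assoc)
      also have "(\<rho> powr (- \<epsilon>)) ^ CARD('d) = \<rho> powr (- (\<epsilon> * ?d))"
        using \<rho> by (simp add: powr_realpow[symmetric] powr_powr)
      also have "\<rho> powr (- (\<epsilon> * ?d)) * A ^ CARD('d) * ((2 * ?d) ^ CARD('d) * q) * ((4 * L) powr \<beta> * \<rho> powr \<beta>)
          = K * (\<rho> powr \<beta> * \<rho> powr (- (\<epsilon> * ?d))) * q"
        by (simp add: K_def mult_ac)
      also have "\<rho> powr \<beta> * \<rho> powr (- (\<epsilon> * ?d)) = \<rho> powr (\<beta> - \<epsilon> * ?d)" by (simp add: powr_add[symmetric])
      finally show "real (card Z) * (2 * R) powr \<beta> \<le> K * \<rho> powr (\<beta> - \<epsilon> * ?d) * q"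
        unfolding RR .
    qed
    also have "... = ennreal K * gauge (\<beta> - \<epsilon> * ?d) (fst w) * cell_energy w \<omega>"
      using \<open>0 < K\<close> q by (simp add: gauge_def \<rho>_def n_def ennreal_mult)
    finally show ?thesis .
  qed
  with \<open>0 < K\<close> show ?thesis by blast
qed

text \<open>A cover of \<open>E\<close> of weight at most \<open>(1/2) ^ N\<close> at the shifted
  exponent bounds the graph content by a random quantity whose mean is at most a constant times
  \<open>(1/2) ^ N\<close>, because the mean energy has a bound common to all cells used.
  Summability over \<open>N\<close> makes these quantities small almost surely.\<close>

theorem graph_hmeasure_eq_0:
  fixes \<beta> \<epsilon> :: real
  assumes "condition_C \<gamma> \<epsilon>" "0 < \<epsilon>" "\<epsilon> * CARD('d) < \<beta>" and E: "E \<subseteq> {0..1}"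
    and null: "hmeasure {0..1} \<delta> (\<beta> - \<epsilon> * CARD('d)) E = 0"
  shows "AE \<omega> in M. graph_hmeasure \<beta> (graph \<omega> E) = 0"
proof -
  let ?\<theta> = "\<beta> - \<epsilon> * CARD('d)"
  let ?h = "\<lambda>\<eta> \<omega> E. graph_content \<beta> \<eta> (graph \<omega> E)"
  have \<theta>: "0 < ?\<theta>" using assms(3) by simp
  have L': "0 < L" using L by simp
  obtain C n1 where C: "0 < C" "n0 \<le> n1"
    "\<And>n J. n1 \<le> n \<Longrightarrow> (\<Sum>j<J. sqrt (2 ^ j) * \<gamma> (1 / 2 ^ n / chain_size j)) \<le> C * gam n powr (1 - \<epsilon>)"
    by (rule entropy_sum_le[OF assms(1,2)]) blast
  obtain K where K: "0 < K" "\<And>w \<omega> \<eta>. n1 \<le> fst w \<Longrightarrow> \<omega> \<in> space M \<Longrightarrow> 2 * L * gam (fst w) \<le> \<eta> \<Longrightarrow>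
      ?h \<eta> \<omega> ({0..1} \<inter> cell_set w) \<le> ennreal K * gauge ?\<theta> (fst w) * cell_energy w \<omega>"
    using hcontent_graph_cell_le[OF C(1,3) assms(2) C(2), of \<beta>] by blast
  have net: "net_content (gauge ?\<theta>) E = 0" by (rule net_content_eq_0_if_hmeasure[OF null \<theta>])
  have "\<exists>W. E \<subseteq> net_cover W \<and> weight (gauge ?\<theta>) W \<le> ennreal ((1/2) ^ N) \<and>
      (\<forall>w\<in>W. n1 \<le> fst w \<and> 2 * L * gam (fst w) \<le> (1/2) ^ N)" for N
  proof -
    \<comment> \<open>The first bound forces levels of at least \<open>n1\<close>, where the entropy
      estimate holds; the second keeps the ball radii \<open>2 * L * gam n\<close> within the mesh
      \<open>(1/2) ^ N\<close>.\<close>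
    let ?\<eta> = "min (gam n1 / 2) ((1/2) ^ N / (2 * L))"
    have "0 < ?\<eta>" using gam_pos[of n1] L' by simp
    then obtain W where W: "E \<subseteq> net_cover W" "weight (gauge ?\<theta>) W \<le> ennreal ((1/2) ^ N)"
      "\<And>w. w \<in> W \<Longrightarrow> n0 \<le> fst w \<and> gam (fst w) \<le> ?\<eta>"
      by (rule fine_net_coverE[OF net \<theta>, of "(1/2) ^ N" ?\<eta>, rotated]) auto
    have "n1 \<le> fst w \<and> 2 * L * gam (fst w) \<le> (1/2) ^ N" if "w \<in> W" for w
    proof
      have le: "gam (fst w) \<le> gam n1 / 2" "gam (fst w) \<le> (1/2) ^ N / (2 * L)" using W(3)[OF that] by auto
      show "n1 \<le> fst w"
      proof (rule ccontr)
        assume "\<not> n1 \<le> fst w"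
        then have "gam n1 \<le> gam (fst w)" by (intro gam_antimono) simp
        then show False using le(1) gam_pos[of n1] by simp
      qed
      show "2 * L * gam (fst w) \<le> (1/2) ^ N" using le(2) L' by (simp add: pos_le_divide_eq mult_ac)
    qed
    then show ?thesis using W by blast
  qed
  then obtain W where W: "\<And>N. E \<subseteq> net_cover (W N)"
      "\<And>N. weight (gauge ?\<theta>) (W N) \<le> ennreal ((1/2) ^ N)"
      "\<And>N w. w \<in> W N \<Longrightarrow> n1 \<le> fst w" "\<And>N w. w \<in> W N \<Longrightarrow> 2 * L * gam (fst w) \<le> (1/2) ^ N"
    by metis
  define H where "H N \<omega> = (\<integral>\<^sup>+ w. ennreal K * gauge ?\<theta> (fst w) * cell_energy w \<omega> \<partial>count_space (W N))" for N \<omega>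
  have h_le: "?h ((1/2) ^ N) \<omega> E \<le> H N \<omega>" if "\<omega> \<in> space M" for N \<omega>
  proof -
    have "?h ((1/2) ^ N) \<omega> E \<le> graph_content \<beta> ((1/2) ^ N)
        (\<Union>w\<in>W N. graph \<omega> ({0..1} \<inter> cell_set w))"
      using W(1)[of N] E unfolding net_cover_eq image_UN[symmetric] by (intro hcontent_mono image_mono) blast
    also have "... \<le> (\<integral>\<^sup>+ w. ?h ((1/2) ^ N) \<omega> ({0..1} \<inter> cell_set w) \<partial>count_space (W N))"
      by (rule hcontent_UN_countable_le) auto
    also have "... \<le> H N \<omega>"
      unfolding H_def using W(3,4) that by (intro nn_integral_mono K(2)) auto
    finally show ?thesis .
  qed
  have sf: "sigma_finite_measure (count_space (W N))" for N by (rule sigma_finite_measure_count_space)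
  have meas: "(\<lambda>p. ennreal K * gauge ?\<theta> (fst (fst p)) * cell_energy (fst p) (snd p))
      \<in> borel_measurable (count_space (W N) \<Otimes>\<^sub>M M)" for N
    by (rule measurable_pair_measure_countable1) (auto intro!: borel_measurable_times)
  have H_meas [measurable]: "H N \<in> borel_measurable M" for N
    using sigma_finite_measure.borel_measurable_nn_integral_fst[OF sf measurable_pair_swap[OF meas]]
    unfolding H_def[abs_def] by simp
  have H_le: "(\<integral>\<^sup>+ \<omega>. H N \<omega> \<partial>M) \<le> ennreal (K * (1 + 2 * CARD('d)) * (1/2) ^ N)" for N
  proof -
    interpret P: pair_sigma_finite "count_space (W N)" M
      using sf sigma_finite_measure_axioms by (rule pair_sigma_finite.intro)
    have "(\<integral>\<^sup>+ \<omega>. H N \<omega> \<partial>M)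
        = (\<integral>\<^sup>+ w. (\<integral>\<^sup>+ \<omega>. ennreal K * gauge ?\<theta> (fst w) * cell_energy w \<omega> \<partial>M) \<partial>count_space (W N))"
      unfolding H_def using P.Fubini[OF meas] by simp
    also have "... \<le> (\<integral>\<^sup>+ w. ennreal K * ennreal (1 + 2 * CARD('d)) * gauge ?\<theta> (fst w) \<partial>count_space (W N))"
    proof (rule nn_integral_mono)
      fix w assume "w \<in> space (count_space (W N))"
      then have "n0 \<le> fst w" using W(3)[of w N] C(2) by simp
      have "(\<integral>\<^sup>+ \<omega>. ennreal K * gauge ?\<theta> (fst w) * cell_energy w \<omega> \<partial>M)
          = ennreal K * gauge ?\<theta> (fst w) * (\<integral>\<^sup>+ \<omega>. cell_energy w \<omega> \<partial>M)"
        by (rule nn_integral_cmult) measurable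
      also have "... \<le> ennreal K * gauge ?\<theta> (fst w) * ennreal (1 + 2 * CARD('d))"
        by (intro mult_left_mono cell_energy_le \<open>n0 \<le> fst w\<close>) simp
      finally show "(\<integral>\<^sup>+ \<omega>. ennreal K * gauge ?\<theta> (fst w) * cell_energy w \<omega> \<partial>M)
          \<le> ennreal K * ennreal (1 + 2 * CARD('d)) * gauge ?\<theta> (fst w)" by (simp add: mult_ac)
    qed
    also have "... = ennreal K * ennreal (1 + 2 * CARD('d)) * weight (gauge ?\<theta>) (W N)"
      by (simp add: nn_integral_cmult emeasure_net_weight)
    also have "... \<le> ennreal K * ennreal (1 + 2 * CARD('d)) * ennreal ((1/2) ^ N)"
      by (intro mult_left_mono W(2)) simp
    also have "... = ennreal (K * (1 + 2 * CARD('d)) * (1/2) ^ N)"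
    proof -
      have "0 \<le> K" "0 \<le> real (1 + 2 * CARD('d))" using K(1) by auto
      from ennreal_mult[OF this, symmetric] show ?thesis
        using \<open>0 \<le> K\<close> by (simp only:) (rule ennreal_mult[symmetric], auto)
    qed
    finally show ?thesis .
  qed
  have "(\<integral>\<^sup>+ \<omega>. (\<Sum>N. H N \<omega>) \<partial>M) = (\<Sum>N. \<integral>\<^sup>+ \<omega>. H N \<omega> \<partial>M)" by (rule nn_integral_suminf) measurable
  also have "... \<le> (\<Sum>N. ennreal (K * (1 + 2 * CARD('d)) * (1/2) ^ N))" by (intro suminf_le allI H_le) auto
  also have "... = ennreal (K * (1 + 2 * CARD('d)) * 2)"
    using sums_mult[OF geometric_sums[of "1/2 :: real"], of "K * (1 + 2 * CARD('d))"] K(1)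
    by (intro suminf_ennreal_eq) auto
  also have "... < top" by simp
  finally have "AE \<omega> in M. (\<Sum>N. H N \<omega>) \<noteq> \<infinity>" by (intro nn_integral_PInf_AE) auto
  then show ?thesis
    using AE_space
  proof eventually_elim
    case (elim \<omega>)
    show ?case
    proof (rule hmeasure_eq_0I)
      fix \<eta> e :: real assume \<eta>: "0 < \<eta>" and e: "0 < e"
      obtain N0 :: nat where N0: "(1/2) ^ N0 < \<eta>" using real_arch_pow_inv[OF \<eta>, of "1/2"] by auto
      \<comment> \<open>A finite sum cannot have all terms from \<open>N0\<close> on above
        \<open>e\<close>, so some cover that is fine enough is also light.\<close>
      have "\<exists>N\<ge>N0. H N \<omega> \<le> ennreal e"
      proof (rule ccontr)
        assume "\<not> ?thesis"
        then have "ennreal e \<le> H N \<omega>" if "N0 \<le> N" for N using that by (meson linear)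
        then have *: "ennreal e * indicator {N0..} N \<le> H N \<omega>" for N
          by (auto split: split_indicator)
        have "ennreal e * emeasure (count_space UNIV) {N0..} = (\<integral>\<^sup>+ N. ennreal e * indicator {N0..} N \<partial>count_space UNIV)"
          by (rule nn_integral_cmult_indicator[symmetric]) simp
        also have "... = (\<Sum>N. ennreal e * indicator {N0..} N)" by (rule nn_integral_count_space_nat)
        also have "... \<le> (\<Sum>N. H N \<omega>)" using * by (intro suminf_le) auto
        finally show False using elim(1) e
          by (simp add: emeasure_count_space_infinite infinite_Ici ennreal_mult_top top_unique)
      qed
      then obtain N where N: "N0 \<le> N" "H N \<omega> \<le> ennreal e" by blast
      have "(1/2) ^ N \<le> ((1/2) ^ N0 :: real)" using N(1) by (intro power_decreasing) auto
      then have "?h \<eta> \<omega> E \<le> ?h ((1/2) ^ N) \<omega> E" using N0 by (intro hcontent_antimono_radius) linarith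
      also have "... \<le> H N \<omega>" by (rule h_le[OF elim(2)])
      also note N(2)
      finally show "?h \<eta> \<omega> E \<le> ennreal e" .
    qed
  qed
qed

text \<open>One null set is discarded per rational exponent; monotonicity of null sets in the
  exponent then reaches every real \<beta>.\<close>

theorem graph_dim_le:
  assumes "condition_C \<gamma> \<epsilon>" "0 < \<epsilon>" and E: "E \<subseteq> {0..1}"
  shows "AE \<omega> in M. graph_dim (graph \<omega> E)
    \<le> hdim {0..1} \<delta> E + ereal (\<epsilon> * CARD('d))"
proof -
  let ?x = "hdim {0..1} \<delta> E + ereal (\<epsilon> * CARD('d))"
  let ?m = "\<lambda>\<beta> \<omega>. graph_hmeasure \<beta> (graph \<omega> E)"
  have "AE \<omega> in M. \<forall>q::rat. ?x < ereal (of_rat q) \<longrightarrow> ?m (of_rat q) \<omega> = 0"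
  proof (subst AE_all_countable, intro allI AE_impI)
    fix q :: rat assume q: "?x < ereal (of_rat q)"
    have less: "hdim {0..1} \<delta> E < ereal (of_rat q - \<epsilon> * CARD('d))"
      using q by (cases "hdim {0..1} \<delta> E") auto
    have "0 < of_rat q - \<epsilon> * CARD('d)" using le_less_trans[OF hdim_nonneg less] by simp
    then show "AE \<omega> in M. ?m (of_rat q) \<omega> = 0"
      using hmeasure_eq_0_of_hdim_less[OF less] by (intro graph_hmeasure_eq_0[OF assms(1,2) _ E]) auto
  qed
  then show ?thesis
  proof eventually_elim
    case (elim \<omega>)
    show ?case
    proof (rule hdim_leI)
      show "0 \<le> ?x" using hdim_nonneg[of "{0..1}" \<delta> E] assms(2) by (intro add_nonneg_nonneg) auto
    next
      fix \<beta> :: real assume "?x < ereal \<beta>"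
      then obtain y where y: "?x < ereal y" "ereal y < ereal \<beta>" using ereal_dense2 by blast
      then obtain q where q: "y < of_rat q" "of_rat q < \<beta>" using of_rat_dense[of y \<beta>] by auto
      have "?x < ereal (of_rat q)" using y(1) q(1) by (metis ereal_less_eq(3) less_imp_le less_le_trans)
      then show "?m \<beta> \<omega> = 0" using elim q(2) by (auto intro: hmeasure_eq_0_mono[where \<beta> = "of_rat q"])
    qed
  qed
qed

lemma image_dim_le_graph_dim:
  "hdim UNIV dist (X \<omega> ` E) \<le> graph_dim (graph \<omega> E)"
proof (rule hdim_mono)
  fix \<beta> :: real
  assume "graph_hmeasure \<beta> (graph \<omega> E) = 0"
  then have "hmeasure UNIV dist \<beta> (snd ` (graph \<omega> E)) = 0"
    by (rule hmeasure_image_eq_0) (auto simp: graph_metric_def dist_norm)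
  then show "hmeasure UNIV dist \<beta> (X \<omega> ` E) = 0" by (simp add: image_image)
qed

lemma image_dim_le_CARD:
  assumes "\<omega> \<in> space M" "E \<subseteq> {0..1}"
  shows "hdim UNIV dist (X \<omega> ` E) \<le> ereal CARD('d)"
proof (rule hdim_leI)
  have "compact (X \<omega> ` {0..1})" using cont assms(1) by (intro compact_continuous_image) auto
  then have "bounded (X \<omega> ` E)"
    using assms(2) by (meson bounded_subset compact_imp_bounded image_mono)
  then show "hmeasure UNIV dist \<beta> (X \<omega> ` E) = 0" if "ereal CARD('d) < ereal \<beta>" for \<beta>
    using that by (intro hmeasure_bounded_eq_0) auto
qed simp

end

text \<open>Continuity on the closed interval and the right limit together force
  \<open>\<gamma> 0 = 0\<close>; the radius shrinks to a power of 1/2 so that it is a cell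
  length.\<close>

lemma admissible_gammaE:
  assumes "admissible_gamma \<gamma>"
  obtains n0 where "continuous_on {0..1 / 2 ^ n0} \<gamma>" "strict_mono_on {0..1 / 2 ^ n0} \<gamma>" "\<gamma> 0 = 0"
proof -
  obtain r where r: "0 < r" "continuous_on {0..r} \<gamma>" "strict_mono_on {0..r} \<gamma>" and lim: "(\<gamma> \<longlongrightarrow> 0) (at_right 0)"
    using assms unfolding admissible_gamma_def by blast
  obtain n0 :: nat where n0: "(1/2) ^ n0 < r" using real_arch_pow_inv[OF r(1), of "1/2"] by auto
  have "{0..1 / 2 ^ n0} \<subseteq> {0..r}" using n0 by (auto simp: power_one_over)
  moreover have "\<gamma> 0 = 0"
  proof -
    have "(\<gamma> \<longlongrightarrow> \<gamma> 0) (at 0 within {0..r})" using r by (simp add: continuous_on)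
    then have "(\<gamma> \<longlongrightarrow> \<gamma> 0) (at_right 0)" using r(1) by (simp add: at_within_Icc_at_right)
    then show ?thesis using lim by (intro tendsto_unique[of "at_right 0"]) auto
  qed
  ultimately show ?thesis
    using that[of n0] r by (meson continuous_on_subset monotone_on_subset)
qed

theorem theorem3p2:
  fixes M :: "'a measure"
    and X :: "'a \<Rightarrow> real \<Rightarrow> real ^ 'd"
    and X0 :: "'a \<Rightarrow> real \<Rightarrow> real"
    and \<gamma> :: "real \<Rightarrow> real"
  assumes "prob_space M"
    and cont: "\<forall>\<omega>\<in>space M. continuous_on {0..1} (X \<omega>)"
    and X0_meas: "(\<lambda>\<omega>. restrict (X0 \<omega>) {0..1}) \<in> M \<rightarrow>\<^sub>M (\<Pi>\<^sub>M t\<in>{0..1}. borel)"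
    and X0_gauss: "centered_gaussian_process M X0"
    and indep: "prob_space.indep_vars M (\<lambda>_. \<Pi>\<^sub>M t\<in>{0..1}. borel)
                  (\<lambda>i \<omega>. restrict (\<lambda>t. X \<omega> t $ i) {0..1}) UNIV"
    and ident: "\<forall>i. distr M (\<Pi>\<^sub>M t\<in>{0..1}. borel) (\<lambda>\<omega>. restrict (\<lambda>t. X \<omega> t $ i) {0..1})
                   = distr M (\<Pi>\<^sub>M t\<in>{0..1}. borel) (\<lambda>\<omega>. restrict (X0 \<omega>) {0..1})"
    and gam: "admissible_gamma \<gamma>"
    and Gamma: "condition_Gamma M X0 \<gamma>"
  shows "(\<forall>E. E \<in> sets borel \<and> E \<subseteq> {0..1} \<longrightarrow>
            (AE \<omega> in M. min (ereal (real CARD('d))) (hdim {0..1} (can_metric M X0) E)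
                          \<le> hdim UNIV dist (X \<omega> ` E)) \<and>
            (AE \<omega> in M. hdim {0..1} (can_metric M X0) E
                          \<le> hdim ({0..1} \<times> UNIV) (graph_metric (can_metric M X0))
                               ((\<lambda>t. (t, X \<omega> t)) ` E)))
       \<and> (\<forall>\<epsilon>. 0 < \<epsilon> \<and> \<epsilon> < 1 \<and> condition_C \<gamma> \<epsilon> \<longrightarrow>
           (\<forall>E. E \<in> sets borel \<and> E \<subseteq> {0..1} \<longrightarrow>
              (AE \<omega> in M. min (hdim {0..1} (can_metric M X0) E) (ereal (real CARD('d)))
                             \<le> hdim UNIV dist (X \<omega> ` E)
                          \<and> hdim UNIV dist (X \<omega> ` E)
                             \<le> min (ereal (real CARD('d)))
                                   (hdim {0..1} (can_metric M X0) E + ereal (\<epsilon> * real CARD('d)))) \<and>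
              (AE \<omega> in M. hdim {0..1} (can_metric M X0) E
                             \<le> hdim ({0..1} \<times> UNIV) (graph_metric (can_metric M X0))
                                  ((\<lambda>t. (t, X \<omega> t)) ` E)
                          \<and> hdim ({0..1} \<times> UNIV) (graph_metric (can_metric M X0))
                                  ((\<lambda>t. (t, X \<omega> t)) ` E)
                             \<le> hdim {0..1} (can_metric M X0) E + ereal (\<epsilon> * real CARD('d)))))"
proof -
  interpret iid_gaussian M X X0
    by (rule iid_gaussian.intro[OF assms(1)], unfold_locales) (fact cont X0_meas X0_gauss indep ident)+
  obtain n0 where n0: "continuous_on {0..1 / 2 ^ n0} \<gamma>" "strict_mono_on {0..1 / 2 ^ n0} \<gamma>" "\<gamma> 0 = 0"
    using admissible_gammaE[OF gam] by blast
  obtain l where l: "1 \<le> l" and bounds: "\<And>s t. s \<in> {0..1} \<Longrightarrow> t \<in> {0..1} \<Longrightarrow>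
      \<gamma> \<bar>t - s\<bar> / sqrt l \<le> \<delta> s t \<and> \<delta> s t \<le> sqrt l * \<gamma> \<bar>t - s\<bar>"
    using Gamma unfolding condition_Gamma_def by blast
  \<comment> \<open>Both inequalities of Condition (Gamma) carry the factor \<open>sqrt l\<close>,
    which becomes \<open>L\<close>.\<close>
  interpret gaussian_gauge M X X0 \<gamma> "sqrt l" n0
  proof unfold_locales
    show "\<gamma> \<bar>s - t\<bar> \<le> sqrt l * \<delta> s t" if "s \<in> {0..1}" "t \<in> {0..1}" for s t
      using bounds[OF that] l by (simp add: pos_divide_le_eq abs_minus_commute mult.commute)
    show "\<delta> s t \<le> sqrt l * \<gamma> \<bar>s - t\<bar>" if "s \<in> {0..1}" "t \<in> {0..1}" for s t
      using bounds[OF that] by (simp add: abs_minus_commute)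
  qed (use l n0 can_metric_sym can_metric_triangle in auto)
  show ?thesis
  proof (intro conjI allI impI; elim conjE)
    fix E :: "real set" assume E: "E \<in> sets borel" "E \<subseteq> {0..1}"
    show "AE \<omega> in M. min (ereal (real CARD('d))) (hdim {0..1} \<delta> E) \<le> hdim UNIV dist (X \<omega> ` E)"
      by (rule image_dim_ge[OF E])
    show "AE \<omega> in M. hdim {0..1} \<delta> E \<le> hdim ({0..1} \<times> UNIV) (graph_metric \<delta>) ((\<lambda>t. (t, X \<omega> t)) ` E)"
      by (rule AE_I2) (rule hdim_graph_ge[OF E(2)])
  next
    fix \<epsilon> :: real and E :: "real set"
    assume \<epsilon>: "0 < \<epsilon>" "condition_C \<gamma> \<epsilon>" and E: "E \<in> sets borel" "E \<subseteq> {0..1}"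
    have graph: "AE \<omega> in M. hdim ({0..1} \<times> UNIV) (graph_metric \<delta>) ((\<lambda>t. (t, X \<omega> t)) ` E)
        \<le> hdim {0..1} \<delta> E + ereal (\<epsilon> * real CARD('d))"
      by (rule graph_dim_le[OF \<epsilon>(2,1) E(2)])
    show "AE \<omega> in M. min (hdim {0..1} \<delta> E) (ereal (real CARD('d))) \<le> hdim UNIV dist (X \<omega> ` E) \<and>
        hdim UNIV dist (X \<omega> ` E) \<le> min (ereal (real CARD('d))) (hdim {0..1} \<delta> E + ereal (\<epsilon> * real CARD('d)))"
      using graph image_dim_ge[OF E] AE_space
    proof eventually_elim
      case (elim \<omega>)
      have "hdim UNIV dist (X \<omega> ` E) \<le> hdim {0..1} \<delta> E + ereal (\<epsilon> * real CARD('d))"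
        using image_dim_le_graph_dim elim(1) by (rule order_trans)
      then show ?case using elim(2) image_dim_le_CARD[OF elim(3) E(2)] by (simp add: min.commute)
    qed
    show "AE \<omega> in M. hdim {0..1} \<delta> E \<le> hdim ({0..1} \<times> UNIV) (graph_metric \<delta>) ((\<lambda>t. (t, X \<omega> t)) ` E) \<and>
        hdim ({0..1} \<times> UNIV) (graph_metric \<delta>) ((\<lambda>t. (t, X \<omega> t)) ` E) \<le> hdim {0..1} \<delta> E + ereal (\<epsilon> * real CARD('d))"
      using graph by eventually_elim (simp add: hdim_graph_ge[OF E(2)])
  qed
qed

end
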